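(* Let $i\colon N\to M$ be a subdivision of finite simplicial complexes, and equip $C_*(M)$ with an inner product. Then there exist subspaces $V_k\subset C_k(M)$ such that, for all $k$, $$C_k(M)=(\operatorname{im} i_*\oplus\partial V_{k+1})\oplus_\perp V_k,$$ where $\operatorname{im} i_*=i_*C_k(N)$ and $\oplus_\perp$ denotes an orthogonal direct sum with respect to the given inner product.
   Context: $C_k(\cdot)$ denotes simplicial $k$-chains with real coefficients, with boundary map $\partial$. A subdivision $i\colon N\to M$ induces the chain map $i_*\colon C_*(N)\to C_*(M)$ sending an oriented simplex of $N$ to the sum of the compatibly oriented simplices of $M$ of the same dimension subdividing it; $i_*$ is injective and induces an isomorphism on homology. An inner product on $C_*(M)$ means an inner product on each $C_k(M)$. *)

theory Defs
  imports "HOL-Analysis.Analysis" "HOL-Analysis.Finite_Function_Topology" "HOL-Combinatorics.Permutations" "Jordan_Normal_Form.Determinant"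
begin

section \<open>Subdivisions\<close>

text \<open>
  Complexes are geometric: \<^const>\<open>simplicial_complex\<close> is a finite, face-closed set of simplices
  in a Euclidean space that meet in common faces; the empty face is a member (of dimension -1) of
  every nonempty complex.  The subdivision map is the identity of the common polyhedron
  \<^term>\<open>\<Union>N = \<Union>M\<close>.
\<close>

definition subdivision :: "'a::euclidean_space set set \<Rightarrow> 'a set set \<Rightarrow> bool" where
  "subdivision N M \<longleftrightarrow> simplicial_complex N \<and> simplicial_complex M \<and>
     (\<forall>T\<in>M. \<exists>S\<in>N. T \<subseteq> S) \<and> (\<forall>S\<in>N. \<exists>F. F \<subseteq> M \<and> S = \<Union>F)"


section \<open>Real simplicial chains\<close>

definition ordered_simplex :: "nat \<Rightarrow> 'a::euclidean_space set set \<Rightarrow> 'a list \<Rightarrow> bool" where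
  "ordered_simplex k K vs \<longleftrightarrow> length vs = Suc k \<and> distinct vs \<and>
     \<not> affine_dependent (set vs) \<and> convex hull set vs \<in> K"

type_synonym 'a chain = "'a list \<Rightarrow>\<^sub>0 real"

text \<open>
  A chain is an alternating function of the ordered simplices.  The oriented simplex
  $[v_0,\dots,v_k]$ has value 1 on the even and -1 on the odd reorderings of
  $v_0,\dots,v_k$; hence it only changes sign when its vertices are permuted oddly.
\<close>

definition oriented_simplex :: "'a list \<Rightarrow> 'a chain" where
  "oriented_simplex vs =
     (\<Sum>p | p permutes {..<length vs}. of_int (sign p) *\<^sub>R Poly_Mapping.single (permute_list p vs) 1)"

definition simplicial_chains :: "nat \<Rightarrow> 'a::euclidean_space set set \<Rightarrow> 'a chain set" where
  "simplicial_chains k K = span {oriented_simplex vs |vs. ordered_simplex k K vs}"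

text \<open>
  The linear map that sends every oriented simplex \<^term>\<open>oriented_simplex vs\<close> to \<^term>\<open>f vs\<close>, where
  \<^term>\<open>f\<close> changes by the sign when the vertices are permuted.  Each of the $(k+1)!$ orderings of a
  $k$-simplex contributes the same amount, which explains the denominator; see
  \<open>linear_extension_oriented_simplex\<close> below.
\<close>

definition linear_extension :: "('a list \<Rightarrow> 'a chain) \<Rightarrow> 'a chain \<Rightarrow> 'a chain" where
  "linear_extension f c =
     (\<Sum>vs\<in>Poly_Mapping.keys c. (Poly_Mapping.lookup c vs / fact (length vs)) *\<^sub>R f vs)"

text \<open>The guard makes the boundary of a 0-chain vanish (there is no augmentation).\<close>

definition boundary_chain :: "'a chain \<Rightarrow> 'a chain" where
  "boundary_chain = linear_extension (\<lambda>vs. if length vs \<le> 1 then 0 else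
     (\<Sum>j<length vs. (-1) ^ j *\<^sub>R oriented_simplex (take j vs @ drop (Suc j) vs)))"

text \<open>
  Two ordered simplices of equal dimension, the second contained in the first, are compatibly
  oriented iff the edge vectors $w_{j+1}-w_0$ and $v_{i+1}-v_0$ are bases of the same orientation
  of the common direction space.  In dimension 0 the matrix is empty, with determinant 1.
\<close>

definition compatibly_oriented :: "'a::euclidean_space list \<Rightarrow> 'a list \<Rightarrow> bool" where
  "compatibly_oriented vs ws \<longleftrightarrow> length ws = length vs \<and>
     (\<exists>A. (\<forall>j < length vs - 1. ws ! Suc j - ws ! 0 =
              (\<Sum>i < length vs - 1. A i j *\<^sub>R (vs ! Suc i - vs ! 0))) \<and>
          Determinant.det (mat (length vs - 1) (length vs - 1) (\<lambda>(i, j). A i j)) > (0::real))"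

text \<open>
  The sum ranges over a set of chains, so every simplex of \<^term>\<open>M\<close> contained in
  the convex hull of \<^term>\<open>set vs\<close> contributes once, all its compatible orderings being the same
  chain.
\<close>

definition subdivision_chain :: "'a::euclidean_space set set \<Rightarrow> 'a chain \<Rightarrow> 'a chain" where
  "subdivision_chain M = linear_extension (\<lambda>vs.
     \<Sum>{oriented_simplex ws |ws. ordered_simplex (length vs - 1) M ws \<and>
         convex hull set ws \<subseteq> convex hull set vs \<and> compatibly_oriented vs ws})"

lemma lookup_scaleR_chain:
  "Poly_Mapping.lookup (r *\<^sub>R c) vs = r * Poly_Mapping.lookup (c :: 'a chain) vs"
proof -
  have "finite {vs. r * Poly_Mapping.lookup c vs \<noteq> 0}"
    by (rule finite_subset[OF _ finite_keys[of c]]) (auto simp: in_keys_iff)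
  then show ?thesis
    by (simp add: scaleR_poly_mapping_def Abs_poly_mapping_inverse)
qed

lemma linear_linear_extension: "linear (linear_extension f)"
proof -
  have eq: "linear_extension f c = (\<Sum>vs\<in>B. (Poly_Mapping.lookup c vs / fact (length vs)) *\<^sub>R f vs)"
    if "finite B" "Poly_Mapping.keys c \<subseteq> B" for B c
    unfolding linear_extension_def using that
    by (intro sum.mono_neutral_left) (auto simp: in_keys_iff)
  show ?thesis
  proof (rule linearI)
    fix c d :: "'a chain"
    let ?B = "Poly_Mapping.keys c \<union> Poly_Mapping.keys d"
    show "linear_extension f (c + d) = linear_extension f c + linear_extension f d"
      by (subst (1 2 3) eq[of ?B])
         (auto simp: lookup_add add_divide_distrib scaleR_left_distrib sum.distrib
               dest: subsetD[OF Poly_Mapping.keys_add])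
  next
    fix r and c :: "'a chain"
    have "Poly_Mapping.keys (r *\<^sub>R c) \<subseteq> Poly_Mapping.keys c"
      by (auto simp: in_keys_iff lookup_scaleR_chain)
    then show "linear_extension f (r *\<^sub>R c) = r *\<^sub>R linear_extension f c"
      by (subst (1 2) eq[of "Poly_Mapping.keys c"]) (auto simp: scaleR_sum_right lookup_scaleR_chain)
  qed
qed

lemma linear_extension_oriented_simplex:
  assumes "\<And>p. p permutes {..<length vs} \<Longrightarrow> f (permute_list p vs) = of_int (sign p) *\<^sub>R f vs"
  shows "linear_extension f (oriented_simplex vs) = f vs"
proof -
  have single: "linear_extension f (Poly_Mapping.single ws 1) = (1 / fact (length ws)) *\<^sub>R f ws" for ws
    by (simp add: linear_extension_def)
  have "linear_extension f (oriented_simplex vs) =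
      (\<Sum>p | p permutes {..<length vs}.
         of_int (sign p) *\<^sub>R linear_extension f (Poly_Mapping.single (permute_list p vs) 1))"
    unfolding oriented_simplex_def
    by (simp add: linear_sum[OF linear_linear_extension] linear_scale[OF linear_linear_extension])
  also have "\<dots> = (\<Sum>p | p permutes {..<length vs}. (1 / fact (length vs)) *\<^sub>R f vs)"
    by (rule sum.cong) (auto simp: single assms sign_def)
  also have "\<dots> = (of_nat (card {p. p permutes {..<length vs}}) / fact (length vs)) *\<^sub>R f vs"
    by (simp add: sum_constant_scaleR)
  also have "\<dots> = f vs"
    by (simp add: card_permutations[OF refl])
  finally show ?thesis .
qed


section \<open>Inner products and direct sums of subspaces\<close>

definition inner_product_on :: "'b::real_vector set \<Rightarrow> ('b \<Rightarrow> 'b \<Rightarrow> real) \<Rightarrow> bool" where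
  "inner_product_on C g \<longleftrightarrow>
     (\<forall>x\<in>C. \<forall>y\<in>C. g x y = g y x) \<and>
     (\<forall>x\<in>C. \<forall>y\<in>C. \<forall>z\<in>C. g (x + y) z = g x z + g y z) \<and>
     (\<forall>r. \<forall>x\<in>C. \<forall>y\<in>C. g (r *\<^sub>R x) y = r * g x y) \<and>
     (\<forall>x\<in>C. x \<noteq> 0 \<longrightarrow> g x x > 0)"

definition is_direct_sum :: "'b::real_vector set \<Rightarrow> 'b set \<Rightarrow> 'b set \<Rightarrow> bool" where
  "is_direct_sum W A B \<longleftrightarrow> subspace A \<and> subspace B \<and> W = A + B \<and> A \<inter> B = {0}"

definition is_orthogonal_direct_sum ::
    "('b \<Rightarrow> 'b \<Rightarrow> real) \<Rightarrow> 'b::real_vector set \<Rightarrow> 'b set \<Rightarrow> 'b set \<Rightarrow> bool" where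
  "is_orthogonal_direct_sum g W A B \<longleftrightarrow>
     is_direct_sum W A B \<and> (\<forall>a\<in>A. \<forall>b\<in>B. g a b = 0)"

end

theory Submission
  imports Defs
begin

text \<open>
  The spaces \<open>V\<^sub>k\<close> are defined downwards from the top degree, \<open>V\<^sub>k\<close> being the orthogonal complement of
  \<open>im i\<^sub>* + \<partial>V\<^sub>k\<^sub>+\<^sub>1\<close>. That the latter sum is direct follows from the acyclicity of \<open>C\<^sub>*(M) / im i\<^sub>*\<close>: if \<open>v\<close> in
  \<open>V\<^sub>k\<^sub>+\<^sub>1\<close> has its boundary in \<open>im i\<^sub>*\<close>, then \<open>v\<close> is a subdivided chain plus the boundary of some \<open>y\<close>;
  decomposing \<open>y\<close> in degree \<open>k + 2\<close> puts \<open>v\<close> into \<open>im i\<^sub>* + \<partial>V\<^sub>k\<^sub>+\<^sub>2\<close>, which is orthogonal to \<open>v\<close>.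

  The quotient is acyclic because \<open>i\<^sub>*\<close> has a homotopy inverse induced by a map of vertices, sending a
  vertex of \<open>M\<close> to a vertex of the smallest simplex of \<open>N\<close> around it. The homotopy comes from acyclic
  carriers, since the part of \<open>M\<close> inside a simplex of \<open>N\<close> is acyclic. For this, chains of \<open>M\<close> are
  compared with the chains on all finite point sets of small diameter, and the latter are contracted
  linearly. That \<open>i\<^sub>*\<close> commutes with the boundary amounts to counting, for a codimension one
  simplex inside a simplex of \<open>N\<close>, its cofaces on either side.
\<close>

section \<open>Alternating chains\<close>

text \<open>What is needed is that every relative cycle of \<open>M\<close> modulo
  \<open>im i\<^sub>*\<close> in positive degree is a boundary up to a subdivided chain; degree 0
  does not occur, since boundaries are only taken of \<open>V (Suc k)\<close>. Two obstacles shape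
  the argument. Orientations enter \<open>subdivision_chain\<close> through determinants of edge
  vectors, so nothing formal makes it commute with the boundary; the determinant is therefore read
  as an affine function of one vertex, whose sign tells the side on which a coface lies. And the
  part of \<open>M\<close> inside a simplex of \<open>N\<close> cannot be contracted by coning,
  because the cone over a simplex of \<open>M\<close> is in general not made of simplices of
  \<open>M\<close>. Point sets of small diameter impose no combinatorial condition, so a
  straight-line contraction works for them. Lists with repeated entries are kept as degenerate
  simplices of value 0, which frees vertex maps from injectivity, and the empty simplex is kept in
  dimension -1, which gives one notion of acyclicity for all degrees.\<close>

abbreviation remove_nth :: "nat \<Rightarrow> 'a list \<Rightarrow> 'a list" where
  "remove_nth j vs \<equiv> take j vs @ drop (Suc j) vs"

text \<open>Adjacent swaps generate all permutations. Phrased through them, antisymmetry passes to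
  prepended, mapped and face-summed functions by recursion on lists, without permutation
  bookkeeping; \<open>alternating_permute_list\<close> recovers the form that
  \<open>linear_extension_oriented_simplex\<close> asks for.\<close>

definition alternating :: "('a list \<Rightarrow> 'b::real_vector) \<Rightarrow> bool" where
  "alternating f \<longleftrightarrow> (\<forall>xs a b ys. f (xs @ a # b # ys) = - f (xs @ b # a # ys))"

lemma alternatingD: "alternating f \<Longrightarrow> f (xs @ a # b # ys) = - f (xs @ b # a # ys)"
  unfolding alternating_def by blast

lemma alternating_Cons:
  assumes "alternating f" shows "alternating (\<lambda>l. f (x # l))"
  unfolding alternating_def using alternatingD[OF assms, of "x # _"] by (metis append_Cons)

lemma alternating_map:
  assumes "alternating f" shows "alternating (\<lambda>l. f (map h l))"
  unfolding alternating_def map_append list.map using alternatingD[OF assms] by blast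

lemma alternating_move:
  assumes "alternating f"
  shows "f (xs @ a # zs @ ys) = (-1) ^ length zs *\<^sub>R f (xs @ zs @ a # ys)"
proof (induction zs arbitrary: xs)
  case (Cons z zs)
  have "f (xs @ a # (z # zs) @ ys) = - f ((xs @ [z]) @ a # zs @ ys)"
    using alternatingD[OF assms, of xs a z "zs @ ys"] by simp
  then show ?case
    using Cons.IH[of "xs @ [z]"] by simp
qed simp

lemma alternating_swap:
  assumes "alternating f"
  shows "f (xs @ a # zs @ b # ys) = - f (xs @ b # zs @ a # ys)"
proof -
  have "f (xs @ a # zs @ b # ys) = (-1) ^ length zs *\<^sub>R f ((xs @ zs) @ a # b # ys)"
    using alternating_move[OF assms, of xs a zs "b # ys"] by simp
  also have "\<dots> = - ((-1) ^ length zs *\<^sub>R f (xs @ zs @ b # a # ys))"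
    using alternatingD[OF assms, of "xs @ zs" a b ys] by simp
  also have "\<dots> = - f (xs @ b # zs @ a # ys)"
    using alternating_move[OF assms, of xs b zs "a # ys"] by simp
  finally show ?thesis .
qed

lemma permute_list_transpose:
  "permute_list (Transposition.transpose (length xs) (length xs + Suc (length zs))) (xs @ a # zs @ b # ys)
     = xs @ b # zs @ a # ys"
proof (rule nth_equalityI)
  let ?m = "length xs" and ?n = "length xs + Suc (length zs)"
  fix i assume "i < length (permute_list (Transposition.transpose ?m ?n) (xs @ a # zs @ b # ys))"
  then have i: "i < length (xs @ a # zs @ b # ys)" by simp
  consider "i = ?m" | "i = ?n" | "i < ?m" | "?m < i" "i < ?n" | "?n < i" by linarith
  then have "(xs @ a # zs @ b # ys) ! Transposition.transpose ?m ?n i = (xs @ b # zs @ a # ys) ! i"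
  proof cases
    case 4
    then obtain k where "i = ?m + Suc k" "k < length zs" by (metis add_Suc_right less_iff_Suc_add nat_add_left_cancel_less Suc_less_eq)
    then show ?thesis by (simp add: Transposition.transpose_def nth_append)
  next
    case 5
    then obtain k where "i = ?n + Suc k" by (metis add_Suc_right less_iff_Suc_add)
    then show ?thesis by (simp add: Transposition.transpose_def nth_append)
  qed (auto simp: Transposition.transpose_def nth_append)
  then show "permute_list (Transposition.transpose ?m ?n) (xs @ a # zs @ b # ys) ! i =
      (xs @ b # zs @ a # ys) ! i"
    using i by (simp add: permute_list_def del: length_append)
qed simp

lemma split_two_nth:
  assumes "i < j" "j < length vs"
  obtains xs zs ys where "vs = xs @ vs ! i # zs @ vs ! j # ys" "length xs = i" "j = i + Suc (length zs)"
proof -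
  define ys where "ys = drop (Suc i) vs"
  have l: "j - Suc i < length ys" using assms by (simp add: ys_def)
  have "vs = take i vs @ vs ! i # ys"
    using assms by (simp add: ys_def id_take_nth_drop)
  moreover have "ys = take (j - Suc i) ys @ ys ! (j - Suc i) # drop (Suc (j - Suc i)) ys"
    by (rule id_take_nth_drop[OF l])
  moreover have "ys ! (j - Suc i) = vs ! j" using assms by (simp add: ys_def)
  ultimately have "vs = take i vs @ vs ! i # take (j - Suc i) ys @ vs ! j # drop (Suc (j - Suc i)) ys"
    by metis
  moreover have "length (take i vs) = i" "j = i + Suc (length (take (j - Suc i) ys))"
    using assms l by (auto simp: ys_def)
  ultimately show ?thesis using that by blast
qed

lemma alternating_transpose:
  assumes "alternating f" "i < length vs" "j < length vs" "i \<noteq> j"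
  shows "f (permute_list (Transposition.transpose i j) vs) = - f vs"
proof -
  have *: "f (permute_list (Transposition.transpose i j) vs) = - f vs"
    if ij: "i < j" "j < length vs" for i j
  proof -
    obtain xs zs ys where e: "vs = xs @ vs ! i # zs @ vs ! j # ys" "length xs = i"
        "j = i + Suc (length zs)"
      using split_two_nth[OF ij] by metis
    have "permute_list (Transposition.transpose i j) vs = xs @ vs ! j # zs @ vs ! i # ys"
      using permute_list_transpose[of xs zs "vs ! i" "vs ! j" ys] e by metis
    then show ?thesis
      using alternating_swap[OF assms(1), of xs "vs ! j" zs "vs ! i" ys] e(1) by simp
  qed
  from assms show ?thesis
    using *[of i j] *[of j i] by (cases "i < j") (auto simp: transpose_commute)
qed

lemma alternating_permute_list:
  assumes "alternating f" "p permutes {..<length vs}"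
  shows "f (permute_list p vs) = of_int (sign p) *\<^sub>R f vs"
  using finite_lessThan assms(2)
proof (induction rule: permutes_rev_induct)
  case (swap a b p)
  have t: "Transposition.transpose a b permutes {..<length vs}"
    using swap by (intro permutes_swap_id) auto
  have "f (permute_list (p \<circ> Transposition.transpose a b) vs) = - f (permute_list p vs)"
    using swap alternating_transpose[OF assms(1), of a "permute_list p vs" b]
    by (simp add: permute_list_compose[OF t])
  moreover have "sign (p \<circ> Transposition.transpose a b) = - sign p"
    using swap by (subst sign_compose)
      (auto simp: sign_swap_id permutation_swap_id intro: permutes_imp_permutation)
  ultimately show ?case using swap by (simp del: o_apply comp_apply add: o_def[symmetric])
qed auto

lemma alternatingI_permute_list:
  fixes f :: "'a list \<Rightarrow> 'b::real_vector"
  assumes "\<And>p vs. p permutes {..<length vs} \<Longrightarrow> f (permute_list p vs) = of_int (sign p) *\<^sub>R f vs"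
  shows "alternating f"
  unfolding alternating_def
proof (intro allI)
  fix xs ys :: "'a list" and a b :: 'a
  let ?t = "Transposition.transpose (length xs) (Suc (length xs))"
  have "?t permutes {..<length (xs @ b # a # ys)}" by (intro permutes_swap_id) auto
  moreover have "permute_list ?t (xs @ b # a # ys) = xs @ a # b # ys"
    using permute_list_transpose[of xs "[]" b a ys] by simp
  ultimately show "f (xs @ a # b # ys) = - f (xs @ b # a # ys)"
    using assms[of ?t "xs @ b # a # ys"] by (simp add: sign_swap_id)
qed

lemma oriented_simplex_permute_list:
  assumes "p permutes {..<length vs}"
  shows "oriented_simplex (permute_list p vs) = of_int (sign p) *\<^sub>R oriented_simplex vs"
proof -
  let ?P = "{q. q permutes {..<length vs}}"
  have s: "permutation q" if "q \<in> ?P" for q using that by (auto intro: permutes_imp_permutation)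
  have "oriented_simplex (permute_list p vs) =
      (\<Sum>q\<in>?P. of_int (sign q) *\<^sub>R Poly_Mapping.single (permute_list (p \<circ> q) vs) 1)"
    unfolding oriented_simplex_def by (intro sum.cong) (auto simp: permute_list_compose)
  \<comment> \<open>Signs square to 1, so the sign of \<open>q\<close> is that of \<open>p\<close>
    times that of \<open>p \<circ> q\<close>. The summand then depends on \<open>p \<circ> q\<close>
    alone and the sum can be reindexed.\<close>
  also have "\<dots> = (\<Sum>q\<in>?P. (of_int (sign p) * of_int (sign (p \<circ> q))) *\<^sub>R
       Poly_Mapping.single (permute_list (p \<circ> q) vs) 1)"
    using assms s permutes_imp_permutation[OF _ assms]
    by (intro sum.cong refl) (simp add: sign_compose sign_idempotent mult.assoc[symmetric] flip: of_int_mult)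
  also have "\<dots> = (\<Sum>q\<in>?P. (of_int (sign p) * of_int (sign q)) *\<^sub>R
       Poly_Mapping.single (permute_list q vs) 1)"
    using sum.reindex_bij_betw[OF bij_betw_byWitness[of ?P "\<lambda>q. inv_into UNIV p \<circ> q" "\<lambda>q. p \<circ> q" ?P],
        of "\<lambda>q. (of_int (sign p) * of_int (sign q)) *\<^sub>R Poly_Mapping.single (permute_list q vs) 1"]
      assms permutes_inv[OF assms]
    by (auto simp: fun.map_comp permutes_compose image_subset_iff permutes_inverses[OF assms] fun_eq_iff)
  finally show ?thesis by (simp add: oriented_simplex_def scaleR_sum_right)
qed

lemma alternating_oriented_simplex: "alternating oriented_simplex"
  by (rule alternatingI_permute_list) (rule oriented_simplex_permute_list)

lemma linear_extension_alternating:
  "alternating f \<Longrightarrow> linear_extension f (oriented_simplex vs) = f vs"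
  by (rule linear_extension_oriented_simplex) (rule alternating_permute_list)

text \<open>Swapping two equal entries fixes the list, so the value is its own negative. Degenerate
  lists may thus stay among the generators of chain spaces.\<close>

lemma alternating_not_distinct:
  assumes "alternating f" "\<not> distinct vs" shows "f vs = 0"
proof -
  obtain i j where ij: "i < length vs" "j < length vs" "i < j" "vs ! i = vs ! j"
    using assms(2) by (auto simp: distinct_conv_nth) (metis linorder_neqE_nat)
  then have "permute_list (Transposition.transpose i j) vs = vs"
    by (intro nth_equalityI) (auto simp: permute_list_def Transposition.transpose_def)
  then have "f vs = - f vs"
    using alternating_transpose[OF assms(1), of i vs j] ij by simp
  then have "2 *\<^sub>R f vs = 0" by (simp add: scaleR_2 eq_neg_iff_add_eq_0)
  then show ?thesis by simp
qed

lemmas oriented_simplex_not_distinct = alternating_not_distinct[OF alternating_oriented_simplex]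

lemma oriented_simplex_set_eq:
  assumes "distinct vs" "distinct ws" "set ws = set vs"
  obtains p where "p permutes {..<length vs}" "ws = permute_list p vs"
    "oriented_simplex ws = of_int (sign p) *\<^sub>R oriented_simplex vs"
proof -
  have "mset ws = mset vs" using assms by (metis set_eq_iff_mset_eq_distinct)
  then obtain p where "p permutes {..<length vs}" "permute_list p vs = ws"
    by (metis mset_eq_permutation)
  then show ?thesis using that oriented_simplex_permute_list by blast
qed

section \<open>Coefficients of oriented simplices\<close>

lemma lookup_oriented_simplex_self:
  assumes "distinct vs" shows "Poly_Mapping.lookup (oriented_simplex vs) vs = 1"
proof -
  have id: "p = id" if p: "p permutes {..<length vs}" and e: "permute_list p vs = vs" for p
  proof
    fix i show "p i = id i"
    proof (cases "i < length vs")
      case True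
      then have "vs ! p i = vs ! i" using e p by (metis permute_list_nth)
      then show ?thesis using True assms permutes_in_image[OF p, of i] by (simp add: nth_eq_iff_index_eq)
    next
      case False
      then show ?thesis using p by (simp add: permutes_def)
    qed
  qed
  have "Poly_Mapping.lookup (oriented_simplex vs) vs =
      (\<Sum>p | p permutes {..<length vs}. of_int (sign p) * (1 when permute_list p vs = vs))"
    by (simp add: oriented_simplex_def lookup_sum lookup_scaleR_chain lookup_single)
  also have "\<dots> = (\<Sum>p\<in>{id}. of_int (sign p) * (1 when permute_list p vs = vs))"
    using id by (intro sum.mono_neutral_right) (auto simp: finite_permutations permutes_id when_def)
  finally show ?thesis by simp
qed

lemma lookup_oriented_simplex_mset:
  assumes "mset ws \<noteq> mset vs" shows "Poly_Mapping.lookup (oriented_simplex vs) ws = 0"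
proof -
  have "permute_list p vs \<noteq> ws" if "p permutes {..<length vs}" for p
    using mset_permute_list[OF that] assms by metis
  then show ?thesis
    by (auto simp: oriented_simplex_def lookup_sum lookup_scaleR_chain lookup_single intro!: sum.neutral)
qed

text \<open>A reordering of \<open>l\<close>, and the same reordering behind a fixed first entry
  \<open>v\<close>, have equal signs: both coefficients are that sign if \<open>us\<close> reorders
  \<open>l\<close>, and 0 otherwise.\<close>

lemma lookup_oriented_simplex_Cons:
  assumes "v \<notin> set l" "distinct l"
  shows "Poly_Mapping.lookup (oriented_simplex (v # l)) (v # us) = Poly_Mapping.lookup (oriented_simplex l) us"
proof (cases "mset us = mset l")
  case True
  then obtain p where p: "p permutes {..<length l}" "permute_list p l = us"
    by (metis mset_eq_permutation)
  have d: "distinct us" "set us = set l" using True assms mset_eq_imp_distinct_iff[OF True] mset_eq_setD[OF True] by auto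
  have "oriented_simplex us = of_int (sign p) *\<^sub>R oriented_simplex l"
    using oriented_simplex_permute_list p by blast
  moreover have "oriented_simplex (v # us) = of_int (sign p) *\<^sub>R oriented_simplex (v # l)"
    using alternating_permute_list[OF alternating_Cons[OF alternating_oriented_simplex] p(1)] p(2) by metis
  moreover have "Poly_Mapping.lookup (oriented_simplex us) us = 1"
     "Poly_Mapping.lookup (oriented_simplex (v # us)) (v # us) = 1"
    using lookup_oriented_simplex_self[of us] lookup_oriented_simplex_self[of "v # us"] assms(1) d by auto
  ultimately have "of_int (sign p) * Poly_Mapping.lookup (oriented_simplex l) us = 1"
     "of_int (sign p) * Poly_Mapping.lookup (oriented_simplex (v # l)) (v # us) = 1"
    by (auto simp: lookup_scaleR_chain)
  then show ?thesis by (metis mult_cancel_left mult_zero_left zero_neq_one)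
next
  case False
  then show ?thesis by (simp add: lookup_oriented_simplex_mset)
qed

section \<open>Alternating face sums and the augmented boundary\<close>

definition face_sum :: "('a list \<Rightarrow> 'b::real_vector) \<Rightarrow> 'a list \<Rightarrow> 'b" where
  "face_sum g vs = (\<Sum>j<length vs. (-1) ^ j *\<^sub>R g (remove_nth j vs))"

lemma face_sum_Nil [simp]: "face_sum g [] = 0"
  by (simp add: face_sum_def)

text \<open>Peeling off the first vertex changes the summed function from \<open>g\<close> to
  \<open>\<lambda>l. g (x # l)\<close>. This is why face sums are formed for arbitrary
  \<open>g\<close>: the identities below are inductions on the list with \<open>g\<close>
  generalized.\<close>

lemma face_sum_Cons: "face_sum g (x # vs) = g vs - face_sum (\<lambda>l. g (x # l)) vs"
  by (simp only: face_sum_def length_Cons sum.lessThan_Suc_shift)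
    (simp add: sum_negf)

lemma face_sum_linear:
  assumes "linear L" shows "L (face_sum g vs) = face_sum (\<lambda>l. L (g l)) vs"
  by (simp add: face_sum_def linear_sum[OF assms] linear_scale[OF assms])

lemma face_sum_diff: "face_sum (\<lambda>l. g l - h l) vs = face_sum g vs - face_sum h vs"
  by (simp add: face_sum_def sum_subtractf algebra_simps)

lemma face_sum_map: "face_sum (\<lambda>l. g (map h l)) vs = face_sum g (map h vs)"
  by (simp add: face_sum_def take_map drop_map)

text \<open>The faces that omit the first vertex cancel, which leaves the same double sum for
  \<open>g\<close> with that vertex prepended.\<close>

lemma face_sum_face_sum: "face_sum (face_sum g) vs = 0"
proof (induction vs arbitrary: g)
  case (Cons x vs)
  have "face_sum (face_sum g) (x # vs) = face_sum (face_sum (\<lambda>l. g (x # l))) vs"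
    by (simp add: face_sum_Cons face_sum_diff)
  then show ?case using Cons by simp
qed simp

text \<open>Swapping \<open>a\<close> and \<open>b\<close> exchanges the faces that omit one of
  them, and these carry opposite signs; all other faces still contain the adjacent pair.\<close>

lemma alternating_face_sum:
  fixes g :: "'a list \<Rightarrow> 'b::real_vector"
  assumes "alternating g" shows "alternating (face_sum g)"
proof -
  have "face_sum g (xs @ a # b # ys) = - face_sum g (xs @ b # a # ys)"
    if "alternating g" for xs ys :: "'a list" and a b :: 'a and g :: "'a list \<Rightarrow> 'b"
    using that
  proof (induction xs arbitrary: g)
    case Nil
    have "g (a # b # l) = - g (b # a # l)" for l
      using alternatingD[OF Nil, of "[]" a b l] by simp
    then have "(\<lambda>l. g (a # b # l)) = (\<lambda>l. - g (b # a # l))" by blast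
    then show ?case by (simp only: face_sum_Cons append_Nil) (simp add: face_sum_def sum_negf)
  next
    case (Cons x xs)
    then show ?case
      using Cons.IH[OF alternating_Cons[OF Cons.prems, of x]] alternatingD[OF Cons.prems, of xs a b ys]
      by (simp add: face_sum_Cons)
  qed
  then show ?thesis using assms unfolding alternating_def[of "face_sum g"] by blast
qed

text \<open>The boundary of the augmented complex, which is graded by the number of vertices: the empty
  list generates the chains of dimension -1.\<close>

definition augmented_boundary :: "'a chain \<Rightarrow> 'a chain" ("\<partial>") where
  "\<partial> = linear_extension (face_sum oriented_simplex)"

lemma linear_augmented_boundary: "linear \<partial>"
  by (simp add: augmented_boundary_def linear_linear_extension)

lemma augmented_boundary_oriented_simplex: "\<partial> (oriented_simplex vs) = face_sum oriented_simplex vs"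
  unfolding augmented_boundary_def
  by (rule linear_extension_alternating[OF alternating_face_sum[OF alternating_oriented_simplex]])

lemma augmented_boundary_face_sum: "\<partial> (face_sum oriented_simplex vs) = 0"
  by (simp add: face_sum_linear[OF linear_augmented_boundary] augmented_boundary_oriented_simplex
      face_sum_face_sum)

lemma boundary_chain_oriented_simplex:
  assumes "length vs \<ge> 2" shows "boundary_chain (oriented_simplex vs) = \<partial> (oriented_simplex vs)"
proof -
  let ?f = "\<lambda>vs. if length vs \<le> 1 then 0 else face_sum oriented_simplex vs"
  have "boundary_chain (oriented_simplex vs) = ?f vs"
    unfolding boundary_chain_def face_sum_def[symmetric]
    by (rule linear_extension_oriented_simplex)
      (simp add: alternating_permute_list[OF alternating_face_sum[OF alternating_oriented_simplex]])
  then show ?thesis using assms by (simp add: augmented_boundary_oriented_simplex)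
qed

text \<open>Moving the vertex at position \<open>j\<close> to the front costs the sign
  \<open>(-1) ^ j\<close>, exactly its sign in the boundary. On coefficient functions the boundary
  is therefore summation over the first argument, and the boundary of a subdivided simplex becomes a
  signed count of cofaces.\<close>

lemma lookup_augmented_boundary:
  assumes "finite W" "set vs \<subseteq> W"
  shows "Poly_Mapping.lookup (\<partial> (oriented_simplex vs)) us =
    (\<Sum>w\<in>W. Poly_Mapping.lookup (oriented_simplex vs) (w # us))"
proof (cases "distinct vs")
  case False
  then show ?thesis
    by (simp add: oriented_simplex_not_distinct linear_0[OF linear_augmented_boundary])
next
  case True
  have nz: "w \<in> set vs" if "Poly_Mapping.lookup (oriented_simplex vs) (w # us) \<noteq> 0" for w
    using that lookup_oriented_simplex_mset[of "w # us" vs] by (metis list.set_intros(1) mset_eq_setD)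
  have term_eq: "Poly_Mapping.lookup (oriented_simplex vs) (vs ! j # us) =
      (-1) ^ j * Poly_Mapping.lookup (oriented_simplex (remove_nth j vs)) us" if j: "j < length vs" for j
  proof -
    have vs: "vs = take j vs @ vs ! j # drop (Suc j) vs" by (rule id_take_nth_drop[OF j])
    then have d: "vs ! j \<notin> set (remove_nth j vs)" "distinct (remove_nth j vs)"
      using True by (metis distinct_append distinct.simps(2) not_distinct_conv_prefix Un_iff set_append
          disjoint_iff list.set_intros(1), metis True distinct_append distinct.simps(2) disjoint_iff
          list.set_intros(2))
    have "oriented_simplex (vs ! j # remove_nth j vs) = (-1) ^ j *\<^sub>R oriented_simplex vs"
      using alternating_move[OF alternating_oriented_simplex, of "[]" "vs ! j" "take j vs" "drop (Suc j) vs"]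
        j vs by simp
    then have "oriented_simplex vs = (-1) ^ j *\<^sub>R oriented_simplex (vs ! j # remove_nth j vs)"
      by simp
    then show ?thesis
      using lookup_oriented_simplex_Cons[OF d] by (simp add: lookup_scaleR_chain)
  qed
  have "(\<Sum>w\<in>W. Poly_Mapping.lookup (oriented_simplex vs) (w # us)) =
      (\<Sum>w\<in>set vs. Poly_Mapping.lookup (oriented_simplex vs) (w # us))"
    using assms nz by (intro sum.mono_neutral_right) auto
  also have "\<dots> = (\<Sum>j<length vs. Poly_Mapping.lookup (oriented_simplex vs) (vs ! j # us))"
    by (rule sum.reindex_bij_betw[symmetric, OF bij_betw_nth[OF True refl refl]])
  also have "\<dots> = Poly_Mapping.lookup (\<partial> (oriented_simplex vs)) us"
    by (simp add: term_eq augmented_boundary_oriented_simplex face_sum_def lookup_sum lookup_scaleR_chain)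
  finally show ?thesis by simp
qed

section \<open>Acyclic carriers\<close>

text \<open>Only the set of entries matters, so orders and repetitions are free; a nonempty complex
  contains the empty list.\<close>

definition list_complex :: "'a list set \<Rightarrow> bool" where
  "list_complex X \<longleftrightarrow> (\<forall>vs\<in>X. \<forall>ws. set ws \<subseteq> set vs \<longrightarrow> ws \<in> X)"

text \<open>The index counts vertices and exceeds the dimension by one; index 0 is the degree of the
  augmentation.\<close>

definition alternating_chains :: "'a list set \<Rightarrow> nat \<Rightarrow> 'a chain set" where
  "alternating_chains X n = span (oriented_simplex ` {vs \<in> X. length vs = n})"

lemma list_complexD: "list_complex X \<Longrightarrow> vs \<in> X \<Longrightarrow> set ws \<subseteq> set vs \<Longrightarrow> ws \<in> X"
  by (auto simp: list_complex_def)

lemma subspace_alternating_chains: "subspace (alternating_chains X n)"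
  by (simp add: alternating_chains_def)

lemma oriented_simplex_in_alternating_chains:
  "vs \<in> X \<Longrightarrow> length vs = n \<Longrightarrow> oriented_simplex vs \<in> alternating_chains X n"
  by (auto simp: alternating_chains_def intro: span_base)

lemma alternating_chains_mono: "X \<subseteq> Y \<Longrightarrow> alternating_chains X n \<subseteq> alternating_chains Y n"
  unfolding alternating_chains_def by (intro span_mono) auto

lemma linear_eq_alternating_chains:
  assumes "linear f" "linear g" "\<And>vs. vs \<in> X \<Longrightarrow> length vs = n \<Longrightarrow> f (oriented_simplex vs) = g (oriented_simplex vs)"
    and "z \<in> alternating_chains X n"
  shows "f z = g z"
  by (rule linear_eq_on_span[OF assms(1,2) _ assms(4)[unfolded alternating_chains_def]])
    (use assms(3) in auto)

lemma linear_image_alternating_chains: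
  assumes "linear f" "subspace S" "\<And>vs. vs \<in> X \<Longrightarrow> length vs = n \<Longrightarrow> f (oriented_simplex vs) \<in> S"
    and "z \<in> alternating_chains X n"
  shows "f z \<in> S"
proof -
  have "f ` alternating_chains X n = span (f ` oriented_simplex ` {vs \<in> X. length vs = n})"
    using assms(1) unfolding alternating_chains_def by (simp add: linear_span_image)
  also have "\<dots> \<subseteq> S" using assms by (intro span_minimal) auto
  finally show ?thesis using assms(4) by blast
qed

lemma face_sum_in_subspace:
  assumes "subspace S" "\<And>j. j < length vs \<Longrightarrow> g (remove_nth j vs) \<in> S"
  shows "face_sum g vs \<in> S"
  unfolding face_sum_def using assms by (intro subspace_sum subspace_scale) auto

lemma set_remove_nth: "set (remove_nth j vs) \<subseteq> set vs"
  by (auto dest: in_set_takeD in_set_dropD)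

lemma length_remove_nth: "j < length vs \<Longrightarrow> length (remove_nth j vs) = length vs - 1"
  by auto

lemma augmented_boundary_in_alternating_chains:
  assumes "list_complex X" "z \<in> alternating_chains X (Suc n)"
  shows "\<partial> z \<in> alternating_chains X n"
proof (rule linear_image_alternating_chains[OF linear_augmented_boundary subspace_alternating_chains _ assms(2)])
  fix vs assume vs: "vs \<in> X" "length vs = Suc n"
  have "remove_nth j vs \<in> X" for j by (rule list_complexD[OF assms(1) vs(1) set_remove_nth])
  with vs show "\<partial> (oriented_simplex vs) \<in> alternating_chains X n"
    unfolding augmented_boundary_oriented_simplex
    by (intro face_sum_in_subspace subspace_alternating_chains oriented_simplex_in_alternating_chains)
      auto
qed

lemma augmented_boundary_twice:
  assumes "z \<in> alternating_chains X n" shows "\<partial> (\<partial> z) = 0"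
  using linear_eq_alternating_chains[OF linear_compose[OF linear_augmented_boundary linear_augmented_boundary]
      linear_zero _ assms]
  by (simp add: augmented_boundary_oriented_simplex augmented_boundary_face_sum)

lemma linear_extension_formula:
  "linear_extension f (oriented_simplex vs) =
     (\<Sum>p | p permutes {..<length vs}. (of_int (sign p) / fact (length vs)) *\<^sub>R f (permute_list p vs))"
proof -
  have single: "linear_extension f (Poly_Mapping.single ws 1) = (1 / fact (length ws)) *\<^sub>R f ws" for ws
    by (simp add: linear_extension_def)
  show ?thesis
    unfolding oriented_simplex_def
    by (simp add: linear_sum[OF linear_linear_extension] linear_scale[OF linear_linear_extension] single)
qed

section \<open>Chain maps of vertex maps, and cones\<close>

definition push_chain :: "('a \<Rightarrow> 'a) \<Rightarrow> 'a chain \<Rightarrow> 'a chain" where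
  "push_chain f = linear_extension (\<lambda>vs. oriented_simplex (map f vs))"

lemma linear_push_chain: "linear (push_chain f)"
  by (simp add: push_chain_def linear_linear_extension)

lemma push_chain_oriented_simplex: "push_chain f (oriented_simplex vs) = oriented_simplex (map f vs)"
  unfolding push_chain_def
  by (rule linear_extension_alternating[OF alternating_map[OF alternating_oriented_simplex]])

lemma augmented_boundary_push_chain_oriented_simplex:
  "\<partial> (push_chain f (oriented_simplex vs)) = push_chain f (\<partial> (oriented_simplex vs))"
  by (simp add: push_chain_oriented_simplex augmented_boundary_oriented_simplex
      face_sum_linear[OF linear_push_chain] face_sum_map)

lemma augmented_boundary_push_chain:
  assumes "z \<in> alternating_chains X n" shows "\<partial> (push_chain f z) = push_chain f (\<partial> z)"
  using linear_eq_alternating_chains[OF linear_compose[OF linear_push_chain linear_augmented_boundary]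
      linear_compose[OF linear_augmented_boundary linear_push_chain] _ assms]
  by (simp add: augmented_boundary_push_chain_oriented_simplex)

definition cone_chain :: "'a \<Rightarrow> 'a chain \<Rightarrow> 'a chain" where
  "cone_chain p = linear_extension (\<lambda>vs. oriented_simplex (p # vs))"

lemma linear_cone_chain: "linear (cone_chain p)"
  by (simp add: cone_chain_def linear_linear_extension)

lemma cone_chain_oriented_simplex: "cone_chain p (oriented_simplex vs) = oriented_simplex (p # vs)"
  unfolding cone_chain_def
  by (rule linear_extension_alternating[OF alternating_Cons[OF alternating_oriented_simplex]])

lemma augmented_boundary_cone_chain:
  assumes "z \<in> alternating_chains X n" shows "\<partial> (cone_chain p z) = z - cone_chain p (\<partial> z)"
proof -
  have 1: "linear (\<lambda>z. \<partial> (cone_chain p z))"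
    using linear_compose[OF linear_cone_chain linear_augmented_boundary] by (simp add: o_def)
  have 2: "linear (\<lambda>z. z - cone_chain p (\<partial> z))"
    using linear_compose_sub[OF linear_id linear_compose[OF linear_augmented_boundary linear_cone_chain]]
    by (simp add: o_def)
  show ?thesis
    using linear_eq_alternating_chains[OF 1 2 _ assms]
    by (simp add: cone_chain_oriented_simplex augmented_boundary_oriented_simplex face_sum_Cons
        face_sum_linear[OF linear_cone_chain])
qed

text \<open>In the augmented complex coning is a contraction in every degree: the boundary of the
  cone over the empty simplex is the empty simplex, so points need no special treatment.\<close>

lemma acyclic_cone:
  assumes "z \<in> alternating_chains X n" "\<partial> z = 0" "\<And>vs. vs \<in> X \<Longrightarrow> p # vs \<in> Y"
  shows "\<exists>y\<in>alternating_chains Y (Suc n). \<partial> y = z"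
proof
  show "\<partial> (cone_chain p z) = z"
    using augmented_boundary_cone_chain[OF assms(1)] assms(2) linear_0[OF linear_cone_chain] by simp
  show "cone_chain p z \<in> alternating_chains Y (Suc n)"
    by (rule linear_image_alternating_chains[OF linear_cone_chain subspace_alternating_chains _ assms(1)])
      (simp add: cone_chain_oriented_simplex oriented_simplex_in_alternating_chains assms(3))
qed

text \<open>Averaging over the orderings makes arbitrary choices of fillings alternating.\<close>

lemma linear_extension_filling:
  assumes "alternating R" "\<And>ws. set ws = set vs \<Longrightarrow> length ws = length vs \<Longrightarrow> y ws \<in> S \<and> \<partial> (y ws) = R ws"
    and "subspace S"
  shows "linear_extension y (oriented_simplex vs) \<in> S"
    and "\<partial> (linear_extension y (oriented_simplex vs)) = R vs"
proof -
  have p: "y (permute_list p vs) \<in> S \<and> \<partial> (y (permute_list p vs)) = R (permute_list p vs)"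
    if "p permutes {..<length vs}" for p
    using assms(2) that by simp
  show "linear_extension y (oriented_simplex vs) \<in> S"
    unfolding linear_extension_formula using p assms(3)
    by (intro subspace_sum subspace_scale) auto
  have "\<partial> (linear_extension y (oriented_simplex vs)) = linear_extension R (oriented_simplex vs)"
    unfolding linear_extension_formula
      linear_sum[OF linear_augmented_boundary] linear_scale[OF linear_augmented_boundary]
    using p by (intro sum.cong) auto
  then show "\<partial> (linear_extension y (oriented_simplex vs)) = R vs"
    using linear_extension_alternating[OF assms(1)] by simp
qed

text \<open>In each degree the obstruction, \<open>\<phi>\<close> minus \<open>E\<close> after the
  boundary, is a cycle inside the carrier and is filled there. The offset \<open>e\<close> merges
  two uses. For \<open>e = 1\<close>, \<open>\<phi>\<close> is a chain map that preserves degrees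
  and \<open>E\<close> is a null-homotopy of it; for \<open>e = 0\<close> and
  \<open>\<phi> = 0\<close>, \<open>E\<close> is a carried map that anticommutes with the boundary.
  The value on the empty simplex, whose carrier is not assumed acyclic, is prescribed by
  \<open>E0\<close>.\<close>

lemma acyclic_carrier:
  fixes A :: "'a list \<Rightarrow> 'a list set"
  assumes X: "list_complex X"
    and mono: "\<And>vs ws. vs \<in> X \<Longrightarrow> set ws \<subseteq> set vs \<Longrightarrow> A ws \<subseteq> A vs"
    and acyclic: "\<And>vs n z. \<lbrakk>vs \<in> X; vs \<noteq> []; z \<in> alternating_chains (A vs) n; \<partial> z = 0\<rbrakk> \<Longrightarrow>
       \<exists>y\<in>alternating_chains (A vs) (Suc n). \<partial> y = z"
    and lin: "\<And>n. linear (\<phi> n)"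
    and carried: "\<And>vs n. \<lbrakk>vs \<in> X; length vs = Suc n\<rbrakk> \<Longrightarrow>
       \<phi> (Suc n) (oriented_simplex vs) \<in> alternating_chains (A vs) (n + e)"
    and chain_map: "\<And>vs n. \<lbrakk>vs \<in> X; length vs = Suc n\<rbrakk> \<Longrightarrow>
       \<partial> (\<phi> (Suc n) (oriented_simplex vs)) = \<phi> n (\<partial> (oriented_simplex vs))"
    and base: "linear E0" "E0 (oriented_simplex []) \<in> alternating_chains (A []) e"
       "\<partial> (E0 (oriented_simplex [])) = \<phi> 0 (oriented_simplex [])"
  obtains E where "E 0 = E0" "\<And>n. linear (E n)"
    "\<And>n vs. \<lbrakk>vs \<in> X; length vs = n\<rbrakk> \<Longrightarrow> E n (oriented_simplex vs) \<in> alternating_chains (A vs) (n + e)"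
    "\<And>n z. z \<in> alternating_chains X (Suc n) \<Longrightarrow> \<partial> (E (Suc n) z) = \<phi> (Suc n) z - E n (\<partial> z)"
proof -
  let ?os = oriented_simplex
  \<comment> \<open>The last clause of \<open>?P\<close> says that the obstruction in the next
    degree is a cycle. It refers to one stage only, as dependent choice requires of an invariant;
    the relation between consecutive stages is \<open>?Q\<close>.\<close>
  let ?P = "\<lambda>n E. linear E \<and> (n = 0 \<longrightarrow> E = E0) \<and>
    (\<forall>vs\<in>X. length vs = n \<longrightarrow> E (?os vs) \<in> alternating_chains (A vs) (n + e)) \<and>
    (\<forall>vs\<in>X. length vs = Suc n \<longrightarrow> \<partial> (E (\<partial> (?os vs))) = \<phi> n (\<partial> (?os vs)))"
  let ?Q = "\<lambda>n E E'. \<forall>vs\<in>X. length vs = Suc n \<longrightarrow> \<partial> (E' (?os vs)) = \<phi> (Suc n) (?os vs) - E (\<partial> (?os vs))"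
  have boundary_Nil: "\<partial> (?os [v]) = ?os []" for v :: 'a
    by (simp add: augmented_boundary_oriented_simplex face_sum_Cons)
  have "?P 0 E0"
    using base by (auto simp: length_Suc_conv boundary_Nil)
  then have start: "\<exists>E. ?P 0 E" by (rule exI[of "?P 0" E0])
  have step: "\<exists>E'. ?P (Suc n) E' \<and> ?Q n E E'" if E: "?P n E" for E n
  proof -
    have linE: "linear E" using E by blast
    define R where "R vs = \<phi> (Suc n) (?os vs) - E (\<partial> (?os vs))" for vs
    have R: "alternating R"
      by (rule alternatingI_permute_list)
        (simp add: R_def oriented_simplex_permute_list linear_scale[OF lin] linear_scale[OF linE]
          linear_scale[OF linear_augmented_boundary] scaleR_diff_right)
    have ex: "\<exists>y\<in>alternating_chains (A vs) (Suc (n + e)). \<partial> y = R vs" if vs: "vs \<in> X" "length vs = Suc n" for vs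
    proof (rule acyclic[OF vs(1)])
      show "vs \<noteq> []" using vs by auto
      have "E (\<partial> (?os vs)) \<in> alternating_chains (A vs) (n + e)"
        unfolding augmented_boundary_oriented_simplex face_sum_linear[OF linE]
      proof (intro face_sum_in_subspace subspace_alternating_chains)
        fix j assume j: "j < length vs"
        have "remove_nth j vs \<in> X" by (rule list_complexD[OF X vs(1) set_remove_nth])
        moreover have "length (remove_nth j vs) = n" using length_remove_nth[OF j] vs by simp
        ultimately have "E (?os (remove_nth j vs)) \<in> alternating_chains (A (remove_nth j vs)) (n + e)"
          using E by blast
        then show "E (?os (remove_nth j vs)) \<in> alternating_chains (A vs) (n + e)"
          using alternating_chains_mono[OF mono[OF vs(1) set_remove_nth]] by blast
      qed
      then show "R vs \<in> alternating_chains (A vs) (n + e)"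
        unfolding R_def using carried[OF vs] by (intro subspace_diff subspace_alternating_chains)
      show "\<partial> (R vs) = 0"
        using E vs chain_map[OF vs] by (simp add: R_def linear_diff[OF linear_augmented_boundary])
    qed
    then obtain y where y: "\<And>vs. vs \<in> X \<Longrightarrow> length vs = Suc n \<Longrightarrow>
        y vs \<in> alternating_chains (A vs) (Suc (n + e)) \<and> \<partial> (y vs) = R vs"
      by metis
    define E' where "E' = linear_extension y"
    have "y ws \<in> alternating_chains (A vs) (Suc n + e) \<and> \<partial> (y ws) = R ws"
      if "vs \<in> X" "length vs = Suc n" "set ws = set vs" "length ws = length vs" for vs ws
    proof -
      have "ws \<in> X" "A ws \<subseteq> A vs" using that list_complexD[OF X] mono by auto
      moreover from this have "alternating_chains (A ws) (Suc (n + e)) \<subseteq> alternating_chains (A vs) (Suc (n + e))"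
        by (intro alternating_chains_mono)
      ultimately show ?thesis using y[of ws] that(2,4) by auto
    qed
    note fill = linear_extension_filling[OF R this subspace_alternating_chains]
    have range: "E' (?os vs) \<in> alternating_chains (A vs) (Suc n + e)" if "vs \<in> X" "length vs = Suc n" for vs
      unfolding E'_def by (rule fill(1)[OF that])
    have Q: "\<partial> (E' (?os vs)) = R vs" if "vs \<in> X" "length vs = Suc n" for vs
      unfolding E'_def by (rule fill(2)[OF that])
    have linE': "linear E'" by (simp add: E'_def linear_linear_extension)
    have "\<partial> (E' (\<partial> (?os vs))) = \<phi> (Suc n) (\<partial> (?os vs))" if vs: "vs \<in> X" "length vs = Suc (Suc n)" for vs
    proof -
      have "\<partial> (E' z) = \<phi> (Suc n) z - E (\<partial> z)" if "z \<in> alternating_chains X (Suc n)" for z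
      proof (rule linear_eq_alternating_chains[OF _ _ _ that])
        show "linear (\<lambda>z. \<partial> (E' z))"
          using linear_compose[OF linE' linear_augmented_boundary] by (simp add: o_def)
        show "linear (\<lambda>z. \<phi> (Suc n) z - E (\<partial> z))"
          using linear_compose_sub[OF lin linear_compose[OF linear_augmented_boundary linE]] by (simp add: o_def)
      qed (simp add: Q R_def)
      moreover have "?os vs \<in> alternating_chains X (Suc (Suc n))"
        using vs by (rule oriented_simplex_in_alternating_chains)
      ultimately show ?thesis
        using augmented_boundary_in_alternating_chains[OF X] augmented_boundary_twice linear_0[OF linE]
        by (metis diff_zero)
    qed
    then have "?P (Suc n) E' \<and> ?Q n E E'" using linE' range Q by (auto simp: R_def)
    then show ?thesis by (rule exI[of "\<lambda>E'. ?P (Suc n) E' \<and> ?Q n E E'" E'])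
  qed
  have "\<exists>E. \<forall>n. ?P n (E n) \<and> ?Q n (E n) (E (Suc n))"
    by (rule dependent_nat_choice[of ?P ?Q, OF start]) (rule step)
  then obtain E where "\<forall>n. ?P n (E n) \<and> ?Q n (E n) (E (Suc n))" ..
  then have E: "\<And>n. ?P n (E n)" "\<And>n. ?Q n (E n) (E (Suc n))" by simp_all
  show ?thesis
  proof (rule that)
    show linE: "linear (E n)" for n using E(1) by blast
    show "E 0 = E0" using E(1) by blast
    show "E n (?os vs) \<in> alternating_chains (A vs) (n + e)" if "vs \<in> X" "length vs = n" for n vs
      using E(1) that by blast
    show "\<partial> (E (Suc n) z) = \<phi> (Suc n) z - E n (\<partial> z)" if "z \<in> alternating_chains X (Suc n)" for n z
    proof (rule linear_eq_alternating_chains[OF _ _ _ that])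
      show "linear (\<lambda>z. \<partial> (E (Suc n) z))"
        using linear_compose[OF linE linear_augmented_boundary] by (simp add: o_def)
      show "linear (\<lambda>z. \<phi> (Suc n) z - E n (\<partial> z))"
        using linear_compose_sub[OF lin linear_compose[OF linear_augmented_boundary linE]] by (simp add: o_def)
    qed (use E(2) in blast)
  qed
qed

text \<open>All lists with entries among the \<open>f\<close>- and \<open>h\<close>-images of one
  simplex form a full simplex, which is acyclic as a cone. The homotopy starts with 0 because both
  maps fix the empty simplex.\<close>

lemma contiguous_push_chain:
  assumes X: "list_complex X" and z: "z \<in> alternating_chains X (Suc n)" "\<partial> z = 0"
    and Y: "\<And>vs ws. vs \<in> X \<Longrightarrow> set ws \<subseteq> f ` set vs \<union> h ` set vs \<Longrightarrow> ws \<in> Y"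
  shows "\<exists>y\<in>alternating_chains Y (Suc (Suc n)). \<partial> y = push_chain f z - push_chain h z"
proof -
  let ?A = "\<lambda>vs. {ws. set ws \<subseteq> f ` set vs \<union> h ` set vs}"
  let ?\<phi> = "\<lambda>n z. push_chain f z - push_chain h z"
  obtain E where E: "E 0 = (\<lambda>_. 0)" "\<And>n. linear (E n)"
    "\<And>n vs. \<lbrakk>vs \<in> X; length vs = n\<rbrakk> \<Longrightarrow> E n (oriented_simplex vs) \<in> alternating_chains (?A vs) (n + 1)"
    "\<And>n z. z \<in> alternating_chains X (Suc n) \<Longrightarrow> \<partial> (E (Suc n) z) = ?\<phi> (Suc n) z - E n (\<partial> z)"
  proof (rule acyclic_carrier[of X ?A ?\<phi> 1 "\<lambda>_. 0", OF X])
    show "?A ws \<subseteq> ?A vs" if "set ws \<subseteq> set vs" for vs ws using that by blast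
    show "linear (?\<phi> n)" for n by (intro linear_compose_sub linear_push_chain)
    show "\<exists>y\<in>alternating_chains (?A vs) (Suc n). \<partial> y = z"
      if "vs \<noteq> []" "z \<in> alternating_chains (?A vs) n" "\<partial> z = 0" for vs n z
      using that by (intro acyclic_cone[of z "?A vs" n "f (hd vs)"]) auto
    show "?\<phi> (Suc n) (oriented_simplex vs) \<in> alternating_chains (?A vs) (n + 1)" if "length vs = Suc n" for vs n
      unfolding push_chain_oriented_simplex
      by (intro subspace_diff subspace_alternating_chains oriented_simplex_in_alternating_chains)
        (auto simp: that)
    show "\<partial> (?\<phi> (Suc n) (oriented_simplex vs)) = ?\<phi> n (\<partial> (oriented_simplex vs))" for vs n
      by (simp add: linear_diff[OF linear_augmented_boundary] augmented_boundary_push_chain_oriented_simplex)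
  qed (auto simp: linear_zero linear_0[OF linear_augmented_boundary] push_chain_oriented_simplex
      subspace_0[OF subspace_alternating_chains])
  show ?thesis
  proof
    show "\<partial> (E (Suc n) z) = push_chain f z - push_chain h z"
      using E(4)[OF z(1)] z(2) linear_0[OF E(2)] by simp
    show "E (Suc n) z \<in> alternating_chains Y (Suc (Suc n))"
    proof (rule linear_image_alternating_chains[OF E(2) subspace_alternating_chains _ z(1)])
      fix vs assume vs: "vs \<in> X" "length vs = Suc n"
      have "?A vs \<subseteq> Y" using Y[OF vs(1)] by blast
      then show "E (Suc n) (oriented_simplex vs) \<in> alternating_chains Y (Suc (Suc n))"
        using E(3)[OF vs] alternating_chains_mono[of "?A vs" Y "Suc n + 1"] by (metis Suc_eq_plus1 subsetD)
    qed
  qed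
qed

section \<open>Points of small diameter in a convex set\<close>

definition rips_complex :: "'a::metric_space set \<Rightarrow> real \<Rightarrow> 'a list set" where
  "rips_complex S r = {vs. set vs \<subseteq> S \<and> (\<forall>x\<in>set vs. \<forall>y\<in>set vs. dist x y < r)}"

text \<open>The contraction towards \<open>p\<close> is cut into steps so short that consecutive stages are contiguous
  at scale \<open>r\<close>.\<close>

lemma acyclic_rips_convex:
  fixes S :: "'a::real_normed_vector set"
  assumes S: "convex S" "bounded S" "p \<in> S" and r: "r > 0"
    and z: "z \<in> alternating_chains (rips_complex S r) n" "\<partial> z = 0"
  shows "\<exists>y\<in>alternating_chains (rips_complex S r) (Suc n). \<partial> y = z"
proof (cases n)
  \<comment> \<open>Without vertices the chain is a multiple of the empty simplex, which is the
    boundary of the point \<open>p\<close>.\<close>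
  case 0
  have "alternating_chains (rips_complex S r) 0 \<subseteq> alternating_chains {[]} 0"
    unfolding alternating_chains_def by (intro span_mono) auto
  then show ?thesis
    using z 0 S(3) r by (intro acyclic_cone[of z "{[]}" n p]) (auto simp: rips_complex_def)
next
  case (Suc m)
  define X where "X d = {vs. set vs \<subseteq> S \<and> (\<forall>x\<in>set vs. \<forall>y\<in>set vs. dist x y \<le> d)}" for d
  have lcX: "list_complex (X d)" for d by (auto simp: list_complex_def X_def)
  \<comment> \<open>A chain involves finitely many distances, so all of them stay below some
    \<open>d < r\<close>. The slack \<open>r - d\<close> is what one step of the contraction may use
    up.\<close>
  have "\<exists>d<r. 0 \<le> d \<and> z \<in> alternating_chains (X d) n"
    using z(1) unfolding alternating_chains_def
  proof (induction rule: span_induct_alt)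
    case base
    show ?case using r by (auto intro!: exI[of _ 0] simp: span_zero)
  next
    case (step c x y)
    then obtain vs where vs: "vs \<in> rips_complex S r" "length vs = n" "x = oriented_simplex vs" by auto
    obtain d where d: "d < r" "0 \<le> d" "y \<in> alternating_chains (X d) n"
      using step unfolding alternating_chains_def by auto
    define d' where "d' = Max (insert d ((\<lambda>(x, y). dist x y) ` (set vs \<times> set vs)))"
    have ge: "d \<le> d'" "\<And>x y. x \<in> set vs \<Longrightarrow> y \<in> set vs \<Longrightarrow> dist x y \<le> d'"
      unfolding d'_def by (auto intro!: Max_ge)
    have lt: "d' < r" using d vs(1) unfolding d'_def by (subst Max_less_iff) (auto simp: rips_complex_def)
    have "vs \<in> X d'" "X d \<subseteq> X d'" using vs(1) ge by (fastforce simp: X_def rips_complex_def)+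
    then have "c *\<^sub>R x + y \<in> alternating_chains (X d') n"
      using vs d(3) alternating_chains_mono[of "X d" "X d'" n]
      by (intro subspace_add subspace_scale subspace_alternating_chains)
        (auto intro: oriented_simplex_in_alternating_chains)
    then show ?case using lt ge(1) d(2) unfolding alternating_chains_def by (intro exI[of _ d']) auto
  qed
  then obtain d where d: "d < r" "0 \<le> d" "z \<in> alternating_chains (X d) (Suc m)" using Suc by auto
  obtain D where D: "\<And>x. x \<in> S \<Longrightarrow> norm (x - p) \<le> D"
    using S(2) bounded_any_center[of S p] by (auto simp: dist_norm norm_minus_commute)
  \<comment> \<open>One of \<open>N\<close> equal steps moves a point by at most
    \<open>D / N\<close>, so points of two consecutive stages are closer than
    \<open>d + (r - d) = r\<close>.\<close>
  obtain N :: nat where N: "N > 0" "D / N < r - d"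
  proof -
    obtain N :: nat where "D / (r - d) < N" using reals_Archimedean2 by blast
    then have "D < (r - d) * Suc N" using d by (simp add: field_simps)
    then show ?thesis using that[of "Suc N"] by (simp add: field_simps)
  qed
  \<comment> \<open>Homothety with centre \<open>p\<close> and ratio \<open>1 - i / N\<close>: it
    does not increase distances, starts with the identity and ends with the constant map to
    \<open>p\<close>.\<close>
  define h where "h i x = p + (1 - real i / N) *\<^sub>R (x - p)" for i x
  have hS: "h i x \<in> S" if "x \<in> S" "i \<le> N" for i x
  proof -
    have "h i x = (real i / N) *\<^sub>R p + (1 - real i / N) *\<^sub>R x" by (simp add: h_def algebra_simps)
    moreover have "real i / N \<le> 1" using that N by simp
    ultimately show ?thesis
      using convexD[OF S(1,3) that(1), of "real i / N" "1 - real i / N"] by simp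
  qed
  have h_dist: "dist (h i x) (h i y) \<le> d" if "dist x y \<le> d" "i \<le> N" for i x y
  proof -
    have "h i x - h i y = (1 - real i / N) *\<^sub>R (x - y)" by (simp add: h_def algebra_simps)
    moreover have "0 \<le> 1 - real i / N" "1 - real i / N \<le> 1" using that N by auto
    ultimately have "norm (h i x - h i y) \<le> norm (x - y)"
      by (simp add: mult_left_le_one_le)
    then show ?thesis using that by (simp add: dist_norm)
  qed
  have h_step: "dist (h i x) (h (Suc i) x) < r - d" if "x \<in> S" for i x
  proof -
    have "h i x - h (Suc i) x = (1 / N) *\<^sub>R (x - p)"
    proof -
      have "h i x - h (Suc i) x = ((1 - real i / N) - (1 - real (Suc i) / N)) *\<^sub>R (x - p)"
        by (simp add: h_def algebra_simps del: of_nat_Suc)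
      also have "(1 - real i / N) - (1 - real (Suc i) / N) = 1 / N"
        using N by (simp add: field_simps)
      finally show ?thesis .
    qed
    then have "dist (h i x) (h (Suc i) x) = norm (x - p) / N" by (simp add: dist_norm)
    also have "\<dots> \<le> D / N" using D[OF that] by (simp add: divide_right_mono)
    finally show ?thesis using N by simp
  qed
  let ?B = "\<partial> ` alternating_chains (rips_complex S r) (Suc n)"
  have B: "subspace ?B" by (intro linear_subspace_image linear_augmented_boundary subspace_alternating_chains)
  have "z - push_chain (h i) z \<in> ?B" if "i \<le> N" for i
    using that
  proof (induction i)
    case 0
    have "h 0 = id" by (auto simp: h_def)
    then have "push_chain (h 0) z = z"
      using linear_eq_alternating_chains[OF linear_push_chain linear_id _ z(1), of id]
      by (simp add: push_chain_oriented_simplex)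
    then show ?case using subspace_0[OF B] by simp
  next
    case (Suc i)
    have "\<exists>y\<in>alternating_chains (rips_complex S r) (Suc (Suc m)). \<partial> y = push_chain (h i) z - push_chain (h (Suc i)) z"
    proof (rule contiguous_push_chain[OF lcX d(3) z(2)])
      fix vs ws assume vs: "vs \<in> X d" and ws: "set ws \<subseteq> h i ` set vs \<union> h (Suc i) ` set vs"
      have S': "\<And>x. x \<in> set vs \<Longrightarrow> x \<in> S" and "\<And>x y. x \<in> set vs \<Longrightarrow> y \<in> set vs \<Longrightarrow> dist x y \<le> d"
        using vs by (auto simp: X_def)
      then have le: "dist (h i x) (h i y) \<le> d" "dist (h (Suc i) x) (h (Suc i) y) \<le> d"
        if "x \<in> set vs" "y \<in> set vs" for x y
        using h_dist Suc.prems that by auto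
      have lt: "dist (h i x) (h (Suc i) y) < r" if "x \<in> set vs" "y \<in> set vs" for x y
        using le(1)[OF that] h_step[OF S'[OF that(2)], of i] dist_triangle[of "h i x" "h (Suc i) y" "h i y"]
        by linarith
      have "dist a b < r" if "a \<in> set ws" "b \<in> set ws" for a b
      proof -
        have "a \<in> h i ` set vs \<union> h (Suc i) ` set vs" "b \<in> h i ` set vs \<union> h (Suc i) ` set vs"
          using that ws by auto
        then show ?thesis
          using le_less_trans[OF le(1) d(1)] le_less_trans[OF le(2) d(1)] lt by (auto simp: dist_commute)
      qed
      moreover have "set ws \<subseteq> S" using ws S' hS Suc.prems by fastforce
      ultimately show "ws \<in> rips_complex S r" by (simp add: rips_complex_def)
    qed
    then have "push_chain (h i) z - push_chain (h (Suc i)) z \<in> ?B"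
      unfolding \<open>n = Suc m\<close> by (metis imageI)
    from subspace_add[OF B Suc.IH this] show ?case using Suc.prems by simp
  qed
  then have 1: "z - push_chain (h N) z \<in> ?B" by blast
  have "push_chain (h N) z \<in> ?B"
  proof -
    let ?P = "{vs. set vs \<subseteq> {p}}"
    have "h N = (\<lambda>_. p)" using N by (auto simp: h_def)
    then have "push_chain (h N) z \<in> alternating_chains ?P n"
      by (intro linear_image_alternating_chains[OF linear_push_chain subspace_alternating_chains _ z(1)])
        (auto simp: push_chain_oriented_simplex intro!: oriented_simplex_in_alternating_chains)
    moreover have "\<partial> (push_chain (h N) z) = 0"
      using augmented_boundary_push_chain[OF z(1)] z(2) linear_0[OF linear_push_chain] by simp
    moreover have "p # vs \<in> rips_complex S r" if "vs \<in> ?P" for vs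
    proof -
      have eq: "x = p" if "x \<in> set (p # vs)" for x using that \<open>vs \<in> ?P\<close> by auto
      have "dist x y < r" if "x \<in> set (p # vs)" "y \<in> set (p # vs)" for x y
        using eq[OF that(1)] eq[OF that(2)] r by simp
      moreover have "set (p # vs) \<subseteq> S" using eq S(3) by blast
      ultimately show ?thesis unfolding rips_complex_def by blast
    qed
    ultimately have "\<exists>y\<in>alternating_chains (rips_complex S r) (Suc n). \<partial> y = push_chain (h N) z"
      by (rule acyclic_cone)
    then show ?thesis by (metis imageI)
  qed
  from subspace_add[OF B 1 this] have "z \<in> ?B" by simp
  then show ?thesis by blast
qed

section \<open>Simplicial complexes with convex union\<close>

text \<open>Asking for a common simplex rather than for \<open>convex hull set vs \<in> K\<close>
  makes closure under subsets immediate; \<open>simplex_listsD\<close> and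
  \<open>simplex_listsI\<close> give back the geometric form.\<close>

definition simplex_lists :: "'a::euclidean_space set set \<Rightarrow> 'a list set" where
  "simplex_lists K = {vs. \<exists>T\<in>K. set vs \<subseteq> {v. v extreme_point_of T}}"

lemma list_complex_simplex_lists: "list_complex (simplex_lists K)"
  unfolding list_complex_def simplex_lists_def by blast

lemma simplex_lists_mono: "K \<subseteq> L \<Longrightarrow> simplex_lists K \<subseteq> simplex_lists L"
  by (auto simp: simplex_lists_def)

lemma simplicial_complex_simplex:
  assumes "simplicial_complex K" "T \<in> K"
  shows "\<not> affine_dependent {v. v extreme_point_of T}" "finite {v. v extreme_point_of T}"
    "T = convex hull {v. v extreme_point_of T}"
proof -
  obtain n where "n simplex T" using assms by (auto simp: simplicial_complex_def)
  then obtain C where C: "finite C" "\<not> affine_dependent C" "T = convex hull C"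
    by (auto simp: simplex)
  then have "{v. v extreme_point_of T} = C"
    using extreme_point_of_convex_hull_affine_independent by blast
  then show "\<not> affine_dependent {v. v extreme_point_of T}" "finite {v. v extreme_point_of T}"
    "T = convex hull {v. v extreme_point_of T}" using C by auto
qed

lemma simplicial_complex_compact:
  assumes "simplicial_complex K" "T \<in> K" shows "compact T" "convex T" "closed T"
  using simplicial_complex_simplex[OF assms]
  by (metis compact_convex_hull finite_imp_compact, metis convex_convex_hull,
      metis compact_convex_hull finite_imp_compact compact_imp_closed)

lemma simplicial_complex_face:
  "simplicial_complex K \<Longrightarrow> T \<in> K \<Longrightarrow> F face_of T \<Longrightarrow> F \<in> K"
  unfolding simplicial_complex_def by blast

lemma simplicial_complex_Int:
  "simplicial_complex K \<Longrightarrow> S \<in> K \<Longrightarrow> T \<in> K \<Longrightarrow> S \<inter> T face_of S"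
  unfolding simplicial_complex_def by blast

lemma extreme_points_hull:
  fixes vs :: "'a::euclidean_space list"
  shows "\<not> affine_dependent (set vs) \<Longrightarrow> {v. v extreme_point_of convex hull set vs} = set vs"
  by (simp add: extreme_point_of_convex_hull_affine_independent)

lemma simplex_lists_hull:
  assumes "simplicial_complex K" "T \<in> K" "V \<subseteq> {v. v extreme_point_of T}"
  shows "\<not> affine_dependent V" "convex hull V face_of T" "convex hull V \<in> K"
proof -
  note s = simplicial_complex_simplex[OF assms(1,2)]
  show "\<not> affine_dependent V" using s(1) assms(3) affine_dependent_subset by blast
  show f: "convex hull V face_of T"
    using face_of_convex_hull_affine_independent[OF s(1), of "convex hull V"] s(3) assms(3) by auto
  show "convex hull V \<in> K" using simplicial_complex_face[OF assms(1,2) f] .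
qed

lemma simplex_listsD:
  assumes "simplicial_complex K" "vs \<in> simplex_lists K"
  shows "\<not> affine_dependent (set vs)" "convex hull set vs \<in> K"
  using assms simplex_lists_hull unfolding simplex_lists_def by blast+

lemma simplex_listsI:
  assumes "\<not> affine_dependent (set vs)" "convex hull set vs \<in> K"
  shows "vs \<in> simplex_lists K"
  unfolding simplex_lists_def using assms extreme_points_hull by blast

lemma ordered_simplex_iff:
  assumes "simplicial_complex K"
  shows "ordered_simplex k K vs \<longleftrightarrow> vs \<in> simplex_lists K \<and> length vs = Suc k \<and> distinct vs"
  unfolding ordered_simplex_def using simplex_listsD[OF assms] simplex_listsI by blast

text \<open>The degenerate lists on the right contribute only 0. The shift passes from dimension to
  number of vertices.\<close>

lemma simplicial_chains_eq:
  assumes "simplicial_complex K"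
  shows "simplicial_chains k K = alternating_chains (simplex_lists K) (Suc k)"
proof
  show "simplicial_chains k K \<subseteq> alternating_chains (simplex_lists K) (Suc k)"
    unfolding simplicial_chains_def alternating_chains_def ordered_simplex_iff[OF assms]
    by (intro span_mono) auto
  have "oriented_simplex vs \<in> simplicial_chains k K" if "vs \<in> simplex_lists K" "length vs = Suc k" for vs
  proof (cases "distinct vs")
    case True
    then show ?thesis unfolding simplicial_chains_def ordered_simplex_iff[OF assms]
      using that by (intro span_base) blast
  next
    case False
    then show ?thesis by (simp add: oriented_simplex_not_distinct simplicial_chains_def span_zero)
  qed
  then show "alternating_chains (simplex_lists K) (Suc k) \<subseteq> simplicial_chains k K"
    unfolding alternating_chains_def by (intro span_minimal) (auto simp: simplicial_chains_def)
qed

section \<open>Least simplices, stars and the Lebesgue number\<close>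

lemma least_simplex:
  assumes "simplicial_complex K" "T0 \<in> K" "X \<subseteq> T0"
  obtains T where "T \<in> K" "X \<subseteq> T" "\<And>S. S \<in> K \<Longrightarrow> X \<subseteq> S \<Longrightarrow> T face_of S"
proof -
  have "finite {T \<in> K. X \<subseteq> T}" using assms(1) by (simp add: simplicial_complex_def)
  moreover have "{T \<in> K. X \<subseteq> T} \<noteq> {}" using assms by blast
  ultimately obtain T where "T \<in> {T \<in> K. X \<subseteq> T}" "\<forall>S\<in>{T \<in> K. X \<subseteq> T}. S \<le> T \<longrightarrow> T = S"
    by (rule bexE[OF finite_has_minimal])
  then have T: "T \<in> K" "X \<subseteq> T" "\<And>S. S \<in> K \<Longrightarrow> X \<subseteq> S \<Longrightarrow> S \<subseteq> T \<Longrightarrow> S = T" by auto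
  \<comment> \<open>The face \<open>S \<inter> T\<close> of \<open>S\<close> is again a simplex
    around \<open>X\<close> and lies in \<open>T\<close>, so minimality identifies it with
    \<open>T\<close>.\<close>
  have "T face_of S" if S: "S \<in> K" "X \<subseteq> S" for S
  proof -
    have "S \<inter> T face_of S" by (rule simplicial_complex_Int[OF assms(1) S(1) T(1)])
    moreover have "S \<inter> T = T"
      using T(2) S(2) by (intro T(3) simplicial_complex_face[OF assms(1) S(1) calculation]) auto
    ultimately show ?thesis by simp
  qed
  then show ?thesis using that T by blast
qed

text \<open>The least simplex around \<open>x\<close> is a face of every simplex that contains
  \<open>x\<close>, so any of its vertices will do.\<close>

lemma common_vertex:
  assumes "simplicial_complex K" "x \<in> \<Union>K"
  shows "\<exists>v. \<forall>T\<in>K. x \<in> T \<longrightarrow> v extreme_point_of T"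
proof -
  obtain T0 where "T0 \<in> K" "{x} \<subseteq> T0" using assms(2) by auto
  then obtain T where T: "T \<in> K" "{x} \<subseteq> T" "\<And>S. S \<in> K \<Longrightarrow> {x} \<subseteq> S \<Longrightarrow> T face_of S"
    using least_simplex[OF assms(1)] by metis
  then have "{v. v extreme_point_of T} \<noteq> {}"
    using simplicial_complex_simplex(3)[OF assms(1) T(1)] by (metis convex_hull_empty insert_not_empty subset_empty)
  then obtain v where "v extreme_point_of T" by blast
  then have "v extreme_point_of S" if "S \<in> K" "x \<in> S" for S
    using T(3)[OF that(1)] that(2) extreme_point_of_face by blast
  then show ?thesis by blast
qed

text \<open>\<open>G v\<close> cuts out the open star of \<open>v\<close>, and the stars cover the
  polyhedron by \<open>common_vertex\<close>. For each point, \<open>f\<close> picks a vertex whose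
  star contains the ball of radius \<open>r\<close>; every simplex that the ball meets then has this
  vertex.\<close>

lemma simplicial_complex_Lebesgue_number:
  assumes K: "simplicial_complex K"
  obtains r f where "r > 0"
    "\<And>x y T. \<lbrakk>x \<in> \<Union>K; y \<in> T; T \<in> K; dist x y < r\<rbrakk> \<Longrightarrow> f x extreme_point_of T"
proof -
  define G where "G v = - \<Union>{T\<in>K. \<not> v extreme_point_of T}" for v
  have fin: "finite K" using K by (simp add: simplicial_complex_def)
  have "compact (\<Union>K)" using fin simplicial_complex_compact[OF K] by (intro compact_Union) auto
  moreover have "\<Union>K \<subseteq> \<Union>(range G)" using common_vertex[OF K] by (fastforce simp: G_def)
  moreover have "open (G v)" for v
    unfolding G_def using fin simplicial_complex_compact[OF K] by (intro open_Compl closed_Union) auto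
  ultimately obtain r where r: "r > 0" "\<And>x. x \<in> \<Union>K \<Longrightarrow> \<exists>g\<in>range G. ball x r \<subseteq> g"
    using Heine_Borel_lemma[of "\<Union>K" "range G"] by (metis rangeE)
  then have "\<forall>x\<in>\<Union>K. \<exists>v. ball x r \<subseteq> G v" by blast
  then obtain f where f: "\<And>x. x \<in> \<Union>K \<Longrightarrow> ball x r \<subseteq> G (f x)"
    unfolding bchoice_iff by blast
  have "f x extreme_point_of T" if "x \<in> \<Union>K" "y \<in> T" "T \<in> K" "dist x y < r" for x y T
    using f[OF that(1)] that by (auto simp: G_def subset_iff)
  then show ?thesis using that r(1) by blast
qed

section \<open>Acyclicity of complexes with convex union\<close>

lemma oriented_simplex_in_span:
  assumes "length ws = length vs" "set ws \<subseteq> set vs"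
  shows "oriented_simplex ws \<in> span {oriented_simplex vs}"
proof (cases "distinct ws")
  case True
  then have "card (set vs) \<le> card (set ws)" using assms(1) card_length[of vs] by (simp add: distinct_card)
  then have eq: "set ws = set vs" using assms(2) by (simp add: card_seteq)
  then have "distinct vs" using True assms(1) by (metis card_distinct distinct_card)
  then obtain p where "p permutes {..<length vs}" "ws = permute_list p vs"
      "oriented_simplex ws = of_int (sign p) *\<^sub>R oriented_simplex vs"
    by (rule oriented_simplex_set_eq[OF _ True eq])
  then show ?thesis by (simp add: span_base span_scale)
next
  case False
  then show ?thesis by (simp add: oriented_simplex_not_distinct span_zero)
qed

text \<open>Coning the top-dimensional chain of a simplex with one of its own vertices yields
  degenerate lists only, so the cone formula turns a cycle into 0. Hence a top chain is determined
  by its boundary.\<close>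

lemma cycle_in_simplex:
  assumes "c \<in> alternating_chains {ws. set ws \<subseteq> set vs} (length vs)" "vs \<noteq> []" "\<partial> c = 0"
  shows "c = 0"
proof -
  let ?p = "hd vs"
  have "alternating_chains {ws. set ws \<subseteq> set vs} (length vs) \<subseteq> span {oriented_simplex vs}"
    unfolding alternating_chains_def by (intro span_minimal) (auto simp: oriented_simplex_in_span)
  then obtain a where a: "c = a *\<^sub>R oriented_simplex vs"
    using assms(1) by (auto simp: span_singleton)
  have "\<not> distinct (?p # vs)" using assms(2) by simp
  then have "cone_chain ?p c = 0"
    using oriented_simplex_not_distinct[of "?p # vs"] by (simp add: a linear_scale[OF linear_cone_chain] cone_chain_oriented_simplex)
  then show ?thesis
    using augmented_boundary_cone_chain[OF assms(1), of ?p] assms(3)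
    by (simp add: linear_0[OF linear_augmented_boundary] linear_0[OF linear_cone_chain])
qed

text \<open>A cycle is replaced by a homologous one among the point configurations of small diameter,
  filled there, and the filling is pushed to the vertices as in simplicial approximation.\<close>

lemma acyclic_convex_union:
  fixes K :: "'a::euclidean_space set set"
  assumes K: "simplicial_complex K" "convex (\<Union>K)" "\<Union>K \<noteq> {}"
    and z: "z \<in> alternating_chains (simplex_lists K) n" "\<partial> z = 0"
  shows "\<exists>y\<in>alternating_chains (simplex_lists K) (Suc n). \<partial> y = z"
proof -
  let ?os = "oriented_simplex :: 'a list \<Rightarrow> 'a chain"
  let ?X = "simplex_lists K"
  obtain r f where r: "r > 0"
    and f: "\<And>x y T. \<lbrakk>x \<in> \<Union>K; y \<in> T; T \<in> K; dist x y < r\<rbrakk> \<Longrightarrow> f x extreme_point_of T"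
    using simplicial_complex_Lebesgue_number[OF K(1)] by metis
  \<comment> \<open>With \<open>\<phi> = 0\<close> and \<open>e = 0\<close> the carrier lemma
    replaces each simplex by a chain of small configurations inside it, as a fine subdivision would
    do.\<close>
  let ?A = "\<lambda>vs::'a list. rips_complex (convex hull set vs) r"
  obtain E where E: "E 0 = (\<lambda>x. x)" "\<And>n. linear (E n)"
    "\<And>n vs. \<lbrakk>vs \<in> ?X; length vs = n\<rbrakk> \<Longrightarrow> E n (?os vs) \<in> alternating_chains (?A vs) (n + 0)"
    "\<And>n z. z \<in> alternating_chains ?X (Suc n) \<Longrightarrow> \<partial> (E (Suc n) z) = 0 - E n (\<partial> z)"
  proof (rule acyclic_carrier[of ?X ?A "\<lambda>_ _. 0" 0 "\<lambda>x. x"])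
    show "?A ws \<subseteq> ?A vs" if "set ws \<subseteq> set vs" for vs ws
      using hull_mono[OF that, of convex] unfolding rips_complex_def by blast
    show "\<exists>y\<in>alternating_chains (?A vs) (Suc n). \<partial> y = z"
      if "vs \<noteq> []" "z \<in> alternating_chains (?A vs) n" "\<partial> z = 0" for vs n z
      using that r by (intro acyclic_rips_convex[of _ "hd vs"])
        (auto simp: bounded_convex_hull finite_imp_bounded hull_inc)
  qed (auto simp: list_complex_simplex_lists linear_zero linear_id[unfolded id_def]
      linear_0[OF linear_augmented_boundary] subspace_0[OF subspace_alternating_chains] rips_complex_def
      augmented_boundary_oriented_simplex intro!: oriented_simplex_in_alternating_chains)
  \<comment> \<open>Points of a simplex go to its vertices under \<open>f\<close>, so both sides are
    top chains of one simplex. Their boundaries agree by induction, and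
    \<open>cycle_in_simplex\<close> makes them equal. The sign accumulates because \<open>E\<close>
    anticommutes with the boundary.\<close>
  have push_E: "push_chain f (E n (?os vs)) = (-1) ^ n *\<^sub>R ?os vs" if "vs \<in> ?X" "length vs = n" for n vs
    using that
  proof (induction n arbitrary: vs)
    case 0
    then show ?case using E(1) by (simp add: push_chain_oriented_simplex)
  next
    case (Suc n)
    let ?Y = "{ws. set ws \<subseteq> set vs}"
    note hull = simplex_listsD[OF K(1) Suc.prems(1)]
    have fv: "f x \<in> set vs" if "x \<in> convex hull set vs" for x
      using f[of x x "convex hull set vs"] that hull r extreme_points_hull[OF hull(1)] by auto
    let ?c = "push_chain f (E (Suc n) (?os vs))"
    have mem1: "?c \<in> alternating_chains ?Y (Suc n)"
    proof (rule linear_image_alternating_chains[OF linear_push_chain subspace_alternating_chains])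
      show "E (Suc n) (?os vs) \<in> alternating_chains (?A vs) (Suc n)" using E(3)[OF Suc.prems] by simp
      show "push_chain f (?os ws) \<in> alternating_chains ?Y (Suc n)"
        if "ws \<in> ?A vs" "length ws = Suc n" for ws
        using that fv by (auto simp: push_chain_oriented_simplex rips_complex_def subset_iff
            intro!: oriented_simplex_in_alternating_chains)
    qed
    have mem2: "?os vs \<in> alternating_chains ?Y (Suc n)"
      using Suc.prems by (auto intro: oriented_simplex_in_alternating_chains)
    have bd: "\<partial> ?c = (-1) ^ Suc n *\<^sub>R \<partial> (?os vs)"
    proof -
      have IH: "push_chain f (E n (?os (remove_nth j vs))) = (-1) ^ n *\<^sub>R ?os (remove_nth j vs)"
        if "j < length vs" for j
        using that Suc.prems length_remove_nth[OF that]
        by (intro Suc.IH list_complexD[OF list_complex_simplex_lists _ set_remove_nth]) auto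
      have "\<partial> (push_chain f (E (Suc n) (?os vs))) = push_chain f (\<partial> (E (Suc n) (?os vs)))"
        using E(3)[OF Suc.prems] by (rule augmented_boundary_push_chain)
      also have "\<partial> (E (Suc n) (?os vs)) = 0 - E n (\<partial> (?os vs))"
        using Suc.prems by (intro E(4) oriented_simplex_in_alternating_chains)
      also have "push_chain f (0 - E n (\<partial> (?os vs))) = - push_chain f (E n (\<partial> (?os vs)))"
        by (simp add: linear_neg[OF linear_push_chain])
      also have "push_chain f (E n (\<partial> (?os vs))) = face_sum (\<lambda>l. push_chain f (E n (?os l))) vs"
        by (simp add: augmented_boundary_oriented_simplex face_sum_linear[OF E(2)]
            face_sum_linear[OF linear_push_chain])
      also have "\<dots> = face_sum (\<lambda>l. (-1) ^ n *\<^sub>R ?os l) vs"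
        unfolding face_sum_def using IH by (intro sum.cong) auto
      also have "\<dots> = (-1) ^ n *\<^sub>R \<partial> (?os vs)"
        by (simp add: augmented_boundary_oriented_simplex face_sum_def scaleR_sum_right mult.commute)
      finally show ?thesis by simp
    qed
    have "?c - (-1) ^ Suc n *\<^sub>R ?os vs = 0"
    proof (rule cycle_in_simplex)
      show "?c - (-1) ^ Suc n *\<^sub>R ?os vs \<in> alternating_chains ?Y (length vs)"
        unfolding Suc.prems(2)
        by (rule subspace_diff[OF subspace_alternating_chains mem1
              subspace_scale[OF subspace_alternating_chains mem2]])
      show "\<partial> (?c - (-1) ^ Suc n *\<^sub>R ?os vs) = 0"
        unfolding linear_diff[OF linear_augmented_boundary] linear_scale[OF linear_augmented_boundary] bd
        by (rule diff_self)
    qed (use Suc.prems in auto)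
    then show ?case by (simp only: right_minus_eq)
  qed
  have "linear (\<lambda>x. (-1) ^ n *\<^sub>R x :: 'a chain)" by (rule linear_scaleR)
  then have push_z: "push_chain f (E n z) = (-1) ^ n *\<^sub>R z"
    using linear_eq_alternating_chains[OF linear_compose[OF E(2) linear_push_chain] _ _ z(1)] push_E by simp
  have "E n z \<in> alternating_chains (rips_complex (\<Union>K) r) n"
  proof (rule linear_image_alternating_chains[OF E(2) subspace_alternating_chains _ z(1)])
    fix vs assume vs: "vs \<in> ?X" "length vs = n"
    have "?A vs \<subseteq> rips_complex (\<Union>K) r"
      using simplex_listsD(2)[OF K(1) vs(1)] unfolding rips_complex_def by blast
    then show "E n (?os vs) \<in> alternating_chains (rips_complex (\<Union>K) r) n"
      using E(3)[OF vs] by (metis add_0_right alternating_chains_mono subsetD)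
  qed
  moreover have "\<partial> (E n z) = 0"
    using E(1) E(4) z linear_0[OF E(2)] by (cases n) auto
  moreover obtain p where "p \<in> \<Union>K" using K(3) by blast
  moreover have "bounded (\<Union>K)"
    using K(1) simplicial_complex_compact(1)[OF K(1)]
    by (intro bounded_Union compact_imp_bounded) (auto simp: simplicial_complex_def)
  ultimately obtain y where y: "y \<in> alternating_chains (rips_complex (\<Union>K) r) (Suc n)" "\<partial> y = E n z"
    using acyclic_rips_convex[OF K(2) _ _ r] by metis
  have "push_chain f y \<in> alternating_chains ?X (Suc n)"
  proof (rule linear_image_alternating_chains[OF linear_push_chain subspace_alternating_chains _ y(1)])
    fix vs assume vs: "vs \<in> rips_complex (\<Union>K) r" "length vs = Suc n"
    then have hd: "hd vs \<in> set vs" by (intro hd_in_set) auto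
    \<comment> \<open>Any simplex through the first point serves: every point of the list is closer
      than \<open>r\<close> to it, so \<open>f\<close> sends all of them to vertices of
      \<open>T\<close>.\<close>
    then obtain T where T: "T \<in> K" "hd vs \<in> T" using vs(1) by (auto simp: rips_complex_def)
    have "f x extreme_point_of T" if "x \<in> set vs" for x
    proof (rule f[OF _ T(2) T(1)])
      show "x \<in> \<Union>K" "dist x (hd vs) < r" using vs(1) that hd by (auto simp: rips_complex_def)
    qed
    then have "map f vs \<in> ?X" using T(1) by (auto simp: simplex_lists_def)
    then show "push_chain f (?os vs) \<in> alternating_chains ?X (Suc n)"
      using vs(2) by (simp add: push_chain_oriented_simplex oriented_simplex_in_alternating_chains)
  qed
  moreover have "\<partial> (push_chain f y) = (-1) ^ n *\<^sub>R z"
    using augmented_boundary_push_chain[OF y(1)] y(2) push_z by simp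
  ultimately show ?thesis
    by (intro bexI[of _ "(-1) ^ n *\<^sub>R push_chain f y"])
      (simp_all add: linear_scale[OF linear_augmented_boundary] subspace_scale[OF subspace_alternating_chains])
qed

lemma simplicial_complex_restrict:
  assumes "simplicial_complex K" shows "simplicial_complex {T\<in>K. T \<subseteq> S}"
  using assms face_of_imp_subset unfolding simplicial_complex_def by fastforce

lemma subdivisionD:
  assumes "subdivision N M"
  shows "simplicial_complex N" "simplicial_complex M" "\<And>T. T \<in> M \<Longrightarrow> \<exists>S\<in>N. T \<subseteq> S"
    "\<And>S. S \<in> N \<Longrightarrow> \<Union>{T\<in>M. T \<subseteq> S} = S"
proof -
  have *: "simplicial_complex N \<and> simplicial_complex M \<and>
     (\<forall>T\<in>M. \<exists>S\<in>N. T \<subseteq> S) \<and> (\<forall>S\<in>N. \<exists>F. F \<subseteq> M \<and> S = \<Union>F)"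
    using assms unfolding subdivision_def .
  then show "simplicial_complex N" "simplicial_complex M" by simp_all
  show "\<exists>S\<in>N. T \<subseteq> S" if "T \<in> M" for T using * that by simp
  show "\<Union>{T\<in>M. T \<subseteq> S} = S" if "S \<in> N" for S
  proof -
    obtain F where "F \<subseteq> M" "S = \<Union>F" using * \<open>S \<in> N\<close> by meson
    then show ?thesis by auto
  qed
qed

section \<open>Barycentric coordinates\<close>

definition affine_functional :: "('a::real_vector \<Rightarrow> real) \<Rightarrow> bool" where
  "affine_functional f \<longleftrightarrow> (\<exists>L c. linear L \<and> f = (\<lambda>x. L x + c))"

lemma affine_functional_combination:
  assumes "affine_functional f" "sum a I = 1"
  shows "f (\<Sum>i\<in>I. a i *\<^sub>R x i) = (\<Sum>i\<in>I. a i * f (x i))"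
proof -
  obtain L c where L: "linear L" and f: "f = (\<lambda>x. L x + c)"
    using assms(1) unfolding affine_functional_def by blast
  have "(\<Sum>i\<in>I. a i * f (x i)) = (\<Sum>i\<in>I. a i * L (x i)) + sum a I * c"
    by (simp add: f sum_distrib_right distrib_left sum.distrib)
  then show ?thesis
    using assms(2) by (simp add: f linear_sum[OF L] linear_scale[OF L])
qed

lemma affine_functional_segment:
  assumes "affine_functional f"
  shows "f ((1 - t) *\<^sub>R x + t *\<^sub>R y) = (1 - t) * f x + t * f y"
proof -
  obtain L c where L: "linear L" and f: "f = (\<lambda>x. L x + c)"
    using assms(1) unfolding affine_functional_def by blast
  show ?thesis by (simp add: f linear_add[OF L] linear_scale[OF L]) (simp add: algebra_simps)
qed

lemma affine_functional_sum:
  assumes "\<And>i. i \<in> I \<Longrightarrow> affine_functional (f i)"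
  shows "affine_functional (\<lambda>x. \<Sum>i\<in>I. f i x * a i)"
proof -
  have "\<forall>i\<in>I. \<exists>L c. linear L \<and> f i = (\<lambda>x. L x + c)"
    using assms unfolding affine_functional_def by blast
  then obtain L c where L: "\<And>i. i \<in> I \<Longrightarrow> linear (L i)" and f: "\<And>i. i \<in> I \<Longrightarrow> f i = (\<lambda>x. L i x + c i)"
    by metis
  have "linear (\<lambda>x. \<Sum>i\<in>I. a i *\<^sub>R L i x)"
    by (intro linear_compose_sum ballI linear_compose_scale_right L)
  moreover have "(\<lambda>x. \<Sum>i\<in>I. f i x * a i) = (\<lambda>x. (\<Sum>i\<in>I. a i *\<^sub>R L i x) + (\<Sum>i\<in>I. c i * a i))"
    using f by (auto simp: algebra_simps sum.distrib)
  ultimately show ?thesis unfolding affine_functional_def by blast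
qed

text \<open>Outside the affine hull of \<open>V\<close> the value is a junk value, but it still depends affinely on
  the point.\<close>

definition bary :: "'a::euclidean_space set \<Rightarrow> 'a \<Rightarrow> 'a \<Rightarrow> real" where
  "bary V v = (SOME f. affine_functional f \<and> (\<forall>w\<in>V. f w = (if w = v then 1 else 0)))"

lemma bary:
  assumes "\<not> affine_dependent V"
  shows "affine_functional (bary V v)" "w \<in> V \<Longrightarrow> bary V v w = (if w = v then 1 else 0)"
proof -
  have "\<exists>f. affine_functional f \<and> (\<forall>w\<in>V. f w = (if w = v then 1 else 0))"
  proof (cases "v \<in> V")
    case False
    have "affine_functional (\<lambda>x. 0)"
      unfolding affine_functional_def by (intro exI[of _ "\<lambda>x. 0"] exI[of _ 0]) (simp add: linear_zero)
    then show ?thesis using False by (intro exI[of _ "\<lambda>x. 0"]) auto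
  next
    case True
    then have "independent ((\<lambda>x. - v + x) ` (V - {v}))"
      using assms affine_dependent_iff_dependent2 by blast
    \<comment> \<open>A functional with value -1 on every edge from \<open>v\<close>, shifted to
      take the value 1 at \<open>v\<close>, vanishes at the other vertices.\<close>
    then obtain g :: "'a \<Rightarrow> real" where g: "linear g" "\<forall>x\<in>(\<lambda>x. - v + x) ` (V - {v}). g x = -1"
      using linear_independent_extend[of _ "\<lambda>_. -1"] by blast
    have "g w + (1 - g v) = (if w = v then 1 else 0)" if "w \<in> V" for w
      using g(2) that linear_add[OF g(1), of "-v" w] linear_neg[OF g(1), of v] by force
    moreover have "affine_functional (\<lambda>x. g x + (1 - g v))"
      using g(1) unfolding affine_functional_def by blast
    ultimately show ?thesis by blast
  qed
  from someI_ex[OF this] show "affine_functional (bary V v)"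
    "w \<in> V \<Longrightarrow> bary V v w = (if w = v then 1 else 0)"
    unfolding bary_def by blast+
qed

lemma bary_combination:
  assumes "\<not> affine_dependent V" "finite V" "sum u V = 1" "v \<in> V"
  shows "bary V v (\<Sum>w\<in>V. u w *\<^sub>R w) = u v"
proof -
  have "bary V v (\<Sum>w\<in>V. u w *\<^sub>R w) = (\<Sum>w\<in>V. u w * bary V v w)"
    by (rule affine_functional_combination[OF bary(1)[OF assms(1)] assms(3)])
  also have "\<dots> = (\<Sum>w\<in>V. if w = v then u w else 0)"
    using bary(2)[OF assms(1)] by (intro sum.cong) auto
  finally show ?thesis using assms by simp
qed

lemma bary_affine_hull:
  assumes V: "\<not> affine_dependent V" and x: "x \<in> affine hull V"
  shows "(\<Sum>v\<in>V. bary V v x) = 1" "(\<Sum>v\<in>V. bary V v x *\<^sub>R v) = x"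
proof -
  have fin: "finite V" using V by (rule aff_independent_finite)
  obtain u where "sum u V = 1" "(\<Sum>v\<in>V. u v *\<^sub>R v) = x"
    using x affine_hull_finite[OF fin] by blast
  then show "(\<Sum>v\<in>V. bary V v x) = 1" "(\<Sum>v\<in>V. bary V v x *\<^sub>R v) = x"
    using bary_combination[OF V fin] by auto
qed

lemma bary_convex_hull:
  assumes V: "\<not> affine_dependent V" and x: "x \<in> convex hull V" and v: "v \<in> V"
  shows "bary V v x \<ge> 0"
proof -
  have fin: "finite V" using V by (rule aff_independent_finite)
  obtain u where "\<forall>v\<in>V. u v \<ge> 0" "sum u V = 1" "(\<Sum>v\<in>V. u v *\<^sub>R v) = x"
    using x convex_hull_finite[OF fin] by blast
  then show ?thesis using bary_combination[OF V fin _ v, of u] v by auto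
qed

lemma convex_hull_bary:
  assumes V: "\<not> affine_dependent V" and x: "x \<in> affine hull V" "\<And>v. v \<in> V \<Longrightarrow> bary V v x \<ge> 0"
  shows "x \<in> convex hull V"
  using bary_affine_hull[OF V x(1)] x(2) convex_hull_finite[OF aff_independent_finite[OF V]]
  by (auto intro: exI[of _ "\<lambda>v. bary V v x"])

lemma bary_subset:
  assumes V: "\<not> affine_dependent V" and U: "U \<subseteq> V" and x: "x \<in> affine hull U"
  shows "v \<in> U \<Longrightarrow> bary U v x = bary V v x" "v \<in> V - U \<Longrightarrow> bary V v x = 0"
proof -
  have U': "\<not> affine_dependent U" using V U affine_dependent_subset by blast
  have fin: "finite V" using V by (rule aff_independent_finite)
  have finU: "finite U" using fin U finite_subset by blast
  obtain u where u: "sum u U = 1" "(\<Sum>v\<in>U. u v *\<^sub>R v) = x"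
    using x affine_hull_finite[OF finU] by blast
  let ?u = "\<lambda>v. if v \<in> U then u v else 0"
  have "sum ?u V = sum u U" "(\<Sum>v\<in>V. ?u v *\<^sub>R v) = (\<Sum>v\<in>U. u v *\<^sub>R v)"
    using U fin by (auto intro!: sum.mono_neutral_cong_right)
  then have "bary V v x = ?u v" if "v \<in> V" for v
    using bary_combination[OF V fin, of ?u v] u that by simp
  then show "v \<in> U \<Longrightarrow> bary U v x = bary V v x" "v \<in> V - U \<Longrightarrow> bary V v x = 0"
    using bary_combination[OF U' finU u(1), of v] u(2) U by auto
qed

lemma sum_set_conv_nth:
  assumes "distinct vs" shows "(\<Sum>v\<in>set vs. f v) = (\<Sum>i<length vs. f (vs ! i))"
  by (rule sum.reindex_bij_betw[symmetric, OF bij_betw_nth[OF assms refl refl]])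

section \<open>Orientations\<close>

text \<open>The ratio of the signed volumes of \<open>ws\<close> and \<open>vs\<close>. In contrast
  to the edge matrix of \<open>compatibly_oriented\<close> it singles out no base vertex, so
  reorderings simply permute its rows or columns.\<close>

definition bary_det :: "'a::euclidean_space list \<Rightarrow> 'a list \<Rightarrow> real" where
  "bary_det vs ws = Determinant.det (Matrix.mat (length vs) (length vs) (\<lambda>(i, j). bary (set vs) (vs ! i) (ws ! j)))"

lemma bary_det_permute_left:
  assumes "p permutes {..<length vs}"
  shows "bary_det (permute_list p vs) ws = of_int (sign p) * bary_det vs ws"
proof -
  let ?n = "length vs"
  let ?A = "Matrix.mat ?n ?n (\<lambda>(i, j). bary (set vs) (vs ! i) (ws ! j))"
  have p: "p permutes {0..<?n}" using assms by (simp add: atLeast0LessThan)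
  have "Matrix.mat ?n ?n (\<lambda>(i, j). ?A $$ (p i, j)) =
      Matrix.mat ?n ?n (\<lambda>(i, j). bary (set (permute_list p vs)) (permute_list p vs ! i) (ws ! j))"
    using assms permutes_in_image[OF assms] by (intro eq_matI) (auto simp: permute_list_nth)
  then show ?thesis
    using det_permute_rows[of ?A ?n p, OF _ p] by (simp add: bary_det_def)
qed

lemma bary_det_permute_right:
  assumes p: "p permutes {..<length ws}" "length ws = length vs"
  shows "bary_det vs (permute_list p ws) = of_int (sign p) * bary_det vs ws"
proof -
  let ?n = "length vs"
  let ?A = "Matrix.mat ?n ?n (\<lambda>(i, j). bary (set vs) (vs ! i) (ws ! j))"
  let ?B = "transpose_mat ?A"
  let ?A' = "Matrix.mat ?n ?n (\<lambda>(i, j). bary (set vs) (vs ! i) (permute_list p ws ! j))"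
  have p': "p permutes {0..<?n}" using p by (simp add: atLeast0LessThan)
  have "Matrix.mat ?n ?n (\<lambda>(i, j). ?B $$ (p i, j)) = transpose_mat ?A'"
    using p permutes_in_image[OF p(1)] by (intro eq_matI) (auto simp: permute_list_nth)
  then have "Determinant.det (transpose_mat ?A') = of_int (sign p) * Determinant.det ?B"
    using det_permute_rows[of ?B ?n p, OF _ p'] by simp
  then show ?thesis
    by (simp add: bary_det_def det_transpose[of _ ?n])
qed

text \<open>A kernel vector would be an affine dependence of \<open>ws\<close>: its entries sum to 0
  because every column sums to 1, and it annihilates the points because the columns are their
  coordinates.\<close>

lemma bary_det_nonzero:
  assumes vs: "distinct vs" "\<not> affine_dependent (set vs)"
    and ws: "distinct ws" "\<not> affine_dependent (set ws)" "length ws = length vs" "set ws \<subseteq> affine hull set vs"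
  shows "bary_det vs ws \<noteq> 0"
proof
  let ?n = "length vs"
  let ?A = "Matrix.mat ?n ?n (\<lambda>(i, j). bary (set vs) (vs ! i) (ws ! j))"
  assume "bary_det vs ws = 0"
  then obtain c where c: "c \<in> carrier_vec ?n" "c \<noteq> 0\<^sub>v ?n" "?A *\<^sub>v c = 0\<^sub>v ?n"
    using det_0_iff_vec_prod_zero_field[of ?A ?n] by (auto simp: bary_det_def)
  have row: "(\<Sum>j<?n. c $ j * bary (set vs) (vs ! i) (ws ! j)) = 0" if "i < ?n" for i
  proof -
    have "(?A *\<^sub>v c) $ i = (\<Sum>j<?n. bary (set vs) (vs ! i) (ws ! j) * c $ j)"
      using that c(1) by (auto simp: scalar_prod_def atLeast0LessThan intro!: sum.cong)
    then show ?thesis using c(3) that by (simp add: mult.commute)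
  qed
  have aff: "ws ! j \<in> affine hull set vs" if "j < ?n" for j using that ws(3,4) by auto
  have "(\<Sum>j<?n. c $ j) = (\<Sum>j<?n. c $ j * (\<Sum>i<?n. bary (set vs) (vs ! i) (ws ! j)))"
    using bary_affine_hull(1)[OF vs(2) aff] by (simp add: sum_set_conv_nth[OF vs(1)])
  also have "\<dots> = (\<Sum>i<?n. \<Sum>j<?n. c $ j * bary (set vs) (vs ! i) (ws ! j))"
    unfolding sum_distrib_left by (rule sum.swap)
  also have "\<dots> = 0" using row by simp
  finally have 1: "(\<Sum>j<?n. c $ j) = 0" .
  have "(\<Sum>j<?n. c $ j *\<^sub>R ws ! j) = (\<Sum>j<?n. c $ j *\<^sub>R (\<Sum>i<?n. bary (set vs) (vs ! i) (ws ! j) *\<^sub>R vs ! i))"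
    using bary_affine_hull(2)[OF vs(2) aff] by (simp add: sum_set_conv_nth[OF vs(1)])
  also have "\<dots> = (\<Sum>i<?n. \<Sum>j<?n. (c $ j * bary (set vs) (vs ! i) (ws ! j)) *\<^sub>R vs ! i)"
    unfolding scaleR_sum_right scaleR_scaleR by (rule sum.swap)
  also have "\<dots> = 0" using row by (simp flip: scaleR_sum_left)
  finally have 2: "(\<Sum>j<?n. c $ j *\<^sub>R ws ! j) = 0" .
  obtain k where k: "k < ?n" "c $ k \<noteq> 0"
    using c(1,2) by (metis carrier_vecD eq_vecI index_zero_vec(1) index_zero_vec(2))
  define U where "U w = c $ (THE j. j < ?n \<and> ws ! j = w)" for w
  have U: "U (ws ! j) = c $ j" if "j < ?n" for j
  proof -
    have "(THE j'. j' < ?n \<and> ws ! j' = ws ! j) = j"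
      using that ws(1,3) by (intro the_equality) (auto simp: nth_eq_iff_index_eq)
    then show ?thesis by (simp add: U_def)
  qed
  have "sum U (set ws) = 0" "(\<Sum>w\<in>set ws. U w *\<^sub>R w) = 0"
    using 1 2 U by (simp_all add: sum_set_conv_nth[OF ws(1)] ws(3))
  moreover have "ws ! k \<in> set ws" "U (ws ! k) \<noteq> 0" using k U ws(3) by auto
  ultimately show False
    using ws(2) affine_dependent_explicit_finite[of "set ws"] by blast
qed

text \<open>Adding all rows to row 0 makes it constant 1, subtracting column 0 from the others
  leaves a single 1 in it, and expansion along this row gives the smaller determinant.
  \<open>P\<close> and \<open>Q\<close> perform these operations and have determinant 1.\<close>

lemma det_barycentric_edges:
  fixes b :: "nat \<Rightarrow> nat \<Rightarrow> real"
  assumes "\<And>j. j \<le> m \<Longrightarrow> (\<Sum>i\<le>m. b i j) = 1"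
  shows "Determinant.det (Matrix.mat (Suc m) (Suc m) (\<lambda>(i, j). b i j)) =
    Determinant.det (Matrix.mat m m (\<lambda>(i, j). b (Suc i) (Suc j) - b (Suc i) 0))"
proof -
  let ?n = "Suc m"
  define B where "B = Matrix.mat ?n ?n (\<lambda>(i, j). b i j)"
  define P where "P = Matrix.mat ?n ?n (\<lambda>(i, j). if i = 0 \<or> i = j then 1 else 0 :: real)"
  define Q where "Q = Matrix.mat ?n ?n (\<lambda>(i, j). if i = j then 1 else if i = 0 then -1 else 0 :: real)"
  define R where "R = Matrix.mat ?n ?n (\<lambda>(i, j). if i = 0 then 1 else b i j)"
  define T where "T = Matrix.mat ?n ?n (\<lambda>(i, j). if j = 0 then R $$ (i, 0) else R $$ (i, j) - R $$ (i, 0))"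
  have dims: "B \<in> carrier_mat ?n ?n" "P \<in> carrier_mat ?n ?n" "Q \<in> carrier_mat ?n ?n"
    "R \<in> carrier_mat ?n ?n" "T \<in> carrier_mat ?n ?n"
    by (auto simp: B_def P_def Q_def R_def T_def)
  have detP: "Determinant.det P = 1"
    using det_upper_triangular[of P ?n] dims
    by (auto simp: P_def upper_triangular_def prod_list_diag_prod)
  have detQ: "Determinant.det Q = 1"
    using det_upper_triangular[of Q ?n] dims
    by (auto simp: Q_def upper_triangular_def prod_list_diag_prod)
  have "P * B = R"
  proof (rule eq_matI)
    fix i j assume "i < dim_row R" "j < dim_col R"
    then have ij: "i < ?n" "j < ?n" by (auto simp: R_def)
    have "(P * B) $$ (i, j) = (\<Sum>k<?n. P $$ (i, k) * B $$ (k, j))"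
      using ij dims by (auto simp: scalar_prod_def atLeast0LessThan intro!: sum.cong)
    also have "\<dots> = (\<Sum>k<?n. if i = 0 \<or> i = k then b k j else 0)"
      using ij by (intro sum.cong) (auto simp: P_def B_def)
    also have "\<dots> = R $$ (i, j)"
      using ij assms[of j] by (cases "i = 0") (auto simp: R_def lessThan_Suc_atMost)
    finally show "(P * B) $$ (i, j) = R $$ (i, j)" .
  qed (auto simp: P_def B_def R_def)
  then have detR: "Determinant.det R = Determinant.det B"
    using det_mult[OF dims(2,1)] detP by simp
  have "R * Q = T"
  proof (rule eq_matI)
    fix i j assume "i < dim_row T" "j < dim_col T"
    then have ij: "i < ?n" "j < ?n" by (auto simp: T_def)
    have "(R * Q) $$ (i, j) = (\<Sum>k<?n. R $$ (i, k) * Q $$ (k, j))"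
      using ij dims by (auto simp: scalar_prod_def atLeast0LessThan intro!: sum.cong)
    also have "\<dots> = (\<Sum>k<?n. (if k = j then R $$ (i, k) else 0) - (if k = 0 \<and> j \<noteq> 0 then R $$ (i, k) else 0))"
      using ij by (intro sum.cong) (auto simp: Q_def)
    also have "\<dots> = (\<Sum>k<?n. if k = j then R $$ (i, k) else 0) - (\<Sum>k<?n. if k = 0 \<and> j \<noteq> 0 then R $$ (i, k) else 0)"
      by (rule sum_subtractf)
    also have "\<dots> = T $$ (i, j)"
      using ij by (cases "j = 0") (auto simp: T_def)
    finally show "(R * Q) $$ (i, j) = T $$ (i, j)" .
  qed (auto simp: R_def Q_def T_def)
  then have detT: "Determinant.det T = Determinant.det B"
    using det_mult[OF dims(4,3)] detQ detR by simp
  have "Determinant.det T = (\<Sum>j<?n. T $$ (0, j) * cofactor T 0 j)"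
    by (rule laplace_expansion_row[OF dims(5)]) simp
  also have "\<dots> = (\<Sum>j<?n. if j = 0 then cofactor T 0 0 else 0)"
    by (intro sum.cong) (auto simp: T_def R_def)
  also have "\<dots> = Determinant.det (mat_delete T 0 0)" by (simp add: cofactor_def)
  also have "mat_delete T 0 0 = Matrix.mat m m (\<lambda>(i, j). b (Suc i) (Suc j) - b (Suc i) 0)"
    by (intro eq_matI) (auto simp: mat_delete_def T_def R_def)
  finally show ?thesis using detT by (simp add: B_def)
qed

text \<open>The matrix in \<open>compatibly_oriented\<close> is unique: the linear parts of the
  barycentric coordinates are dual to the edge vectors of \<open>vs\<close>. It consists of
  differences of coordinates, to which \<open>det_barycentric_edges\<close> applies.\<close>

lemma compatibly_oriented_iff:
  assumes vs: "distinct vs" "\<not> affine_dependent (set vs)" "vs \<noteq> []"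
    and ws: "length ws = length vs" "set ws \<subseteq> affine hull set vs"
  shows "compatibly_oriented vs ws \<longleftrightarrow> bary_det vs ws > 0"
proof -
  obtain m where m: "length vs = Suc m" using vs(3) by (cases vs) auto
  define b where "b i x = bary (set vs) (vs ! i) x" for i x
  define A0 where "A0 i j = b (Suc i) (ws ! Suc j) - b (Suc i) (ws ! 0)" for i j
  have aff: "ws ! j \<in> affine hull set vs" if "j \<le> m" for j using that ws m by auto
  have sum1: "(\<Sum>i\<le>m. b i (ws ! j)) = 1" and sum2: "(\<Sum>i\<le>m. b i (ws ! j) *\<^sub>R vs ! i) = ws ! j"
    if "j \<le> m" for j
    using bary_affine_hull[OF vs(2) aff[OF that]]
    by (simp_all add: sum_set_conv_nth[OF vs(1)] b_def m lessThan_Suc_atMost)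
  have det: "bary_det vs ws = Determinant.det (Matrix.mat m m (\<lambda>(i, j). A0 i j))"
    using det_barycentric_edges[of m "\<lambda>i j. b i (ws ! j)"] sum1
    by (simp add: bary_det_def m A0_def b_def)
  have A0: "ws ! Suc j - ws ! 0 = (\<Sum>i<m. A0 i j *\<^sub>R (vs ! Suc i - vs ! 0))" if j: "j < m" for j
  proof -
    have "(\<Sum>i\<le>m. (b i (ws ! Suc j) - b i (ws ! 0)) *\<^sub>R (vs ! i - vs ! 0)) =
        (\<Sum>i\<le>m. b i (ws ! Suc j) *\<^sub>R vs ! i) - (\<Sum>i\<le>m. b i (ws ! 0) *\<^sub>R vs ! i)
        - ((\<Sum>i\<le>m. b i (ws ! Suc j)) - (\<Sum>i\<le>m. b i (ws ! 0))) *\<^sub>R vs ! 0"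
      by (simp add: scaleR_diff_left scaleR_diff_right sum_subtractf scaleR_sum_left)
    also have "\<dots> = ws ! Suc j - ws ! 0"
      using j sum1[of "Suc j"] sum2[of "Suc j"] sum1[of 0] sum2[of 0] by simp
    finally show ?thesis
      unfolding lessThan_Suc_atMost[symmetric] sum.lessThan_Suc_shift by (simp add: A0_def)
  qed
  have unique: "A i j = A0 i j"
    if A: "\<forall>j<m. ws ! Suc j - ws ! 0 = (\<Sum>i<m. A i j *\<^sub>R (vs ! Suc i - vs ! 0))" and ij: "i < m" "j < m" for A i j
  proof -
    obtain L c where L: "linear L" and bL: "b (Suc i) = (\<lambda>x. L x + c)"
      using bary(1)[OF vs(2), of "vs ! Suc i"] unfolding affine_functional_def b_def by blast
    have bv: "b (Suc i) (vs ! k) = (if k = Suc i then 1 else 0)" if "k \<le> m" for k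
      using bary(2)[OF vs(2), of "vs ! k" "vs ! Suc i"] that ij m vs(1) by (simp add: b_def nth_eq_iff_index_eq)
    have "A0 i j = L (ws ! Suc j - ws ! 0)" by (simp add: A0_def bL linear_diff[OF L])
    also have "\<dots> = (\<Sum>k<m. A k j * (b (Suc i) (vs ! Suc k) - b (Suc i) (vs ! 0)))"
      using A ij by (simp add: linear_sum[OF L] linear_scale[OF L] linear_diff[OF L] bL)
    also have "\<dots> = (\<Sum>k<m. if k = i then A k j else 0)"
      using bv by (intro sum.cong) auto
    finally show ?thesis using ij by simp
  qed
  show ?thesis
  proof
    assume "compatibly_oriented vs ws"
    then obtain A where A: "\<forall>j<m. ws ! Suc j - ws ! 0 = (\<Sum>i<m. A i j *\<^sub>R (vs ! Suc i - vs ! 0))"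
        "Determinant.det (Matrix.mat m m (\<lambda>(i, j). A i j)) > (0::real)"
      by (auto simp: compatibly_oriented_def m)
    have "Matrix.mat m m (\<lambda>(i, j). A i j) = Matrix.mat m m (\<lambda>(i, j). A0 i j)"
      using unique[OF A(1)] by (intro eq_matI) auto
    then show "bary_det vs ws > 0" using det A(2) by simp
  next
    assume "bary_det vs ws > 0"
    then show "compatibly_oriented vs ws"
      unfolding compatibly_oriented_def using A0 det ws m by (auto intro!: exI[of _ A0])
  qed
qed

text \<open>Expansion along column 0, whose cofactors do not involve \<open>w\<close>. The function
  vanishes on \<open>us\<close> by \<open>bary_det_repeated\<close>, so its sign distinguishes the
  two sides of \<open>us\<close> within the affine hull of \<open>vs\<close>.\<close>

lemma bary_det_Cons:
  assumes "\<not> affine_dependent (set vs)"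
  shows "affine_functional (\<lambda>w. bary_det vs (w # us))"
proof -
  let ?n = "length vs"
  define B where "B w = Matrix.mat ?n ?n (\<lambda>(i, j). bary (set vs) (vs ! i) ((w # us) ! j))" for w
  have dims: "B w \<in> carrier_mat ?n ?n" for w by (simp add: B_def)
  show ?thesis
  proof (cases "?n = 0")
    case True
    then have "(\<lambda>w. bary_det vs (w # us)) = (\<lambda>w. 0 + 1)" by (auto simp: bary_det_def)
    moreover have "linear (\<lambda>w::'a. 0::real)" by (rule linear_zero)
    ultimately show ?thesis unfolding affine_functional_def by blast
  next
    case False
    have cof: "cofactor (B w) i 0 = cofactor (B 0) i 0" if "i < ?n" for w i
    proof -
      have "mat_delete (B w) i 0 = mat_delete (B 0) i 0"
        using that by (intro eq_matI) (auto simp: mat_delete_def B_def)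
      then show ?thesis by (simp add: cofactor_def)
    qed
    have "bary_det vs (w # us) = (\<Sum>i<?n. bary (set vs) (vs ! i) w * cofactor (B 0) i 0)" for w
    proof -
      have "bary_det vs (w # us) = (\<Sum>i<?n. B w $$ (i, 0) * cofactor (B w) i 0)"
        unfolding bary_det_def B_def[symmetric] using False by (intro laplace_expansion_column dims) simp
      also have "\<dots> = (\<Sum>i<?n. bary (set vs) (vs ! i) w * cofactor (B 0) i 0)"
        by (rule sum.cong[OF refl], subst cof) (use False in \<open>auto simp: B_def\<close>)
      finally show ?thesis .
    qed
    then have "(\<lambda>w. bary_det vs (w # us)) = (\<lambda>w. \<Sum>i<?n. bary (set vs) (vs ! i) w * cofactor (B 0) i 0)"
      by blast
    moreover have "affine_functional (\<lambda>w. \<Sum>i<?n. bary (set vs) (vs ! i) w * cofactor (B 0) i 0)"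
      by (rule affine_functional_sum) (rule bary(1)[OF assms])
    ultimately show ?thesis by simp
  qed
qed

lemma bary_det_repeated:
  assumes "u \<in> set us" "length vs = Suc (length us)"
  shows "bary_det vs (u # us) = 0"
proof -
  let ?n = "length vs"
  let ?A = "Matrix.mat ?n ?n (\<lambda>(i, j). bary (set vs) (vs ! i) ((u # us) ! j))"
  obtain k where k: "k < length us" "us ! k = u" using assms(1) by (auto simp: in_set_conv_nth)
  have "Determinant.det (transpose_mat ?A) = 0"
    by (rule det_identical_rows[of _ ?n 0 "Suc k"]) (use k assms(2) in \<open>auto intro!: eq_vecI\<close>)
  then show ?thesis by (simp add: bary_det_def det_transpose[of _ ?n])
qed

text \<open>If \<open>us\<close> lies in the facet opposite to the vertex \<open>j\<close>, only the entry of column 0 survives in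
  row \<open>j\<close>.\<close>

lemma bary_det_facet:
  assumes vs: "distinct vs" "\<not> affine_dependent (set vs)" and j: "j < length vs"
    and us: "length vs = Suc (length us)" "set us \<subseteq> affine hull set (remove_nth j vs)"
  shows "bary_det vs (w # us) = bary (set vs) (vs ! j) w * ((-1) ^ j * bary_det (remove_nth j vs) us)"
proof -
  let ?n = "length vs"
  let ?A = "Matrix.mat ?n ?n (\<lambda>(i, k). bary (set vs) (vs ! i) ((w # us) ! k))"
  have set: "set (remove_nth j vs) = set vs - {vs ! j}"
    using j vs(1) by (subst (3) id_take_nth_drop[OF j]) (auto simp: set_take_disj_set_drop_if_distinct
      in_set_conv_nth nth_eq_iff_index_eq)
  have sub: "set (remove_nth j vs) \<subseteq> set vs" by (rule set_remove_nth)
  have u: "us ! k \<in> affine hull set (remove_nth j vs)" if "k < length us" for k using us(2) that by auto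
  have zero: "bary (set vs) (vs ! j) (us ! k) = 0" if "k < length us" for k
    using bary_subset(2)[OF vs(2) sub u[OF that], of "vs ! j"] j unfolding set by simp
  have "bary_det vs (w # us) = (\<Sum>k<?n. ?A $$ (j, k) * cofactor ?A j k)"
    unfolding bary_det_def by (rule laplace_expansion_row[of _ ?n]) (use j in auto)
  also have "\<dots> = (\<Sum>k<?n. if k = 0 then bary (set vs) (vs ! j) w * cofactor ?A j 0 else 0)"
    using j zero us(1) by (intro sum.cong) (auto simp: nth_Cons split: nat.splits)
  also have "\<dots> = bary (set vs) (vs ! j) w * cofactor ?A j 0" using us(1) by simp
  also have "cofactor ?A j 0 = (-1) ^ j * Determinant.det (mat_delete ?A j 0)" by (simp add: cofactor_def)
  also have "mat_delete ?A j 0 = Matrix.mat (length (remove_nth j vs)) (length (remove_nth j vs))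
      (\<lambda>(i, k). bary (set (remove_nth j vs)) (remove_nth j vs ! i) (us ! k))"
  proof (rule eq_matI)
    fix i k assume "i < dim_row (Matrix.mat (length (remove_nth j vs)) (length (remove_nth j vs))
      (\<lambda>(i, k). bary (set (remove_nth j vs)) (remove_nth j vs ! i) (us ! k)))"
      "k < dim_col (Matrix.mat (length (remove_nth j vs)) (length (remove_nth j vs))
      (\<lambda>(i, k). bary (set (remove_nth j vs)) (remove_nth j vs ! i) (us ! k)))"
    then have ik: "i < length us" "k < length us" using j us(1) by auto
    have nth: "remove_nth j vs ! i = vs ! (if i < j then i else Suc i)"
      using ik us(1) j by (auto simp: nth_append)
    have "remove_nth j vs ! i \<in> set (remove_nth j vs)" using ik us(1) j by (intro nth_mem) auto
    then have "bary (set (remove_nth j vs)) (remove_nth j vs ! i) (us ! k) = bary (set vs) (remove_nth j vs ! i) (us ! k)"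
      by (rule bary_subset(1)[OF vs(2) sub u[OF ik(2)]])
    then show "mat_delete ?A j 0 $$ (i, k) = Matrix.mat (length (remove_nth j vs)) (length (remove_nth j vs))
      (\<lambda>(i, k). bary (set (remove_nth j vs)) (remove_nth j vs ! i) (us ! k)) $$ (i, k)"
      using ik us(1) j by (auto simp: mat_delete_def nth)
  qed (use j us(1) in \<open>auto simp: mat_delete_def\<close>)
  finally show ?thesis by (simp add: bary_det_def)
qed

section \<open>Cofaces in a subdivided simplex\<close>

definition barycenter :: "'a::real_vector set \<Rightarrow> 'a" where
  "barycenter U = (\<Sum>u\<in>U. (1 / card U) *\<^sub>R u)"

lemma affine_functional_barycenter:
  assumes "affine_functional f" "finite U" "U \<noteq> {}"
  shows "f (barycenter U) = (\<Sum>u\<in>U. f u) / card U"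
proof -
  have "f (barycenter U) = (\<Sum>u\<in>U. 1 / card U * f u)"
    unfolding barycenter_def by (rule affine_functional_combination[OF assms(1)]) (use assms in simp)
  then show ?thesis by (simp add: sum_divide_distrib)
qed

lemma barycenter_in_convex_hull:
  assumes "finite U" "U \<noteq> {}" shows "barycenter U \<in> convex hull U"
  unfolding convex_hull_finite[OF assms(1)] barycenter_def
  using assms by (auto intro!: exI[of _ "\<lambda>_. 1 / card U"])

lemma barycenter_in_rel_interior:
  fixes U :: "'a::euclidean_space set"
  assumes "\<not> affine_dependent U" "U \<noteq> {}" shows "barycenter U \<in> rel_interior (convex hull U)"
proof -
  have "finite U" using assms(1) by (rule aff_independent_finite)
  then show ?thesis
    unfolding rel_interior_convex_hull_explicit[OF assms(1)] barycenter_def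
    using assms(2) by (auto intro!: exI[of _ "\<lambda>_. 1 / card U"] simp: card_gt_0_iff)
qed

text \<open>Some simplex of the subdivision contains points arbitrarily close to the barycenter of \<open>us\<close> on
  the segment towards \<open>y\<close>; it has the simplex \<open>us\<close> as a face and a vertex on the side of \<open>y\<close>.\<close>

lemma coface_exists:
  fixes M :: "'a::euclidean_space set set"
  assumes M: "simplicial_complex M" and S: "convex S" "\<Union>{T\<in>M. T \<subseteq> S} = S"
    and us: "us \<in> simplex_lists M" "us \<noteq> []" "set us \<subseteq> S"
    and f: "affine_functional f" "\<And>u. u \<in> set us \<Longrightarrow> f u = 0"
    and y: "y \<in> S" "f y > 0"
  shows "\<exists>w\<in>S. f w > 0 \<and> w # us \<in> simplex_lists M"
proof -
  let ?U = "set us"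
  define x where "x = barycenter ?U"
  define p where "p m = (1 - 1 / real (Suc m)) *\<^sub>R x + (1 / real (Suc m)) *\<^sub>R y" for m :: nat
  note hull = simplex_listsD[OF M us(1)]
  have ne: "?U \<noteq> {}" using us(2) by simp
  have xF: "x \<in> convex hull ?U" unfolding x_def by (rule barycenter_in_convex_hull) (use ne in auto)
  have xS: "x \<in> S" using xF hull_minimal[where S = convex, OF us(3) S(1)] by blast
  have fx: "f x = 0" unfolding x_def using affine_functional_barycenter[OF f(1) _ ne] f(2) by simp
  have pS: "p m \<in> S" for m unfolding p_def by (rule convexD[OF S(1) xS y(1)]) auto
  have fp: "f (p m) > 0" for m
    unfolding p_def affine_functional_segment[OF f(1)] fx using y(2) by simp
  have "\<forall>m. \<exists>T\<in>{T\<in>M. T \<subseteq> S}. p m \<in> T" using pS S(2) by blast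
  then obtain T where T: "\<And>m. T m \<in> {T\<in>M. T \<subseteq> S}" "\<And>m. p m \<in> T m" by metis
  have "finite (range T)"
    by (rule finite_subset[of _ M]) (use T M in \<open>auto simp: simplicial_complex_def\<close>)
  then obtain m0 where "infinite {m \<in> UNIV. T m = T m0}"
    using pigeonhole_infinite[of UNIV T] by auto
  then have inf: "infinite {m. T m = T m0}" by simp
  let ?T = "T m0"
  have TM: "?T \<in> M" "?T \<subseteq> S" using T(1)[of m0] by auto
  have "x \<in> closure ?T"
    unfolding closure_approachable
  proof (intro allI impI)
    fix e :: real assume e: "e > 0"
    obtain k :: nat where k: "norm (y - x) / e < k" using reals_Archimedean2 by blast
    obtain m where m: "m > k" "T m = ?T" using inf unfolding infinite_nat_iff_unbounded by blast
    have "p m - x = (1 / real (Suc m)) *\<^sub>R (y - x)" by (simp add: p_def algebra_simps)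
    then have "dist (p m) x = norm (y - x) / real (Suc m)" by (simp add: dist_norm)
    also have "\<dots> < e"
    proof -
      have "norm (y - x) < k * e" using k e by (simp add: field_simps)
      also have "\<dots> \<le> real (Suc m) * e" using m e by (intro mult_right_mono) auto
      finally show ?thesis by (simp add: field_simps)
    qed
    finally show "\<exists>z\<in>?T. dist z x < e" using T(2)[of m] m(2) by metis
  qed
  then have xT: "x \<in> ?T" using simplicial_complex_compact(3)[OF M TM(1)] by simp
  let ?F = "convex hull ?U"
  have fc: "?F \<inter> ?T face_of ?F" by (rule simplicial_complex_Int[OF M hull(2) TM(1)])
  \<comment> \<open>A face of \<open>?F\<close> that meets its relative interior is all of
    \<open>?F\<close>.\<close>
  have "x \<in> (?F \<inter> ?T) \<inter> rel_interior ?F"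
    using xF xT barycenter_in_rel_interior[OF hull(1) ne] by (simp add: x_def)
  then have "?F \<subseteq> ?F \<inter> ?T" by (intro subset_of_face_of[OF fc subset_refl]) blast
  then have "?T \<inter> ?F = ?F" by blast
  then have F_face: "?F face_of ?T" using simplicial_complex_Int[OF M TM(1) hull(2)] by simp
  have U: "u extreme_point_of ?T" if "u \<in> ?U" for u
    using extreme_point_of_face[OF F_face] extreme_points_hull[OF hull(1)] that by blast
  let ?V = "{v. v extreme_point_of ?T}"
  note V = simplicial_complex_simplex[OF M TM(1)]
  have "p m0 \<in> convex hull ?V" using T(2)[of m0] V(3) by simp
  then obtain a where a: "\<forall>v\<in>?V. 0 \<le> a v" "sum a ?V = 1" "(\<Sum>v\<in>?V. a v *\<^sub>R v) = p m0"
    unfolding convex_hull_finite[OF V(2)] by blast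
  \<comment> \<open>The value of \<open>f\<close> at a point of \<open>?T\<close> is an average of
    its values at the vertices, so a positive value forces a vertex with positive value.\<close>
  have "f (p m0) = (\<Sum>v\<in>?V. a v * f v)"
    using affine_functional_combination[OF f(1) a(2), of "\<lambda>v. v"] a(3) by simp
  moreover have "(\<Sum>v\<in>?V. a v * f v) \<le> 0" if "\<forall>v\<in>?V. f v \<le> 0"
    using that a(1) by (intro sum_nonpos) (auto simp: mult_nonneg_nonpos)
  ultimately obtain w where w: "w extreme_point_of ?T" "f w > 0"
    using fp[of m0] by (metis mem_Collect_eq not_le)
  have "w \<in> S" using w(1) TM(2) by (auto simp: extreme_point_of_def)
  moreover have "w # us \<in> simplex_lists M" using w(1) U TM(1) by (auto simp: simplex_lists_def)
  ultimately show ?thesis using w(2) by blast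
qed

text \<open>Two cofaces of \<open>us\<close> on the same side would overlap near the barycenter of \<open>us\<close>.\<close>

lemma coface_unique:
  fixes M :: "'a::euclidean_space set set"
  assumes M: "simplicial_complex M"
    and w: "w # us \<in> simplex_lists M" "w' # us \<in> simplex_lists M" "us \<noteq> []"
    and aff: "w \<in> affine hull set (w' # us)"
    and f: "affine_functional f" "\<And>u. u \<in> set us \<Longrightarrow> f u = 0" "f w > 0" "f w' > 0"
  shows "w = w'"
proof -
  let ?U = "set us" and ?V = "set (w # us)" and ?V' = "set (w' # us)"
  define m where "m = real (card ?U)"
  have m: "m \<ge> 1" unfolding m_def using w(3) by (cases us) (auto simp: Suc_le_eq card_gt_0_iff)
  note h = simplex_listsD[OF M w(1)] and h' = simplex_listsD[OF M w(2)]
  have wU: "w \<notin> ?U" "w' \<notin> ?U" using f by force+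
  define x where "x = barycenter ?U"
  define B where "B = (\<Sum>u\<in>?U. \<bar>bary ?V' u w\<bar>)"
  \<comment> \<open>At each vertex of \<open>us\<close> the barycenter \<open>x\<close> has
    coordinate \<open>1 / m\<close>. Moving by \<open>e\<close> towards \<open>w\<close> leaves at
    least \<open>(1 - e * (1 + m * B)) / m\<close> of it, which this choice of \<open>e\<close>
    keeps positive.\<close>
  define e where "e = 1 / (2 + m * B)"
  have B: "- bary ?V' u w \<le> B" if "u \<in> ?U" for u
  proof -
    have "\<bar>bary ?V' u w\<bar> \<le> B"
      unfolding B_def using that by (intro member_le_sum) auto
    then show ?thesis using abs_ge_minus_self[of "bary ?V' u w"] by linarith
  qed
  have B0: "B \<ge> 0" unfolding B_def by (simp add: sum_nonneg)
  have pos: "2 + m * B > 0" using m B0 by (simp add: add_pos_nonneg)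
  have e: "0 < e" "e < 1" "e * (1 + m * B) < 1"
    using pos m B0 by (auto simp: e_def add_pos_nonneg divide_simps)
  define q where "q = (1 - e) *\<^sub>R x + e *\<^sub>R w"
  \<comment> \<open>As \<open>f\<close> vanishes on \<open>us\<close>, only the coordinate of
    \<open>w\<close> at \<open>w'\<close> contributes; being a quotient of positive values, it is
    positive.\<close>
  have fw: "f w = bary ?V' w' w * f w'"
  proof -
    have "f w = (\<Sum>v\<in>?V'. bary ?V' v w * f v)"
      using affine_functional_combination[OF f(1) bary_affine_hull(1)[OF h'(1) aff], of "\<lambda>v. v"]
        bary_affine_hull(2)[OF h'(1) aff] by simp
    also have "\<dots> = bary ?V' w' w * f w'" using f(2) wU(2) by simp
    finally show ?thesis .
  qed
  have pos': "bary ?V' w' w > 0"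
    using fw f(3,4) by (metis zero_less_mult_pos2)
  have bx: "bary ?V' u x = (if u = w' then 0 else 1 / m)" if "u \<in> ?V'" for u
  proof -
    have "bary ?V' u x = (\<Sum>v\<in>?U. bary ?V' u v) / m"
      unfolding x_def m_def
      by (rule affine_functional_barycenter[OF bary(1)[OF h'(1)]]) (use w(3) in auto)
    also have "(\<Sum>v\<in>?U. bary ?V' u v) = (\<Sum>v\<in>?U. if v = u then 1 else 0)"
      using bary(2)[OF h'(1)] by (intro sum.cong) auto
    finally show ?thesis using that wU(2) by auto
  qed
  have xU: "x \<in> convex hull ?U" unfolding x_def using w(3) by (intro barycenter_in_convex_hull) auto
  have "x \<in> affine hull ?V'"
    using xU convex_hull_subset_affine_hull[of ?U] hull_mono[of ?U ?V' affine] by auto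
  then have "q \<in> affine hull ?V'"
    unfolding q_def using aff by (intro mem_affine) (auto simp: affine_affine_hull)
  moreover have "bary ?V' v q \<ge> 0" if v: "v \<in> ?V'" for v
  proof -
    have q: "bary ?V' v q = (1 - e) * bary ?V' v x + e * bary ?V' v w"
      unfolding q_def by (rule affine_functional_segment[OF bary(1)[OF h'(1)]])
    show ?thesis
    proof (cases "v = w'")
      case True
      then show ?thesis using q bx[OF v] pos' e by simp
    next
      case False
      then have "- bary ?V' v w \<le> B" using B v by simp
      then have "e * bary ?V' v w \<ge> - (e * B)" using e(1) mult_left_mono[of "- bary ?V' v w" B e] by simp
      then have "bary ?V' v q \<ge> (1 - e) / m - e * B" using q bx[OF v] False by simp
      moreover have "(1 - e) / m - e * B = (1 - e * (1 + m * B)) / m" using m by (simp add: field_simps)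
      ultimately show ?thesis using e(3) m by (smt (verit) divide_nonneg_pos)
    qed
  qed
  ultimately have qT': "q \<in> convex hull ?V'" by (rule convex_hull_bary[OF h'(1)])
  have q_rel: "q \<in> rel_interior (convex hull ?V)"
    unfolding rel_interior_convex_hull_explicit[OF h(1)]
  proof (intro CollectI exI conjI)
    let ?c = "\<lambda>v. if v = w then e else (1 - e) / m"
    show "\<forall>v\<in>?V. 0 < ?c v" using e m by simp
    have c: "(\<Sum>v\<in>?U. ?c v) = (\<Sum>v\<in>?U. (1 - e) / m)"
      "(\<Sum>v\<in>?U. ?c v *\<^sub>R v) = (\<Sum>v\<in>?U. ((1 - e) / m) *\<^sub>R v)"
      by (rule sum.cong[OF refl], use wU(1) in force)+
    have "sum ?c ?V = e + (\<Sum>v\<in>?U. (1 - e) / m)"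
      unfolding c(1)[symmetric] using wU(1) by simp
    also have "(\<Sum>v\<in>?U. (1 - e) / m) = 1 - e" using w(3) by (simp add: m_def)
    finally show "sum ?c ?V = 1" by simp
    have "(\<Sum>v\<in>?V. ?c v *\<^sub>R v) = e *\<^sub>R w + (\<Sum>v\<in>?U. ((1 - e) / m) *\<^sub>R v)"
      unfolding c(2)[symmetric] using wU(1) by simp
    also have "(\<Sum>v\<in>?U. ((1 - e) / m) *\<^sub>R v) = (1 - e) *\<^sub>R x"
      by (simp add: x_def barycenter_def m_def scaleR_sum_right)
    finally show "(\<Sum>v\<in>?V. ?c v *\<^sub>R v) = q" by (simp add: q_def)
  qed
  \<comment> \<open>The point \<open>q\<close> is interior to \<open>?T\<close> and lies in
    \<open>?T'\<close>, so \<open>?T\<close> is a face of \<open>?T'\<close>. Thus \<open>w\<close>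
    is a vertex of \<open>?T'\<close>, and it is not in \<open>us\<close> because
    \<open>f w > 0\<close>.\<close>
  let ?T = "convex hull ?V" and ?T' = "convex hull ?V'"
  have fc: "?T \<inter> ?T' face_of ?T" by (rule simplicial_complex_Int[OF M h(2) h'(2)])
  have "q \<in> (?T \<inter> ?T') \<inter> rel_interior ?T"
    using qT' q_rel rel_interior_subset by blast
  then have "?T \<subseteq> ?T \<inter> ?T'" by (intro subset_of_face_of[OF fc subset_refl]) blast
  then have "?T' \<inter> ?T = ?T" by blast
  then have "?T face_of ?T'" using simplicial_complex_Int[OF M h'(2) h(2)] by simp
  moreover have "w extreme_point_of ?T" using extreme_points_hull[OF h(1)] by auto
  ultimately have "w extreme_point_of ?T'" using extreme_point_of_face by blast
  then have "w \<in> ?V'" using extreme_points_hull[OF h'(1)] by auto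
  then show ?thesis using f(2,3) by auto
qed

lemma affine_hull_eq_length:
  fixes vs ws :: "'a::euclidean_space list"
  assumes vs: "distinct vs" "\<not> affine_dependent (set vs)"
    and ws: "distinct ws" "\<not> affine_dependent (set ws)" "length ws = length vs" "set ws \<subseteq> affine hull set vs"
  shows "affine hull set ws = affine hull set vs"
proof (cases "ws = []")
  case True
  then show ?thesis using ws(3) by simp
next
  case False
  have "int (card (set ws)) = int (card (set vs))" using vs(1) ws(1,3) by (simp add: distinct_card)
  then have "aff_dim (set ws) = aff_dim (set vs)"
    using aff_dim_affine_independent[OF vs(2)] aff_dim_affine_independent[OF ws(2)] by linarith
  then show ?thesis
    using False ws(4) by (intro affine_dim_equal) (auto simp: hull_minimal aff_dim_affine_hull)
qed

lemma bary_det_vertex_nonzero: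
  assumes vs: "distinct vs" "\<not> affine_dependent (set vs)"
    and us: "distinct us" "\<not> affine_dependent (set us)" "length vs = Suc (length us)" "set us \<subseteq> affine hull set vs"
  shows "\<exists>i<length vs. bary_det vs (vs ! i # us) \<noteq> 0"
proof -
  have "\<not> set vs \<subseteq> affine hull set us"
  proof
    assume "set vs \<subseteq> affine hull set us"
    then have "aff_dim (set vs) \<le> aff_dim (set us)" by (metis aff_dim_affine_hull aff_dim_subset)
    then show False
      using aff_dim_affine_independent[OF vs(2)] aff_dim_affine_independent[OF us(2)] vs(1) us(1,3)
      by (simp add: distinct_card)
  qed
  then obtain i where i: "i < length vs" "vs ! i \<notin> affine hull set us"
    by (metis in_set_conv_nth subsetI)
  have "vs ! i \<notin> set us" using i(2) hull_inc[of "vs ! i" "set us" affine] by blast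
  then have "bary_det vs (vs ! i # us) \<noteq> 0"
    using us i affine_independent_insert[OF us(2) i(2)]
    by (intro bary_det_nonzero[OF vs]) (auto simp: hull_inc)
  then show ?thesis using i(1) by blast
qed

section \<open>Signed pieces and the count of cofaces\<close>

definition pieces :: "'a::euclidean_space set set \<Rightarrow> 'a list \<Rightarrow> 'a list set" where
  "pieces M vs = {ws \<in> simplex_lists M. distinct ws \<and> length ws = length vs \<and> set ws \<subseteq> convex hull set vs}"

text \<open>This is the coefficient function of the subdivided simplex, as
  \<open>lookup_subdivided_simplex\<close> shows; through it the chain map property becomes an
  identity between sums of signs.\<close>

definition piece_sign :: "'a::euclidean_space set set \<Rightarrow> 'a list \<Rightarrow> 'a list \<Rightarrow> real" where
  "piece_sign M vs ws = (if ws \<in> pieces M vs then sgn (bary_det vs ws) else 0)"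

lemma bary_det_piece_nonzero:
  assumes "simplicial_complex M" "distinct vs" "\<not> affine_dependent (set vs)" "ws \<in> pieces M vs"
  shows "bary_det vs ws \<noteq> 0"
  using assms simplex_listsD(1)[OF assms(1), of ws] convex_hull_subset_affine_hull[of "set vs"]
  by (intro bary_det_nonzero) (auto simp: pieces_def)

text \<open>The factor \<open>s\<close> selects the side of \<open>us\<close>. An affine function is
  positive somewhere on a simplex only if it is positive at a vertex; in that case
  \<open>coface_exists\<close> and \<open>coface_unique\<close> give exactly one coface on this
  side.\<close>

lemma card_cofaces:
  fixes M :: "'a::euclidean_space set set"
  assumes M: "simplicial_complex M" and vs: "distinct vs" "\<not> affine_dependent (set vs)"
    and S: "\<Union>{T\<in>M. T \<subseteq> convex hull set vs} = convex hull set vs"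
    and us: "us \<in> simplex_lists M" "us \<noteq> []" "set us \<subseteq> convex hull set vs" "distinct us"
      "length vs = Suc (length us)"
    and W: "\<And>ws. ws \<in> simplex_lists M \<Longrightarrow> set ws \<subseteq> W"
  shows "card {w\<in>W. w # us \<in> pieces M vs \<and> s * bary_det vs (w # us) > 0} =
    (if \<exists>i<length vs. s * bary_det vs (vs ! i # us) > 0 then 1 else 0)"
proof -
  let ?f = "\<lambda>w. s * bary_det vs (w # us)"
  let ?P = "\<lambda>w. w \<in> W \<and> w # us \<in> pieces M vs \<and> ?f w > 0"
  have "affine_functional (\<lambda>w. \<Sum>i\<in>{()}. bary_det vs (w # us) * s)"
    by (rule affine_functional_sum) (rule bary_det_Cons[OF vs(2)])
  then have f: "affine_functional ?f" by (simp add: mult.commute)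
  have f0: "?f u = 0" if "u \<in> set us" for u using bary_det_repeated[OF that us(5)] by simp
  show ?thesis
  proof (cases "\<exists>i<length vs. ?f (vs ! i) > 0")
    case True
    then obtain i where i: "i < length vs" "?f (vs ! i) > 0" by blast
    have "vs ! i \<in> convex hull set vs" using i(1) by (intro hull_inc) simp
    then obtain w where w: "w \<in> convex hull set vs" "?f w > 0" "w # us \<in> simplex_lists M"
      using coface_exists[OF M convex_convex_hull S us(1,2,3) f f0 _ i(2)] by blast
    have "w \<notin> set us" using w(2) f0 by force
    then have w_piece: "w # us \<in> pieces M vs" using w us by (auto simp: pieces_def)
    have "w' = w" if "?P w'" for w'
    proof (rule coface_unique[OF M _ w(3) us(2) _ f f0 _ w(2)])
      have hull: "affine hull set (w # us) = affine hull set vs"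
        using w_piece simplex_listsD(1)[OF M w(3)] convex_hull_subset_affine_hull[of "set vs"]
        by (intro affine_hull_eq_length[OF vs]) (auto simp: pieces_def)
      show "w' \<in> affine hull set (w # us)"
        unfolding hull using that convex_hull_subset_affine_hull[of "set vs"] by (auto simp: pieces_def)
    qed (use that in \<open>auto simp: pieces_def\<close>)
    moreover have "?P w" using w w_piece W[OF w(3)] by simp
    ultimately have "{w. ?P w} = {w}" by blast
    then show ?thesis unfolding if_P[OF True] by simp
  next
    case False
    have "\<not> ?P w" for w
    proof
      assume w: "?P w"
      then have wS: "w \<in> convex hull set vs" by (simp add: pieces_def)
      then obtain a where a: "\<forall>v\<in>set vs. 0 \<le> a v" "sum a (set vs) = 1" "(\<Sum>v\<in>set vs. a v *\<^sub>R v) = w"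
        unfolding convex_hull_finite[OF List.finite_set] by blast
      have "?f w = (\<Sum>v\<in>set vs. a v * ?f v)"
        using affine_functional_combination[OF f a(2), of "\<lambda>v. v"] a(3) by simp
      also have "\<dots> \<le> 0"
      proof (rule sum_nonpos, rule mult_nonneg_nonpos)
        fix v assume "v \<in> set vs"
        then show "0 \<le> a v" "?f v \<le> 0" using a(1) False by (simp, metis in_set_conv_nth not_less)
      qed
      finally show False using w by simp
    qed
    then have empty: "{w. ?P w} = {}" by blast
    show ?thesis unfolding empty if_not_P[OF False] by (rule card.empty)
  qed
qed

lemma facet_of_bary_zero:
  assumes vs: "distinct vs" "\<not> affine_dependent (set vs)" and j: "j < length vs"
    and u: "u \<in> convex hull set vs" "bary (set vs) (vs ! j) u = 0"
  shows "u \<in> convex hull set (remove_nth j vs)"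
proof -
  let ?b = "\<lambda>v. bary (set vs) v u"
  have set: "set (remove_nth j vs) = set vs - {vs ! j}"
    using j vs(1) by (subst (3) id_take_nth_drop[OF j]) (auto simp: set_take_disj_set_drop_if_distinct
      in_set_conv_nth nth_eq_iff_index_eq)
  have aff: "u \<in> affine hull set vs" using u(1) convex_hull_subset_affine_hull by blast
  have "sum ?b (set vs - {vs ! j}) = 1" "(\<Sum>v\<in>set vs - {vs ! j}. ?b v *\<^sub>R v) = u"
    using bary_affine_hull[OF vs(2) aff] u(2) j by (simp_all add: sum_diff1)
  moreover have "\<forall>v\<in>set vs - {vs ! j}. 0 \<le> ?b v" using bary_convex_hull[OF vs(2) u(1)] by blast
  ultimately show ?thesis unfolding set convex_hull_finite[OF finite_Diff[OF List.finite_set]]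
    by (intro CollectI exI[of _ ?b] conjI)
qed

text \<open>If \<open>us\<close> lies in no facet, the simplex extends to both sides of it and the
  two cofaces cancel. If \<open>us\<close> lies in a facet, only the side of the opposite vertex is
  occupied, and expansion of the determinant identifies the sign with that of \<open>us\<close> as a
  piece of the facet.\<close>

lemma piece_sign_boundary:
  fixes M :: "'a::euclidean_space set set"
  assumes M: "simplicial_complex M" and vs: "distinct vs" "\<not> affine_dependent (set vs)" "length vs \<ge> 2"
    and S: "\<Union>{T\<in>M. T \<subseteq> convex hull set vs} = convex hull set vs"
    and W: "finite W" "\<And>ws. ws \<in> simplex_lists M \<Longrightarrow> set ws \<subseteq> W"
  shows "(\<Sum>w\<in>W. piece_sign M vs (w # us)) =
     (\<Sum>j<length vs. (-1) ^ j * piece_sign M (remove_nth j vs) us)"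
proof -
  let ?good = "us \<in> simplex_lists M \<and> distinct us \<and> length vs = Suc (length us) \<and> set us \<subseteq> convex hull set vs"
  let ?l = "\<lambda>w. bary_det vs (w # us)"
  have sub: "set (remove_nth j vs) \<subseteq> set vs" for j by (rule set_remove_nth)
  have good1: ?good if "w # us \<in> pieces M vs" for w
    using that list_complexD[OF list_complex_simplex_lists, of "w # us" M us] by (auto simp: pieces_def)
  have piece_iff: "us \<in> pieces M (remove_nth j vs) \<longleftrightarrow> ?good \<and> set us \<subseteq> convex hull set (remove_nth j vs)"
    if "j < length vs" for j
    using that hull_mono[OF sub, of convex j] length_remove_nth[OF that] unfolding pieces_def by auto
  show ?thesis
  proof (cases ?good)
    case False
    then have "w # us \<notin> pieces M vs" "j < length vs \<Longrightarrow> us \<notin> pieces M (remove_nth j vs)" for w j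
      using good1 piece_iff by blast+
    then show ?thesis by (simp add: piece_sign_def)
  next
    case good: True
    then have us: "us \<in> simplex_lists M" "us \<noteq> []" "set us \<subseteq> convex hull set vs" "distinct us"
      "length vs = Suc (length us)" using vs(3) by auto
    have us_aff: "set us \<subseteq> affine hull set vs" using us(3) convex_hull_subset_affine_hull by blast
    note us_indep = simplex_listsD(1)[OF M us(1)]
    have l: "affine_functional ?l" by (rule bary_det_Cons[OF vs(2)])
    have nz: "\<exists>i<length vs. ?l (vs ! i) \<noteq> 0"
      by (rule bary_det_vertex_nonzero[OF vs(1,2) us(4) us_indep us(5) us_aff])
    \<comment> \<open>Splitting each sign into two indicators turns the sum into the number of
      cofaces on the positive side minus that on the negative side, each of them 0 or 1.\<close>
    have "(\<Sum>w\<in>W. piece_sign M vs (w # us)) =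
        (\<Sum>w\<in>W. of_bool (w # us \<in> pieces M vs \<and> 1 * ?l w > 0) - of_bool (w # us \<in> pieces M vs \<and> -1 * ?l w > 0))"
      by (intro sum.cong) (auto simp: piece_sign_def sgn_if)
    also have "\<dots> = real (card {w\<in>W. w # us \<in> pieces M vs \<and> 1 * ?l w > 0}) -
        real (card {w\<in>W. w # us \<in> pieces M vs \<and> -1 * ?l w > 0})"
      using W(1) by (simp add: sum_subtractf sum.If_cases of_bool_def Int_def Collect_conj_eq[symmetric])
    also have "\<dots> = of_bool (\<exists>i<length vs. ?l (vs ! i) > 0) - of_bool (\<exists>i<length vs. ?l (vs ! i) < 0)"
      using card_cofaces[OF M vs(1,2) S us W(2), of 1] card_cofaces[OF M vs(1,2) S us W(2), of "-1"]
      by (simp add: of_bool_def)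
    finally have lhs: "(\<Sum>w\<in>W. piece_sign M vs (w # us)) =
        of_bool (\<exists>i<length vs. ?l (vs ! i) > 0) - of_bool (\<exists>i<length vs. ?l (vs ! i) < 0)" .
    show ?thesis
    proof (cases "\<exists>j<length vs. set us \<subseteq> convex hull set (remove_nth j vs)")
      case True
      define C where "C j = (-1) ^ j * bary_det (remove_nth j vs) us" for j
      have facet: "?l (vs ! i) = (if i = j then C j else 0)"
        if "j < length vs" "i < length vs" "set us \<subseteq> convex hull set (remove_nth j vs)" for i j
      proof -
        have "set us \<subseteq> affine hull set (remove_nth j vs)"
          using that(3) convex_hull_subset_affine_hull by blast
        then have "?l (vs ! i) = bary (set vs) (vs ! j) (vs ! i) * C j"
          unfolding C_def by (rule bary_det_facet[OF vs(1,2) that(1) us(5)])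
        then show ?thesis using bary(2)[OF vs(2)] that vs(1) by (simp add: nth_eq_iff_index_eq)
      qed
      obtain j where j: "j < length vs" "set us \<subseteq> convex hull set (remove_nth j vs)" using True by blast
      have Cj: "C j \<noteq> 0" using nz facet[OF j(1) _ j(2)] by (auto split: if_splits)
      \<comment> \<open>Inside facet \<open>k\<close> the functional could be nonzero at vertex
        \<open>k\<close> only, whereas its value at vertex \<open>j\<close> is
        \<open>C j \<noteq> 0\<close>.\<close>
      have only: "k = j" if "k < length vs" "set us \<subseteq> convex hull set (remove_nth k vs)" for k
        using facet[OF that(1) j(1) that(2)] facet[OF j(1,1,2)] Cj by (auto split: if_splits)
      have "(-1) ^ k * piece_sign M (remove_nth k vs) us = (if k = j then sgn (C j) else 0)"
        if k: "k < length vs" for k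
      proof (cases "k = j")
        case True
        have "us \<in> pieces M (remove_nth j vs)" using piece_iff[OF j(1)] good j(2) by blast
        moreover have "sgn (C j) = (-1) ^ j * sgn (bary_det (remove_nth j vs) us)"
          unfolding C_def sgn_mult by (cases "even j") simp_all
        ultimately show ?thesis using True by (simp add: piece_sign_def)
      next
        case False
        then have "us \<notin> pieces M (remove_nth k vs)" using piece_iff[OF k] only[OF k] by blast
        then show ?thesis using False by (simp add: piece_sign_def)
      qed
      then have "(\<Sum>k<length vs. (-1) ^ k * piece_sign M (remove_nth k vs) us) =
          (\<Sum>k<length vs. if k = j then sgn (C j) else 0)"
        by (intro sum.cong) (simp_all del: set_append)
      also have "\<dots> = sgn (C j)" using j(1) by simp
      also have "\<dots> = of_bool (\<exists>i<length vs. ?l (vs ! i) > 0) - of_bool (\<exists>i<length vs. ?l (vs ! i) < 0)"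
      proof -
        have "(\<exists>i<length vs. ?l (vs ! i) > 0) \<longleftrightarrow> C j > 0" "(\<exists>i<length vs. ?l (vs ! i) < 0) \<longleftrightarrow> C j < 0"
          using facet[OF j(1) _ j(2)] j(1) by (auto split: if_splits)
        then show ?thesis using Cj by (simp add: sgn_if)
      qed
      finally show ?thesis using lhs by simp
    next
      case False
      let ?x = "barycenter (set us)"
      have ne: "set us \<noteq> {}" using us(2) by simp
      have xS: "?x \<in> convex hull set vs"
        using barycenter_in_convex_hull[OF List.finite_set ne] hull_minimal[where S = convex, OF us(3) convex_convex_hull] by blast
      then have xA: "?x \<in> affine hull set vs" using convex_hull_subset_affine_hull by blast
      \<comment> \<open>Some point of \<open>us\<close> lies off the facet opposite to vertex
        \<open>i\<close> and has a positive coordinate there; averaging with nonnegative coordinates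
        keeps it positive.\<close>
      have bpos: "bary (set vs) (vs ! i) ?x > 0" if i: "i < length vs" for i
      proof -
        obtain u where u: "u \<in> set us" "u \<notin> convex hull set (remove_nth i vs)" using False i by blast
        have nn: "bary (set vs) (vs ! i) u' \<ge> 0" if "u' \<in> set us" for u'
          using bary_convex_hull[OF vs(2)] us(3) that i by auto
        have "bary (set vs) (vs ! i) u \<noteq> 0"
          using facet_of_bary_zero[OF vs(1,2) i] u us(3) by blast
        then have "bary (set vs) (vs ! i) u > 0" using nn[OF u(1)] by simp
        then have "(\<Sum>u\<in>set us. bary (set vs) (vs ! i) u) > 0"
          using u(1) nn by (intro sum_pos2) auto
        then show ?thesis
          using affine_functional_barycenter[OF bary(1)[OF vs(2)] _ ne, of "vs ! i"] ne by (simp add: card_gt_0_iff)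
      qed
      have "?l ?x = (\<Sum>v\<in>set vs. bary (set vs) v ?x * ?l v)"
        using affine_functional_combination[OF l bary_affine_hull(1)[OF vs(2) xA], of "\<lambda>v. v"]
          bary_affine_hull(2)[OF vs(2) xA] by simp
      moreover have "?l ?x = 0"
        using affine_functional_barycenter[OF l _ ne] bary_det_repeated[OF _ us(5)] by simp
      ultimately have sum0: "(\<Sum>i<length vs. bary (set vs) (vs ! i) ?x * ?l (vs ! i)) = 0"
        by (simp add: sum_set_conv_nth[OF vs(1)])
      \<comment> \<open>A vanishing sum with positive weights whose values are not all zero has
        values of both signs.\<close>
      obtain i0 where i0: "i0 < length vs" "?l (vs ! i0) \<noteq> 0" using nz by blast
      have "\<exists>i<length vs. ?l (vs ! i) > 0"
      proof (rule ccontr)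
        assume "\<not> ?thesis"
        then have le: "?l (vs ! i) \<le> 0" if "i < length vs" for i using that by (meson not_less)
        have "(\<Sum>i<length vs. bary (set vs) (vs ! i) ?x * ?l (vs ! i)) < (\<Sum>i<length vs. 0)"
          using i0 le bpos by (intro sum_strict_mono_ex1)
            (auto intro!: bexI[of _ i0] simp: mult_le_0_iff mult_less_0_iff less_le)
        then show False using sum0 by simp
      qed
      moreover have "\<exists>i<length vs. ?l (vs ! i) < 0"
      proof (rule ccontr)
        assume "\<not> ?thesis"
        then have le: "?l (vs ! i) \<ge> 0" if "i < length vs" for i using that by (meson not_less)
        have "(\<Sum>i<length vs. 0) < (\<Sum>i<length vs. bary (set vs) (vs ! i) ?x * ?l (vs ! i))"
          using i0 le bpos by (intro sum_strict_mono_ex1)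
            (auto intro!: bexI[of _ i0] simp: zero_le_mult_iff zero_less_mult_iff less_le)
        then show False using sum0 by simp
      qed
      ultimately have "(\<Sum>w\<in>W. piece_sign M vs (w # us)) = 0" using lhs by simp
      then show ?thesis using False piece_iff by (auto simp: piece_sign_def intro!: sum.neutral[symmetric])
    qed
  qed
qed

section \<open>The subdivision map is a chain map\<close>

definition subdivided_simplex :: "'a::euclidean_space set set \<Rightarrow> 'a list \<Rightarrow> 'a chain" where
  "subdivided_simplex M vs = \<Sum>{oriented_simplex ws |ws. ordered_simplex (length vs - 1) M ws \<and>
         convex hull set ws \<subseteq> convex hull set vs \<and> compatibly_oriented vs ws}"

lemma linear_subdivision_chain: "linear (subdivision_chain M)"
  by (simp add: subdivision_chain_def linear_linear_extension)

lemma finite_simplex_lists: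
  assumes "simplicial_complex M"
  obtains W where "finite W" "\<And>ws. ws \<in> simplex_lists M \<Longrightarrow> set ws \<subseteq> W"
proof
  show "finite (\<Union>T\<in>M. {v. v extreme_point_of T})"
    using assms simplicial_complex_simplex(2)[OF assms] by (auto simp: simplicial_complex_def)
  show "set ws \<subseteq> (\<Union>T\<in>M. {v. v extreme_point_of T})" if "ws \<in> simplex_lists M" for ws
    using that unfolding simplex_lists_def by blast
qed

lemma subdivided_simplex_eq:
  assumes M: "simplicial_complex M" and vs: "distinct vs" "\<not> affine_dependent (set vs)" "vs \<noteq> []"
  shows "subdivided_simplex M vs = \<Sum>(oriented_simplex ` {ws \<in> pieces M vs. bary_det vs ws > 0})"
proof -
  have "{oriented_simplex ws |ws. ordered_simplex (length vs - 1) M ws \<and>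
         convex hull set ws \<subseteq> convex hull set vs \<and> compatibly_oriented vs ws} =
      oriented_simplex ` {ws \<in> pieces M vs. bary_det vs ws > 0}"
  proof -
    have hull: "convex hull set ws \<subseteq> convex hull set vs \<longleftrightarrow> set ws \<subseteq> convex hull set vs" for ws
      by (metis convex_convex_hull hull_minimal hull_subset subset_trans)
    have "ordered_simplex (length vs - 1) M ws \<and> convex hull set ws \<subseteq> convex hull set vs \<and> compatibly_oriented vs ws
       \<longleftrightarrow> ws \<in> pieces M vs \<and> bary_det vs ws > 0" for ws
    proof (cases "length ws = length vs \<and> set ws \<subseteq> convex hull set vs")
      case True
      then have "set ws \<subseteq> affine hull set vs" using convex_hull_subset_affine_hull by blast
      then show ?thesis
        using True compatibly_oriented_iff[OF vs, of ws] vs(3) unfolding ordered_simplex_iff[OF M] hull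
        by (auto simp: pieces_def)
    next
      case False
      then show ?thesis using vs(3) unfolding ordered_simplex_iff[OF M] hull by (auto simp: pieces_def)
    qed
    then show ?thesis by blast
  qed
  then show ?thesis by (simp add: subdivided_simplex_def)
qed

lemma finite_pieces: 
  assumes "simplicial_complex M" shows "finite (pieces M vs)"
proof -
  obtain W where "finite W" "\<And>ws. ws \<in> simplex_lists M \<Longrightarrow> set ws \<subseteq> W"
    using finite_simplex_lists[OF assms] by metis
  then show ?thesis
    by (intro finite_subset[OF _ finite_lists_length_eq[of W "length vs"]]) (auto simp: pieces_def)
qed

lemma pieces_permute:
  assumes "ws \<in> pieces M vs" "p permutes {..<length ws}"
  shows "permute_list p ws \<in> pieces M vs"
  using assms list_complexD[OF list_complex_simplex_lists, of ws M "permute_list p ws"]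
  by (auto simp: pieces_def)

text \<open>All positively oriented orderings of a piece are the same chain, which the set of chains
  contains once. At \<open>us\<close> only the chain
  \<open>sgn (bary_det vs us) *\<^sub>R oriented_simplex us\<close> can have a nonzero
  coefficient.\<close>

lemma lookup_subdivided_simplex:
  assumes M: "simplicial_complex M" and vs: "distinct vs" "\<not> affine_dependent (set vs)" "vs \<noteq> []"
  shows "Poly_Mapping.lookup (subdivided_simplex M vs) us = piece_sign M vs us"
proof -
  let ?Z = "oriented_simplex ` {ws \<in> pieces M vs. bary_det vs ws > 0}"
  have fin: "finite ?Z" using finite_pieces[OF M] by simp
  have lookup: "Poly_Mapping.lookup (subdivided_simplex M vs) us = (\<Sum>c\<in>?Z. Poly_Mapping.lookup c us)"
    unfolding subdivided_simplex_eq[OF assms] by (rule lookup_sum)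
  have perm: "\<exists>p. p permutes {..<length us} \<and> permute_list p us = ws"
    if "Poly_Mapping.lookup (oriented_simplex ws) us \<noteq> 0" for ws
    using lookup_oriented_simplex_mset[of us ws] that by (metis mset_eq_permutation)
  have single: "(\<Sum>c\<in>?Z. Poly_Mapping.lookup c us) = Poly_Mapping.lookup c0 us"
    if "c0 \<in> ?Z" "\<And>c. c \<in> ?Z \<Longrightarrow> Poly_Mapping.lookup c us \<noteq> 0 \<Longrightarrow> c = c0" for c0
  proof -
    have "(\<Sum>c\<in>?Z. Poly_Mapping.lookup c us) = (\<Sum>c\<in>{c0}. Poly_Mapping.lookup c us)"
      using that fin by (intro sum.mono_neutral_right) auto
    then show ?thesis by simp
  qed
  show ?thesis
  proof (cases "us \<in> pieces M vs")
    case False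
    have "Poly_Mapping.lookup (oriented_simplex ws) us = 0" if ws: "ws \<in> pieces M vs" for ws
    proof (rule ccontr)
      assume "Poly_Mapping.lookup (oriented_simplex ws) us \<noteq> 0"
      then have "mset us = mset ws" using lookup_oriented_simplex_mset by blast
      then obtain p where "p permutes {..<length ws}" "permute_list p ws = us"
        by (metis mset_eq_permutation)
      then show False using pieces_permute[OF ws] False by blast
    qed
    then show ?thesis using False unfolding lookup by (auto simp: piece_sign_def intro!: sum.neutral)
  next
    case True
    have us: "distinct us" "length us = length vs" using True by (auto simp: pieces_def)
    have self: "Poly_Mapping.lookup (oriented_simplex us) us = 1"
      by (rule lookup_oriented_simplex_self[OF us(1)])
    have nz: "bary_det vs us \<noteq> 0" by (rule bary_det_piece_nonzero[OF M vs(1,2) True])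
    have Z: "c = sgn (bary_det vs us) *\<^sub>R oriented_simplex us"
      if c: "c \<in> ?Z" "Poly_Mapping.lookup c us \<noteq> 0" for c
    proof -
      obtain ws where ws: "c = oriented_simplex ws" "bary_det vs ws > 0" using c(1) by blast
      obtain p where p: "p permutes {..<length us}" "permute_list p us = ws" using perm c(2) ws(1) by blast
      have "bary_det vs ws = of_int (sign p) * bary_det vs us"
        using bary_det_permute_right[OF p(1) us(2)] p(2) by simp
      moreover have "sign p = 1 \<or> sign p = -1" by (simp add: sign_def)
      ultimately have "of_int (sign p) = sgn (bary_det vs us)" using ws(2) by (auto simp: sgn_if)
      then show ?thesis using oriented_simplex_permute_list[OF p(1)] p(2) ws(1) by simp
    qed
    have "sgn (bary_det vs us) *\<^sub>R oriented_simplex us \<in> ?Z"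
    proof (cases "bary_det vs us > 0")
      case pos: True
      then show ?thesis using True by auto
    next
      case neg: False
      then have lt: "bary_det vs us < 0" using nz by simp
      \<comment> \<open>A negatively oriented ordering is made positive by swapping two vertices, so
        a single point must be excluded first; its determinant is 1.\<close>
      have "length us \<noteq> 1"
      proof
        assume "length us = 1"
        then obtain v u where "vs = [v]" "us = [u]" using us(2) by (auto simp: length_Suc_conv)
        moreover from this have "u = v" using True by (auto simp: pieces_def)
        ultimately have "bary_det vs us = 1"
          using bary(2)[OF vs(2), of v v] by (simp add: bary_det_def det_single)
        then show False using lt by simp
      qed
      then have len: "0 < length us" "1 < length us" using us(2) vs(3) by (auto simp: Suc_lessI)
      let ?t = "Transposition.transpose 0 1 :: nat \<Rightarrow> nat"
      have t: "?t permutes {..<length us}" using len by (intro permutes_swap_id) auto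
      have "sign ?t = -1" by (simp add: sign_swap_id)
      then have "bary_det vs (permute_list ?t us) > 0" "oriented_simplex (permute_list ?t us) = - oriented_simplex us"
        using bary_det_permute_right[OF t us(2)] lt oriented_simplex_permute_list[OF t] by simp_all
      then have "- oriented_simplex us \<in> ?Z" using pieces_permute[OF True t] by force
      then show ?thesis using lt by simp
    qed
    then have "Poly_Mapping.lookup (subdivided_simplex M vs) us =
        Poly_Mapping.lookup (sgn (bary_det vs us) *\<^sub>R oriented_simplex us) us"
      unfolding lookup using Z by (rule single)
    then show ?thesis using True self by (simp add: lookup_scaleR_chain piece_sign_def)
  qed
qed

text \<open>Alternation in \<open>vs\<close> is read off the coefficients: reordering
  \<open>vs\<close> permutes the rows of the determinant.\<close>

lemma subdivision_chain_oriented_simplex: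
  assumes M: "simplicial_complex M" and vs: "distinct vs" "\<not> affine_dependent (set vs)" "vs \<noteq> []"
  shows "subdivision_chain M (oriented_simplex vs) = subdivided_simplex M vs"
  unfolding subdivision_chain_def subdivided_simplex_def[symmetric]
proof (rule linear_extension_oriented_simplex)
  fix p assume p: "p permutes {..<length vs}"
  have vs': "distinct (permute_list p vs)" "\<not> affine_dependent (set (permute_list p vs))" "permute_list p vs \<noteq> []"
    using vs p by (simp_all, metis length_0_conv length_permute_list)
  have "piece_sign M (permute_list p vs) us = of_int (sign p) * piece_sign M vs us" for us
    using bary_det_permute_left[OF p, of us] p
    by (auto simp: piece_sign_def pieces_def sgn_mult sign_def)
  then show "subdivided_simplex M (permute_list p vs) = of_int (sign p) *\<^sub>R subdivided_simplex M vs"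
    by (intro poly_mapping_eqI)
      (simp add: lookup_scaleR_chain lookup_subdivided_simplex[OF M vs] lookup_subdivided_simplex[OF M vs'])
qed

lemma subdivided_simplex_in_alternating_chains:
  assumes M: "simplicial_complex M" and vs: "distinct vs" "\<not> affine_dependent (set vs)" "vs \<noteq> []"
  shows "subdivided_simplex M vs \<in> alternating_chains (simplex_lists {T\<in>M. T \<subseteq> convex hull set vs}) (length vs)"
  unfolding subdivided_simplex_eq[OF assms]
proof (rule subspace_sum[OF subspace_alternating_chains])
  fix c assume "c \<in> oriented_simplex ` {ws \<in> pieces M vs. bary_det vs ws > 0}"
  then obtain ws where ws: "ws \<in> pieces M vs" "c = oriented_simplex ws" by blast
  then have w: "ws \<in> simplex_lists M" and "set ws \<subseteq> convex hull set vs" by (auto simp: pieces_def)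
  then have "convex hull set ws \<subseteq> convex hull set vs"
    by (intro hull_minimal convex_convex_hull)
  then have "ws \<in> simplex_lists {T\<in>M. T \<subseteq> convex hull set vs}"
    using simplex_listsD[OF M w] by (intro simplex_listsI) simp_all
  then show "c \<in> alternating_chains (simplex_lists {T\<in>M. T \<subseteq> convex hull set vs}) (length vs)"
    using ws by (auto simp: pieces_def intro: oriented_simplex_in_alternating_chains)
qed

lemma lookup_boundary_alternating_chains:
  fixes c :: "'a chain"
  assumes "finite W" "\<And>vs. vs \<in> X \<Longrightarrow> set vs \<subseteq> W" "c \<in> alternating_chains X n"
  shows "Poly_Mapping.lookup (\<partial> c) us = (\<Sum>w\<in>W. Poly_Mapping.lookup c (w # us))"
proof (rule linear_eq_alternating_chains[OF _ _ _ assms(3)])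
  have lookup: "linear (\<lambda>c :: 'a chain. Poly_Mapping.lookup c ws)" for ws
    by (rule linearI) (simp_all add: lookup_add lookup_scaleR_chain)
  show "linear (\<lambda>c. Poly_Mapping.lookup (\<partial> c) us)"
    using linear_compose[OF linear_augmented_boundary lookup] by (simp add: o_def)
  show "linear (\<lambda>c :: 'a chain. \<Sum>w\<in>W. Poly_Mapping.lookup c (w # us))"
    by (rule linear_compose_sum) (simp add: lookup)
qed (rule lookup_augmented_boundary[OF assms(1) assms(2)])

text \<open>Coefficientwise this is \<open>piece_sign_boundary\<close>. At least two vertices keep
  the facets nonempty; the identity would fail for a vertex, because the empty list is subdivided
  into 0.\<close>

lemma boundary_subdivided_simplex:
  assumes M: "simplicial_complex M" and vs: "distinct vs" "\<not> affine_dependent (set vs)" "length vs \<ge> 2"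
    and S: "\<Union>{T\<in>M. T \<subseteq> convex hull set vs} = convex hull set vs"
  shows "\<partial> (subdivided_simplex M vs) = face_sum (subdivided_simplex M) vs"
proof (rule poly_mapping_eqI)
  fix us
  have ne: "vs \<noteq> []" using vs(3) by auto
  obtain W where W: "finite W" "\<And>ws. ws \<in> simplex_lists M \<Longrightarrow> set ws \<subseteq> W"
    using finite_simplex_lists[OF M] by metis
  have "set ws \<subseteq> W" if "ws \<in> simplex_lists {T\<in>M. T \<subseteq> convex hull set vs}" for ws
    using W(2) simplex_lists_mono[of "{T\<in>M. T \<subseteq> convex hull set vs}" M] that by blast
  from lookup_boundary_alternating_chains[OF W(1) this subdivided_simplex_in_alternating_chains[OF M vs(1,2) ne]]
  have "Poly_Mapping.lookup (\<partial> (subdivided_simplex M vs)) us = (\<Sum>w\<in>W. piece_sign M vs (w # us))"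
    by (simp add: lookup_subdivided_simplex[OF M vs(1,2) ne])
  also have "\<dots> = (\<Sum>j<length vs. (-1) ^ j * piece_sign M (remove_nth j vs) us)"
    by (rule piece_sign_boundary[OF M vs S W])
  also have "\<dots> = (\<Sum>j<length vs. (-1) ^ j * Poly_Mapping.lookup (subdivided_simplex M (remove_nth j vs)) us)"
  proof (rule sum.cong[OF refl])
    fix j assume j: "j \<in> {..<length vs}"
    have 1: "distinct (remove_nth j vs)"
      using vs(1) set_take_disj_set_drop_if_distinct[OF vs(1), of j "Suc j"] by auto
    have 2: "\<not> affine_dependent (set (remove_nth j vs))"
      using vs(2) set_remove_nth[of j vs] affine_dependent_subset by blast
    have 3: "remove_nth j vs \<noteq> []" using vs(3) j by auto
    show "(-1) ^ j * piece_sign M (remove_nth j vs) us =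
        (-1) ^ j * Poly_Mapping.lookup (subdivided_simplex M (remove_nth j vs)) us"
      by (simp only: lookup_subdivided_simplex[OF M 1 2 3])
  qed
  also have "\<dots> = Poly_Mapping.lookup (face_sum (subdivided_simplex M) vs) us"
    by (simp add: face_sum_def lookup_sum lookup_scaleR_chain)
  finally show "Poly_Mapping.lookup (\<partial> (subdivided_simplex M vs)) us =
      Poly_Mapping.lookup (face_sum (subdivided_simplex M) vs) us" .
qed

lemma boundary_subdivision_chain:
  assumes sub: "subdivision N M" and z: "z \<in> alternating_chains (simplex_lists N) (Suc (Suc n))"
  shows "\<partial> (subdivision_chain M z) = subdivision_chain M (\<partial> z)"
proof -
  note N = subdivisionD(1)[OF sub] and M = subdivisionD(2)[OF sub]
  have "(\<partial> \<circ> subdivision_chain M) z = (subdivision_chain M \<circ> \<partial>) z"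
  proof (rule linear_eq_alternating_chains[OF _ _ _ z])
    fix vs assume vs: "vs \<in> simplex_lists N" "length vs = Suc (Suc n)"
    note simp = simplex_listsD[OF N vs(1)]
    show "(\<partial> \<circ> subdivision_chain M) (oriented_simplex vs) = (subdivision_chain M \<circ> \<partial>) (oriented_simplex vs)"
    proof (cases "distinct vs")
      case True
      have sc: "subdivision_chain M (oriented_simplex ws) = subdivided_simplex M ws"
        if "distinct ws" "set ws \<subseteq> set vs" "ws \<noteq> []" for ws
        using that simp(1) affine_dependent_subset by (intro subdivision_chain_oriented_simplex[OF M]) blast+
      have "face_sum (\<lambda>l. subdivision_chain M (oriented_simplex l)) vs = face_sum (subdivided_simplex M) vs"
        unfolding face_sum_def
      proof (rule sum.cong[OF refl])
        fix j assume j: "j \<in> {..<length vs}"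
        have 1: "distinct (remove_nth j vs)"
          using True set_take_disj_set_drop_if_distinct[OF True, of j "Suc j"] by auto
        have 2: "remove_nth j vs \<noteq> []" using vs(2) j by auto
        show "(-1) ^ j *\<^sub>R subdivision_chain M (oriented_simplex (remove_nth j vs)) =
            (-1) ^ j *\<^sub>R subdivided_simplex M (remove_nth j vs)"
          by (simp only: sc[OF 1 set_remove_nth 2])
      qed
      moreover have "\<partial> (subdivided_simplex M vs) = face_sum (subdivided_simplex M) vs"
        using vs(2) by (intro boundary_subdivided_simplex[OF M True simp(1)] subdivisionD(4)[OF sub simp(2)]) simp
      moreover have "subdivision_chain M (oriented_simplex vs) = subdivided_simplex M vs"
        using True vs(2) by (intro sc) auto
      ultimately show ?thesis
        by (simp add: augmented_boundary_oriented_simplex face_sum_linear[OF linear_subdivision_chain])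
    next
      case False
      then show ?thesis
        by (simp add: oriented_simplex_not_distinct linear_0[OF linear_subdivision_chain]
            linear_0[OF linear_augmented_boundary])
    qed
  qed (intro linear_compose linear_augmented_boundary linear_subdivision_chain)+
  then show ?thesis by simp
qed

lemma subdivision_chain_in_alternating_chains:
  assumes N: "simplicial_complex N" and M: "simplicial_complex M" and vs: "vs \<in> simplex_lists N" "vs \<noteq> []"
  shows "subdivision_chain M (oriented_simplex vs) \<in>
    alternating_chains (simplex_lists {T\<in>M. T \<subseteq> convex hull set vs}) (length vs)"
proof (cases "distinct vs")
  case True
  then show ?thesis
    using subdivision_chain_oriented_simplex[OF M True simplex_listsD(1)[OF N vs(1)] vs(2)]
      subdivided_simplex_in_alternating_chains[OF M True simplex_listsD(1)[OF N vs(1)] vs(2)] by simp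
next
  case False
  then show ?thesis
    by (simp add: oriented_simplex_not_distinct linear_0[OF linear_subdivision_chain]
        subspace_0[OF subspace_alternating_chains])
qed

text \<open>This replaces the chain map property in the lowest degree, where it makes the carried
  homotopy compatible with the augmentation.\<close>

lemma subdivision_chain_vertex:
  assumes sub: "subdivision N M" and v: "[v] \<in> simplex_lists N"
  shows "subdivision_chain M (oriented_simplex [v]) = oriented_simplex [v]"
proof -
  note M = subdivisionD(2)[OF sub]
  have "{v} \<in> N" using simplex_listsD(2)[OF subdivisionD(1)[OF sub] v] by simp
  then have "\<Union>{T\<in>M. T \<subseteq> {v}} = {v}" by (rule subdivisionD(4)[OF sub])
  then obtain T where "T \<in> M" "T \<subseteq> {v}" "v \<in> T" by blast
  then have "{v} \<in> M" by (metis singletonD subset_antisym subset_iff)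
  then have "[v] \<in> simplex_lists M" by (intro simplex_listsI) (auto simp: affine_independent_1)
  then have "[v] \<in> pieces M [v]" by (simp add: pieces_def)
  moreover have "bary_det [v] [v] = 1"
    using bary(2)[of "{v}" v v] by (simp add: bary_det_def det_single)
  ultimately have "{ws \<in> pieces M [v]. bary_det [v] ws > 0} = {[v]}"
    by (auto simp: pieces_def length_Suc_conv)
  then show ?thesis
    using subdivision_chain_oriented_simplex[OF M, of "[v]"] subdivided_simplex_eq[OF M, of "[v]"]
    by (simp add: affine_independent_1)
qed

section \<open>Acyclicity of the quotient\<close>

lemma simplex_lists_length:
  fixes M :: "'a::euclidean_space set set"
  assumes M: "simplicial_complex M" and us: "us \<in> simplex_lists {T\<in>M. T \<subseteq> convex hull V}"
    and V: "\<not> affine_dependent V" and d: "distinct us"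
  shows "length us \<le> card V"
proof -
  have "us \<in> simplex_lists M" using us simplex_lists_mono[of "{T\<in>M. T \<subseteq> convex hull V}" M] by blast
  then have indep: "\<not> affine_dependent (set us)" by (rule simplex_listsD(1)[OF M])
  have "set us \<subseteq> convex hull V" using us by (auto simp: simplex_lists_def extreme_point_of_def)
  then have "aff_dim (set us) \<le> aff_dim V" by (metis aff_dim_convex_hull aff_dim_subset)
  then show ?thesis
    using aff_dim_affine_independent[OF indep] aff_dim_affine_independent[OF V] d
    by (simp add: distinct_card)
qed

text \<open>The composition of the simplicial map given by \<open>r\<close> with the subdivision map is homotopic to
  the identity by a homotopy carried by the least simplex of \<open>N\<close>. On a subdivided simplex this
  homotopy vanishes for dimension reasons, so a chain whose boundary is subdivided is itself
  subdivided up to a boundary.\<close>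

lemma relative_cycle_subdivision:
  fixes N M :: "'a::euclidean_space set set"
  assumes sub: "subdivision N M" and n: "n \<ge> 1"
    and z: "z \<in> alternating_chains (simplex_lists M) (Suc n)"
    and bd: "\<partial> z = subdivision_chain M c" and c: "c \<in> alternating_chains (simplex_lists N) n"
  obtains x y where "x \<in> alternating_chains (simplex_lists N) (Suc n)"
    "y \<in> alternating_chains (simplex_lists M) (Suc (Suc n))" "z = subdivision_chain M x + \<partial> y"
proof -
  let ?X = "simplex_lists M"
  let ?os = "oriented_simplex :: 'a list \<Rightarrow> 'a chain"
  let ?i = "subdivision_chain M"
  note N = subdivisionD(1)[OF sub] and M = subdivisionD(2)[OF sub]
  have "\<forall>v\<in>\<Union>N. \<exists>w. \<forall>S\<in>N. v \<in> S \<longrightarrow> w extreme_point_of S" using common_vertex[OF N] by blast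
  then obtain r where r0: "\<forall>v\<in>\<Union>N. \<forall>S\<in>N. v \<in> S \<longrightarrow> r v extreme_point_of S"
    unfolding bchoice_iff by blast
  have r: "r v extreme_point_of S" if "S \<in> N" "v \<in> S" for v S using r0 that by blast
  have "\<exists>S. S \<in> N \<and> set vs \<subseteq> S \<and> (\<forall>T\<in>N. set vs \<subseteq> T \<longrightarrow> S face_of T)" if vs: "vs \<in> ?X" for vs
  proof -
    obtain S where S: "S \<in> N" "convex hull set vs \<subseteq> S"
      using subdivisionD(3)[OF sub] simplex_listsD(2)[OF M vs] by blast
    have "set vs \<subseteq> S" using S(2) hull_subset[of "set vs" convex] by blast
    show ?thesis
    proof (rule least_simplex[OF N S(1) \<open>set vs \<subseteq> S\<close>])
      fix T assume "T \<in> N" "set vs \<subseteq> T" "\<And>S. S \<in> N \<Longrightarrow> set vs \<subseteq> S \<Longrightarrow> T face_of S"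
      then show ?thesis by (intro exI[of _ T]) simp
    qed
  qed
  then have "\<forall>vs\<in>?X. \<exists>S. S \<in> N \<and> set vs \<subseteq> S \<and> (\<forall>T\<in>N. set vs \<subseteq> T \<longrightarrow> S face_of T)" by blast
  then obtain car where car0: "\<forall>vs\<in>?X. car vs \<in> N \<and> set vs \<subseteq> car vs \<and> (\<forall>T\<in>N. set vs \<subseteq> T \<longrightarrow> car vs face_of T)"
    unfolding bchoice_iff by blast
  have car: "car vs \<in> N" "set vs \<subseteq> car vs" if "vs \<in> ?X" for vs using car0 that by blast+
  have car_least: "car vs \<subseteq> T" if "vs \<in> ?X" "T \<in> N" "set vs \<subseteq> T" for vs T
    using car0 that face_of_imp_subset by blast
  let ?A = "\<lambda>vs. simplex_lists {T\<in>M. T \<subseteq> car vs}"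
  have A_le: "?A vs \<subseteq> ?X" for vs by (rule simplex_lists_mono) blast
  have r_list: "map r vs \<in> simplex_lists N" "set (map r vs) \<subseteq> car vs" if vs: "vs \<in> ?X" for vs
  proof -
    have e: "r v extreme_point_of car vs" if "v \<in> set vs" for v
      using r[OF car(1)[OF vs]] car(2)[OF vs] that by blast
    then show "map r vs \<in> simplex_lists N" using car(1)[OF vs] unfolding simplex_lists_def by auto
    show "set (map r vs) \<subseteq> car vs" using e by (auto simp: extreme_point_of_def)
  qed
  have push_r: "push_chain r z \<in> alternating_chains (simplex_lists N) n" if "z \<in> alternating_chains ?X n" for z n
    by (rule linear_image_alternating_chains[OF linear_push_chain subspace_alternating_chains _ that])
      (use r_list(1) in \<open>auto simp: push_chain_oriented_simplex intro!: oriented_simplex_in_alternating_chains\<close>)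
  \<comment> \<open>The value 0 in degree 0 is set by hand: \<open>subdivision_chain\<close> sends
    the empty simplex to 0, so the general formula would not make the two maps agree there.\<close>
  define \<phi> where "\<phi> n z = (if n = 0 then 0 else z - ?i (push_chain r z))" for n :: nat and z
  have lin_ir: "linear (\<lambda>z. ?i (push_chain r z))"
    using linear_compose[OF linear_push_chain linear_subdivision_chain] by (simp add: o_def)
  have lin_\<phi>: "linear (\<phi> n)" for n
  proof (cases "n = 0")
    case True
    then have "\<phi> n = (\<lambda>z. 0)" by (auto simp: \<phi>_def)
    then show ?thesis by (simp add: linear_zero)
  next
    case False
    then have "\<phi> n = (\<lambda>z. z - ?i (push_chain r z))" by (auto simp: \<phi>_def)
    then show ?thesis using linear_compose_sub[OF linear_id lin_ir] by (simp add: id_def)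
  qed
  obtain E where E: "E 0 = (\<lambda>_. 0)" "\<And>n. linear (E n)"
    "\<And>n vs. \<lbrakk>vs \<in> ?X; length vs = n\<rbrakk> \<Longrightarrow> E n (?os vs) \<in> alternating_chains (?A vs) (n + 1)"
    "\<And>n z. z \<in> alternating_chains ?X (Suc n) \<Longrightarrow> \<partial> (E (Suc n) z) = \<phi> (Suc n) z - E n (\<partial> z)"
  proof (rule acyclic_carrier[of ?X ?A \<phi> 1 "\<lambda>_. 0", OF list_complex_simplex_lists])
    show "?A ws \<subseteq> ?A vs" if vs: "vs \<in> ?X" and ws: "set ws \<subseteq> set vs" for vs ws
    proof -
      have "ws \<in> ?X" by (rule list_complexD[OF list_complex_simplex_lists vs ws])
      then have "car ws \<subseteq> car vs" using car[OF vs] ws by (intro car_least) auto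
      then show ?thesis by (intro simplex_lists_mono) blast
    qed
    show "\<exists>y\<in>alternating_chains (?A vs) (Suc n). \<partial> y = z"
      if vs: "vs \<in> ?X" "vs \<noteq> []" and z: "z \<in> alternating_chains (?A vs) n" "\<partial> z = 0" for vs n z
    proof (rule acyclic_convex_union[OF simplicial_complex_restrict[OF M] _ _ z])
      have union: "\<Union>{T\<in>M. T \<subseteq> car vs} = car vs" by (rule subdivisionD(4)[OF sub car(1)[OF vs(1)]])
      show "convex (\<Union>{T\<in>M. T \<subseteq> car vs})"
        unfolding union by (rule simplicial_complex_compact(2)[OF N car(1)[OF vs(1)]])
      show "\<Union>{T\<in>M. T \<subseteq> car vs} \<noteq> {}"
        unfolding union using car(2)[OF vs(1)] vs(2) by (cases vs) auto
    qed
    show "\<phi> (Suc n) (?os vs) \<in> alternating_chains (?A vs) (n + 1)"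
      if vs: "vs \<in> ?X" "length vs = Suc n" for vs n
    proof -
      have cvx: "convex (car vs)" by (rule simplicial_complex_compact(2)[OF N car(1)[OF vs(1)]])
      have hull1: "convex hull set vs \<subseteq> car vs" by (rule hull_minimal[where S = convex, OF car(2)[OF vs(1)] cvx])
      have hull2: "convex hull set (map r vs) \<subseteq> car vs"
        by (rule hull_minimal[where S = convex, OF r_list(2)[OF vs(1)] cvx])
      have "vs \<in> ?A vs" using hull1 simplex_listsD[OF M vs(1)] by (intro simplex_listsI) simp_all
      then have 1: "?os vs \<in> alternating_chains (?A vs) (n + 1)"
        using vs(2) by (intro oriented_simplex_in_alternating_chains) auto
      have "{T\<in>M. T \<subseteq> convex hull set (map r vs)} \<subseteq> {T\<in>M. T \<subseteq> car vs}" using hull2 by blast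
      then have "alternating_chains (simplex_lists {T\<in>M. T \<subseteq> convex hull set (map r vs)}) (n + 1)
          \<subseteq> alternating_chains (?A vs) (n + 1)"
        by (intro alternating_chains_mono simplex_lists_mono)
      moreover have "?i (?os (map r vs)) \<in>
          alternating_chains (simplex_lists {T\<in>M. T \<subseteq> convex hull set (map r vs)}) (length (map r vs))"
        by (rule subdivision_chain_in_alternating_chains[OF N M r_list(1)[OF vs(1)]]) (use vs(2) in auto)
      ultimately have 2: "?i (?os (map r vs)) \<in> alternating_chains (?A vs) (n + 1)"
        using vs(2) by auto
      show ?thesis
        unfolding \<phi>_def push_chain_oriented_simplex
        using subspace_diff[OF subspace_alternating_chains 1 2] by simp
    qed
    show "\<partial> (\<phi> (Suc n) (?os vs)) = \<phi> n (\<partial> (?os vs))" if vs: "vs \<in> ?X" "length vs = Suc n" for vs n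
    proof (cases n)
      \<comment> \<open>The points \<open>v\<close> and \<open>r v\<close> both have the empty
        simplex as augmented boundary, so the difference is a cycle, in accordance with
        \<open>\<phi> 0\<close>.\<close>
      case 0
      then obtain v where v: "vs = [v]" using vs(2) by (auto simp: length_Suc_conv)
      have "?i (?os [r v]) = ?os [r v]" using r_list(1)[OF vs(1)] v by (intro subdivision_chain_vertex[OF sub]) simp
      then show ?thesis
        using 0 v by (simp add: \<phi>_def push_chain_oriented_simplex linear_diff[OF linear_augmented_boundary]
            augmented_boundary_oriented_simplex face_sum_Cons)
    next
      case (Suc m)
      have mem: "?os vs \<in> alternating_chains ?X (Suc (Suc m))"
        using vs Suc by (intro oriented_simplex_in_alternating_chains) auto
      have "\<partial> (?i (push_chain r (?os vs))) = ?i (push_chain r (\<partial> (?os vs)))"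
        using boundary_subdivision_chain[OF sub push_r[OF mem]]
        by (simp add: augmented_boundary_push_chain_oriented_simplex)
      then show ?thesis using Suc by (simp add: \<phi>_def linear_diff[OF linear_augmented_boundary])
    qed
    show "linear (\<phi> n)" for n by (rule lin_\<phi>)
  qed (auto simp: linear_zero linear_0[OF linear_augmented_boundary] \<phi>_def subspace_0[OF subspace_alternating_chains])
  have E_i: "E n (?i c) = 0"
  proof -
    have "(E n \<circ> ?i) c = (\<lambda>_. 0) c"
    proof (rule linear_eq_alternating_chains[OF _ linear_zero _ c])
      show "linear (E n \<circ> ?i)" by (intro linear_compose linear_subdivision_chain E(2))
      fix vs assume vs: "vs \<in> simplex_lists N" "length vs = n"
      let ?S = "convex hull set vs"
      note simp = simplex_listsD[OF N vs(1)]
      have img: "?i (?os vs) \<in> alternating_chains (simplex_lists {T\<in>M. T \<subseteq> ?S}) n"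
        using subdivision_chain_in_alternating_chains[OF N M vs(1)] vs(2) n by (cases vs) auto
      have "E n (?os ws) \<in> {0}" if ws: "ws \<in> simplex_lists {T\<in>M. T \<subseteq> ?S}" "length ws = n" for ws
      proof -
        have wsX: "ws \<in> ?X" using ws(1) simplex_lists_mono[of "{T\<in>M. T \<subseteq> ?S}" M] by blast
        have "set ws \<subseteq> ?S" using ws(1) by (auto simp: simplex_lists_def extreme_point_of_def)
        then have "car ws \<subseteq> ?S" by (rule car_least[OF wsX simp(2)])
        then have sub': "?A ws \<subseteq> simplex_lists {T\<in>M. T \<subseteq> ?S}" by (intro simplex_lists_mono) blast
        have "?os us = 0" if us: "us \<in> ?A ws" "length us = n + 1" for us
        proof (rule oriented_simplex_not_distinct, rule notI)
          assume "distinct us"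
          then have "length us \<le> card (set vs)"
            using us(1) sub' by (intro simplex_lists_length[OF M _ simp(1)]) auto
          then show False using us(2) vs(2) card_length[of vs] by simp
        qed
        then have "alternating_chains (?A ws) (n + 1) \<subseteq> {0}"
          unfolding alternating_chains_def by (intro span_minimal subspace_single_0) auto
        then show ?thesis using E(3)[OF wsX ws(2)] by blast
      qed
      from linear_image_alternating_chains[OF E(2) subspace_single_0 this img]
      have "E n (?i (?os vs)) \<in> {0}" .
      then show "(E n \<circ> ?i) (?os vs) = 0" by simp
    qed
    then show ?thesis by simp
  qed
  show ?thesis
  proof (rule that)
    show "push_chain r z \<in> alternating_chains (simplex_lists N) (Suc n)" by (rule push_r[OF z])
    show "E (Suc n) z \<in> alternating_chains ?X (Suc (Suc n))"
    proof (rule linear_image_alternating_chains[OF E(2) subspace_alternating_chains _ z])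
      fix vs assume vs: "vs \<in> ?X" "length vs = Suc n"
      show "E (Suc n) (?os vs) \<in> alternating_chains ?X (Suc (Suc n))"
        using E(3)[OF vs] alternating_chains_mono[OF A_le, of vs "Suc n + 1"] by auto
    qed
    \<comment> \<open>By the homotopy formula, \<open>z - ?i (push_chain r z)\<close> is the
      boundary of \<open>E (Suc n) z\<close> plus \<open>E n\<close> of the boundary of
      \<open>z\<close>. The last term is \<open>E n (?i c) = 0\<close>.\<close>
    show "z = ?i (push_chain r z) + \<partial> (E (Suc n) z)"
      using E(4)[OF z] E_i bd by (simp add: \<phi>_def)
  qed
qed

section \<open>Orthogonal complements\<close>

lemma inner_product_onD:
  assumes "inner_product_on C g" "subspace C"
  shows "\<lbrakk>x \<in> C; y \<in> C\<rbrakk> \<Longrightarrow> g x y = g y x"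
    "\<lbrakk>x \<in> C; y \<in> C; z \<in> C\<rbrakk> \<Longrightarrow> g (x + y) z = g x z + g y z"
    "\<lbrakk>x \<in> C; y \<in> C\<rbrakk> \<Longrightarrow> g (a *\<^sub>R x) y = a * g x y"
    "\<lbrakk>x \<in> C; x \<noteq> 0\<rbrakk> \<Longrightarrow> g x x > 0"
    "\<lbrakk>x \<in> C; y \<in> C; z \<in> C\<rbrakk> \<Longrightarrow> g x (y + z) = g x y + g x z"
    "\<lbrakk>x \<in> C; y \<in> C\<rbrakk> \<Longrightarrow> g x (a *\<^sub>R y) = a * g x y"
    "\<lbrakk>x \<in> C; y \<in> C; z \<in> C\<rbrakk> \<Longrightarrow> g x (y - z) = g x y - g x z"
    "x \<in> C \<Longrightarrow> g x 0 = 0"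
proof -
  note def = assms(1)[unfolded inner_product_on_def]
  note sym = def[THEN conjunct1, rule_format]
    and add = def[THEN conjunct2, THEN conjunct1, rule_format]
    and scale = def[THEN conjunct2, THEN conjunct2, THEN conjunct1, rule_format]
    and pos = def[THEN conjunct2, THEN conjunct2, THEN conjunct2, rule_format]
  have add': "g x (y + z) = g x y + g x z" if "x \<in> C" "y \<in> C" "z \<in> C" for x y z
    using add[OF that(2,3,1)] sym[OF that(1) subspace_add[OF assms(2) that(2,3)]]
      sym[OF that(1,2)] sym[OF that(1,3)] by simp
  have scale': "g x (a *\<^sub>R y) = a * g x y" if "x \<in> C" "y \<in> C" for a x y
    using scale[OF that(2,1)] sym[OF that(1) subspace_scale[OF assms(2) that(2)]] sym[OF that] by simp
  have diff': "g x (y - z) = g x y - g x z" if "x \<in> C" "y \<in> C" "z \<in> C" for x y z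
    using add'[OF that(1,2), of "(-1) *\<^sub>R z"] scale'[OF that(1,3), of "-1"]
      subspace_scale[OF assms(2) that(3), of "-1"] by simp
  show "\<lbrakk>x \<in> C; y \<in> C\<rbrakk> \<Longrightarrow> g x y = g y x"
    "\<lbrakk>x \<in> C; y \<in> C; z \<in> C\<rbrakk> \<Longrightarrow> g (x + y) z = g x z + g y z"
    "\<lbrakk>x \<in> C; y \<in> C\<rbrakk> \<Longrightarrow> g (a *\<^sub>R x) y = a * g x y"
    "\<lbrakk>x \<in> C; x \<noteq> 0\<rbrakk> \<Longrightarrow> g x x > 0"
    "\<lbrakk>x \<in> C; y \<in> C; z \<in> C\<rbrakk> \<Longrightarrow> g x (y + z) = g x y + g x z"
    "\<lbrakk>x \<in> C; y \<in> C\<rbrakk> \<Longrightarrow> g x (a *\<^sub>R y) = a * g x y"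
    "\<lbrakk>x \<in> C; y \<in> C; z \<in> C\<rbrakk> \<Longrightarrow> g x (y - z) = g x y - g x z"
    "x \<in> C \<Longrightarrow> g x 0 = 0"
    by (fact sym add scale pos add' scale' diff')+ (use diff'[of x 0 0] subspace_0[OF assms(2)] in simp)
qed

definition orthogonal_complement_in :: "('b \<Rightarrow> 'b \<Rightarrow> real) \<Rightarrow> 'b set \<Rightarrow> 'b set \<Rightarrow> 'b set" where
  "orthogonal_complement_in g C W = {v \<in> C. \<forall>w\<in>W. g w v = 0}"

lemma subspace_orthogonal_complement_in:
  assumes g: "inner_product_on C g" "subspace C" and W: "W \<subseteq> C"
  shows "subspace (orthogonal_complement_in g C W)"
  unfolding orthogonal_complement_in_def
proof (rule subspaceI)
  note ip = inner_product_onD[OF g]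
  show "0 \<in> {v \<in> C. \<forall>w\<in>W. g w v = 0}" using ip(8) W subspace_0[OF g(2)] by auto
  show "x + y \<in> {v \<in> C. \<forall>w\<in>W. g w v = 0}"
    if "x \<in> {v \<in> C. \<forall>w\<in>W. g w v = 0}" "y \<in> {v \<in> C. \<forall>w\<in>W. g w v = 0}" for x y
    using that W ip(5) subspace_add[OF g(2)] by (auto simp: subset_iff)
  show "c *\<^sub>R x \<in> {v \<in> C. \<forall>w\<in>W. g w v = 0}" if "x \<in> {v \<in> C. \<forall>w\<in>W. g w v = 0}" for c x
    using that W ip(6) subspace_scale[OF g(2)] by (auto simp: subset_iff)
qed

text \<open>Gram-Schmidt as an induction: the hypothesis, applied to the new vector
  \<open>b\<close>, makes it orthogonal to \<open>span B\<close>, and the projection of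
  \<open>x\<close> is then corrected along the resulting vector \<open>e\<close>.\<close>

lemma orthogonal_projection_exists:
  assumes g: "inner_product_on C g" "subspace C" and B: "finite B" "B \<subseteq> C" and x: "x \<in> C"
  shows "\<exists>w\<in>span B. \<forall>u\<in>span B. g u (x - w) = 0"
  using B x
proof (induction B arbitrary: x rule: finite_induct)
  case empty
  then show ?case using inner_product_onD(1,8)[OF g] subspace_0[OF g(2)] inner_product_onD(3)[OF g, of 0 x 0] by simp
next
  case (insert b B)
  note ip = inner_product_onD[OF g]
  have BC: "span B \<subseteq> C" using insert.prems g(2) by (intro span_minimal) auto
  have bC: "b \<in> C" using insert.prems by simp
  obtain w0 where w0: "w0 \<in> span B" "\<forall>u\<in>span B. g u (x - w0) = 0" using insert by blast
  obtain b0 where b0: "b0 \<in> span B" "\<forall>u\<in>span B. g u (b - b0) = 0" using insert.IH[of b] insert.prems bC by blast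
  define e where "e = b - b0"
  have w0C: "w0 \<in> C" and b0C: "b0 \<in> C" using w0 b0 BC by auto
  have eC: "e \<in> C" unfolding e_def by (rule subspace_diff[OF g(2) bC b0C])
  define y where "y = x - w0"
  have yC: "y \<in> C" unfolding y_def by (rule subspace_diff[OF g(2) insert.prems(2) w0C])
  \<comment> \<open>The Fourier coefficient along \<open>e\<close>. If \<open>b\<close> already lies
    in \<open>span B\<close>, then \<open>e = 0\<close>, and the correction vanishes whatever the
    quotient is.\<close>
  define c where "c = g e y / g e e"
  have ce: "g e (y - c *\<^sub>R e) = 0"
  proof (cases "e = 0")
    case True
    then show ?thesis using ip(1)[OF eC yC] ip(8)[OF yC] by simp
  next
    case False
    then show ?thesis
      using ip(4)[OF eC] ip(7)[OF eC yC subspace_scale[OF g(2) eC]] ip(6)[OF eC eC] by (simp add: c_def)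
  qed
  show ?case
  proof (intro bexI[of _ "w0 + c *\<^sub>R e"] ballI)
    have "b \<in> span (insert b B)" by (simp add: span_base)
    moreover have "w0 \<in> span (insert b B)" "b0 \<in> span (insert b B)"
      using w0(1) b0(1) span_mono[of B "insert b B"] by auto
    ultimately show "w0 + c *\<^sub>R e \<in> span (insert b B)"
      unfolding e_def by (intro span_add span_scale span_diff)
    fix u assume "u \<in> span (insert b B)"
    then obtain k where k: "u - k *\<^sub>R b \<in> span B" using span_breakdown_eq by blast
    define u' where "u' = (u - k *\<^sub>R b) + k *\<^sub>R b0"
    have u': "u' \<in> span B" unfolding u'_def by (intro span_add span_scale k b0(1))
    then have u'C: "u' \<in> C" using BC by blast
    have u: "u = u' + k *\<^sub>R e" by (simp add: u'_def e_def algebra_simps)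
    have yce: "y - c *\<^sub>R e \<in> C" by (intro subspace_diff subspace_scale g(2) yC eC)
    have "g u (y - c *\<^sub>R e) = g u' (y - c *\<^sub>R e) + k * g e (y - c *\<^sub>R e)"
      unfolding u using ip(2)[OF u'C subspace_scale[OF g(2) eC] yce] ip(3)[OF eC yce] by simp
    also have "g u' (y - c *\<^sub>R e) = g u' y - c * g u' e"
      using ip(7)[OF u'C yC subspace_scale[OF g(2) eC]] ip(6)[OF u'C eC] by simp
    also have "\<dots> = 0" using w0(2) b0(2) u' by (simp add: y_def e_def)
    finally show "g u (x - (w0 + c *\<^sub>R e)) = 0" using ce by (simp add: y_def algebra_simps)
  qed
qed

lemma orthogonal_complement_direct_sum:
  assumes g: "inner_product_on C g" "subspace C" and fin: "finite B" "C = span B"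
    and W: "subspace W" "W \<subseteq> C"
  shows "is_orthogonal_direct_sum g C W (orthogonal_complement_in g C W)"
proof -
  let ?V = "orthogonal_complement_in g C W"
  note ip = inner_product_onD[OF g]
  obtain B' where B': "B' \<subseteq> W" "independent B'" "W \<subseteq> span B'"
    using maximal_independent_subset by blast
  then have "B' \<subseteq> span B" using W(2) fin(2) by blast
  then have finB': "finite B'" using independent_span_bound[OF fin(1) B'(2)] by blast
  have span: "span B' = W" using B' W(1) span_minimal by blast
  have V: "subspace ?V" by (rule subspace_orthogonal_complement_in[OF g W(2)])
  have "C \<subseteq> W + ?V"
  proof
    fix x assume x: "x \<in> C"
    obtain w where w: "w \<in> W" "\<forall>u\<in>W. g u (x - w) = 0"
      using orthogonal_projection_exists[OF g finB' _ x] B'(1) W(2) span by blast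
    have "x - w \<in> ?V"
      using w W(2) subspace_diff[OF g(2) x] by (auto simp: orthogonal_complement_in_def)
    moreover have "x = w + (x - w)" by simp
    ultimately show "x \<in> W + ?V" using w(1) unfolding set_plus_def by blast
  qed
  moreover have "W + ?V \<subseteq> C"
    using W(2) subspace_add[OF g(2)] by (auto simp: set_plus_def orthogonal_complement_in_def subset_iff)
  moreover have "W \<inter> ?V = {0}"
  proof -
    have "v = 0" if "v \<in> W" "v \<in> ?V" for v
      using that ip(4)[of v] by (force simp: orthogonal_complement_in_def)
    then show ?thesis using subspace_0[OF W(1)] subspace_0[OF V] by blast
  qed
  ultimately show ?thesis
    using W(1) V by (auto simp: is_orthogonal_direct_sum_def is_direct_sum_def orthogonal_complement_in_def)
qed

text \<open>The last hypothesis says that \<open>C / I\<close> is acyclic in positive degrees.\<close>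

lemma orthogonal_complements_of_acyclic_quotient:
  fixes C I :: "nat \<Rightarrow> 'b::real_vector set"
  assumes g: "\<And>k. inner_product_on (C k) (g k)"
    and C: "\<And>k. \<exists>B. finite B \<and> C k = span B" and top: "\<And>k. k \<ge> K \<Longrightarrow> C k = {0}"
    and I: "\<And>k. subspace (I k)" "\<And>k. I k \<subseteq> C k"
    and d: "linear d" "\<And>k x. x \<in> C (Suc k) \<Longrightarrow> d x \<in> C k" "\<And>k x. x \<in> I (Suc k) \<Longrightarrow> d x \<in> I k"
      "\<And>k x. x \<in> C (Suc (Suc k)) \<Longrightarrow> d (d x) = 0"
    and acyclic: "\<And>k z. \<lbrakk>z \<in> C (Suc k); d z \<in> I k\<rbrakk> \<Longrightarrow> \<exists>x\<in>I (Suc k). \<exists>y\<in>C (Suc (Suc k)). z = x + d y"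
  shows "\<exists>V. \<forall>k. subspace (V k) \<and> V k \<subseteq> C k \<and>
     (\<exists>W. is_direct_sum W (I k) (d ` V (Suc k)) \<and> is_orthogonal_direct_sum (g k) (C k) W (V k))"
proof -
  let ?oc = "\<lambda>k X. orthogonal_complement_in (g k) (C k) (I k + d ` X)"
  have subC: "subspace (C k)" for k using C[of k] by auto
  note ip = inner_product_onD[OF g subC]
  \<comment> \<open>The stage \<open>j\<close> belongs to degree \<open>K - j\<close>, which turns
    the descending recursion into a primitive one. Stages beyond \<open>K\<close>, where the
    subtraction truncates, are never read.\<close>
  define U where "U = rec_nat {0} (\<lambda>j X. ?oc (K - Suc j) X)"
  have U: "U 0 = {0}" "U (Suc j) = ?oc (K - Suc j) (U j)" for j by (simp_all add: U_def)
  define V where "V k = U (K - k)" for k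
  have zero_in: "0 \<in> ?oc k X" if "X \<subseteq> C (Suc k)" for k X
    using ip(8)[of _ k] subspace_0[OF subC] d(2)[of _ k] I(2)[of k] subspace_add[OF subC, of _ k] that
    unfolding orthogonal_complement_in_def set_plus_def by (auto simp: subset_iff)
  have V_C: "V k \<subseteq> C k" for k
  proof (cases "k < K")
    case True
    then have "K - k = Suc (K - Suc k)" "K - Suc (K - Suc k) = k" by auto
    then show ?thesis using U(2)[of "K - Suc k"] by (auto simp: V_def orthogonal_complement_in_def)
  next
    case False
    then show ?thesis using U(1) subspace_0[OF subC] by (simp add: V_def)
  qed
  have V: "V k = ?oc k (V (Suc k))" for k
  proof (cases "k < K")
    case True
    then have "K - k = Suc (K - Suc k)" "K - Suc (K - Suc k) = k" by auto
    then show ?thesis using U(2)[of "K - Suc k"] by (simp add: V_def)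
  next
    \<comment> \<open>From degree \<open>K\<close> on both sides are \<open>{0}\<close>, since the
      chain space is; the recursive equation thus holds in all degrees.\<close>
    case False
    then have 0: "V k = {0}" "C k = {0}" using U(1) top by (auto simp: V_def)
    have "?oc k (V (Suc k)) \<subseteq> {0}" unfolding 0(2)[symmetric] by (auto simp: orthogonal_complement_in_def)
    moreover have "0 \<in> ?oc k (V (Suc k))" by (rule zero_in[OF V_C])
    ultimately show ?thesis unfolding 0(1) by (intro subset_antisym) simp_all
  qed
  let ?W = "\<lambda>k. I k + d ` V (Suc k)"
  have W_C: "?W k \<subseteq> C k" for k
    using I(2)[of k] d(2)[of _ k] V_C[of "Suc k"] subspace_add[OF subC]
    by (auto simp: set_plus_def subset_iff)
  have subV: "subspace (V k)" for k
    unfolding V[of k] by (rule subspace_orthogonal_complement_in[OF g subC W_C])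
  have subdV: "subspace (d ` V (Suc k))" for k by (rule linear_subspace_image[OF d(1) subV])
  have subW: "subspace (?W k)" for k
  proof -
    have "?W k = {x + y |x y. x \<in> I k \<and> y \<in> d ` V (Suc k)}" unfolding set_plus_def by blast
    then show ?thesis using subspace_sums[OF I(1) subdV] by simp
  qed
  have orth: "is_orthogonal_direct_sum (g k) (C k) (?W k) (V k)" for k
  proof -
    obtain B where "finite B" "C k = span B" using C by blast
    then show ?thesis
      using orthogonal_complement_direct_sum[OF g subC _ _ subW W_C] V[of k] by metis
  qed
  have decomp: "\<exists>a\<in>I k. \<exists>v\<in>V (Suc k). \<exists>v'\<in>V k. x = a + d v + v'" if "x \<in> C k" for k x
    using orth[of k] that unfolding is_orthogonal_direct_sum_def is_direct_sum_def set_plus_def by blast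
  have vanish: "v = 0" if v: "v \<in> V (Suc k)" "d v \<in> I k" for k v
  proof -
    have vC: "v \<in> C (Suc k)" using v(1) V_C by blast
    obtain x y where xy: "x \<in> I (Suc k)" "y \<in> C (Suc (Suc k))" "v = x + d y"
      using acyclic[OF vC v(2)] by blast
    obtain a w w' where y: "a \<in> I (Suc (Suc k))" "w \<in> V (Suc (Suc (Suc k)))" "w' \<in> V (Suc (Suc k))"
      "y = a + d w + w'" using decomp[OF xy(2)] by blast
    have "d (d w) = 0" using y(2) V_C by (intro d(4)) blast
    then have "v = (x + d a) + d w'" using xy(3) y(4) by (simp add: linear_add[OF d(1)])
    moreover have "x + d a \<in> I (Suc k)" by (rule subspace_add[OF I(1) xy(1) d(3)[OF y(1)]])
    ultimately have "v \<in> ?W (Suc k)" using y(3) unfolding set_plus_def by blast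
    moreover have "v \<in> ?oc (Suc k) (V (Suc (Suc k)))" using v(1) V[of "Suc k"] by simp
    ultimately have "g (Suc k) v v = 0" by (simp add: orthogonal_complement_in_def)
    then show ?thesis using ip(4)[OF vC] by fastforce
  qed
  have "I k \<inter> d ` V (Suc k) = {0}" for k
  proof -
    have "x = 0" if x: "x \<in> I k" "x \<in> d ` V (Suc k)" for x
    proof -
      obtain v where v: "v \<in> V (Suc k)" "x = d v" using x(2) by auto
      then have "v = 0" using x(1) vanish[of v k] by simp
      then show ?thesis using v(2) linear_0[OF d(1)] by simp
    qed
    then show ?thesis using subspace_0[OF I(1)[of k]] subspace_0[OF subdV[of k]] by blast
  qed
  then have "is_direct_sum (?W k) (I k) (d ` V (Suc k))" for k
    using I(1) subdV by (simp add: is_direct_sum_def)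
  then show ?thesis using subV V_C orth by blast
qed

text \<open>The two boundaries can differ only on points. Here the number of vertices is at least 2,
  which covers every degree in which the theorem takes a boundary.\<close>

lemma boundary_chain_eq:
  assumes "z \<in> alternating_chains X (Suc (Suc n))" shows "boundary_chain z = \<partial> z"
proof (rule linear_eq_alternating_chains[OF _ linear_augmented_boundary _ assms])
  show "linear boundary_chain" unfolding boundary_chain_def by (rule linear_linear_extension)
qed (rule boundary_chain_oriented_simplex, simp)

theorem theorem2p7:
  fixes N M :: "'a::euclidean_space set set"
    and g :: "nat \<Rightarrow> 'a chain \<Rightarrow> 'a chain \<Rightarrow> real"
  assumes "subdivision N M"
    and "\<And>k. inner_product_on (simplicial_chains k M) (g k)"
  shows "\<exists>V :: nat \<Rightarrow> 'a chain set. \<forall>k.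
     subspace (V k) \<and> V k \<subseteq> simplicial_chains k M \<and>
     (\<exists>W. is_direct_sum W (subdivision_chain M ` simplicial_chains k N) (boundary_chain ` V (Suc k)) \<and>
          is_orthogonal_direct_sum (g k) (simplicial_chains k M) W (V k))"
proof -
  note sub = assms(1)
  note N = subdivisionD(1)[OF sub] and M = subdivisionD(2)[OF sub]
  let ?C = "\<lambda>k. simplicial_chains k M" and ?I = "\<lambda>k. subdivision_chain M ` simplicial_chains k N"
  obtain W where W: "finite W" "\<And>ws. ws \<in> simplex_lists M \<Longrightarrow> set ws \<subseteq> W"
    using finite_simplex_lists[OF M] by metis
  note C_eq = simplicial_chains_eq[OF M] and N_eq = simplicial_chains_eq[OF N]
  note bd_eq = boundary_chain_eq[of _ "simplex_lists M"]
  have bd_C: "\<partial> z \<in> alternating_chains (simplex_lists M) n"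
    if "z \<in> alternating_chains (simplex_lists M) (Suc n)" for z n
    by (rule augmented_boundary_in_alternating_chains[OF list_complex_simplex_lists that])
  have I_C: "subdivision_chain M c \<in> alternating_chains (simplex_lists M) (Suc k)"
    if "c \<in> alternating_chains (simplex_lists N) (Suc k)" for c k
  proof (rule linear_image_alternating_chains[OF linear_subdivision_chain subspace_alternating_chains _ that])
    fix vs assume vs: "vs \<in> simplex_lists N" "length vs = Suc k"
    have "alternating_chains (simplex_lists {T\<in>M. T \<subseteq> convex hull set vs}) (Suc k)
        \<subseteq> alternating_chains (simplex_lists M) (Suc k)"
      by (intro alternating_chains_mono simplex_lists_mono) blast
    moreover have "vs \<noteq> []" using vs(2) by auto
    ultimately show "subdivision_chain M (oriented_simplex vs) \<in> alternating_chains (simplex_lists M) (Suc k)"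
      using subdivision_chain_in_alternating_chains[OF N M vs(1)] vs(2) by auto
  qed
  show ?thesis
  proof (rule orthogonal_complements_of_acyclic_quotient[where C = ?C and I = ?I and K = "card W" and d = boundary_chain])
    show "inner_product_on (?C k) (g k)" for k by (rule assms(2))
    show "\<exists>B. finite B \<and> ?C k = span B" for k
    proof (intro exI conjI)
      show "?C k = span (oriented_simplex ` {vs \<in> simplex_lists M. length vs = Suc k})"
        unfolding C_eq alternating_chains_def ..
      show "finite (oriented_simplex ` {vs \<in> simplex_lists M. length vs = Suc k})"
        using W by (intro finite_imageI finite_subset[OF _ finite_lists_length_eq[of W "Suc k"]]) auto
    qed
    \<comment> \<open>A simplex of dimension \<open>k\<close> has \<open>k + 1\<close> distinct
      vertices in \<open>W\<close>; this is the origin of the bound \<open>card W\<close> for the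
      top degree.\<close>
    show "?C k = {0}" if "card W \<le> k" for k
    proof -
      have "oriented_simplex vs = 0" if "vs \<in> simplex_lists M" "length vs = Suc k" for vs
      proof (rule oriented_simplex_not_distinct, rule notI)
        assume "distinct vs"
        then have "Suc k \<le> card W" using card_mono[OF W(1) W(2)[OF that(1)]] that(2) by (simp add: distinct_card)
        then show False using \<open>card W \<le> k\<close> by simp
      qed
      then have "?C k \<subseteq> {0}"
        unfolding C_eq alternating_chains_def by (intro span_minimal subspace_single_0) auto
      then show ?thesis using subspace_0[OF subspace_alternating_chains] unfolding C_eq by blast
    qed
    show "subspace (?I k)" for k
      unfolding N_eq by (intro linear_subspace_image linear_subdivision_chain subspace_alternating_chains)
    show "?I k \<subseteq> ?C k" for k unfolding C_eq N_eq using I_C by blast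
    show "linear boundary_chain" unfolding boundary_chain_def by (rule linear_linear_extension)
    show "boundary_chain x \<in> ?C k" if "x \<in> ?C (Suc k)" for k x
      using that bd_eq bd_C unfolding C_eq by simp
    show "boundary_chain x \<in> ?I k" if x: "x \<in> ?I (Suc k)" for k x
    proof -
      obtain c where c: "c \<in> alternating_chains (simplex_lists N) (Suc (Suc k))" "x = subdivision_chain M c"
        using x unfolding N_eq by blast
      have "boundary_chain x = subdivision_chain M (\<partial> c)"
        using bd_eq[OF I_C[OF c(1)]] boundary_subdivision_chain[OF sub c(1)] c(2) by simp
      moreover have "\<partial> c \<in> alternating_chains (simplex_lists N) (Suc k)"
        by (rule augmented_boundary_in_alternating_chains[OF list_complex_simplex_lists c(1)])
      ultimately show ?thesis unfolding N_eq by blast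
    qed
    show "boundary_chain (boundary_chain x) = 0" if x: "x \<in> ?C (Suc (Suc k))" for k x
      using x bd_eq[of x "Suc k"] bd_eq[of "\<partial> x" k] bd_C[of x "Suc (Suc k)"] augmented_boundary_twice
      unfolding C_eq by metis
    show "\<exists>x\<in>?I (Suc k). \<exists>y\<in>?C (Suc (Suc k)). z = x + boundary_chain y"
      if z: "z \<in> ?C (Suc k)" "boundary_chain z \<in> ?I k" for k z
    proof -
      have zC: "z \<in> alternating_chains (simplex_lists M) (Suc (Suc k))" using z(1) unfolding C_eq .
      obtain c where c: "c \<in> alternating_chains (simplex_lists N) (Suc k)" "\<partial> z = subdivision_chain M c"
        using z(2) bd_eq[OF zC] unfolding N_eq by auto
      obtain x y where xy: "x \<in> alternating_chains (simplex_lists N) (Suc (Suc k))"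
        "y \<in> alternating_chains (simplex_lists M) (Suc (Suc (Suc k)))" "z = subdivision_chain M x + \<partial> y"
        by (rule relative_cycle_subdivision[OF sub _ zC c(2,1)]) simp
      then show ?thesis
        unfolding C_eq N_eq using bd_eq[OF xy(2)]
        by (intro bexI[of _ "subdivision_chain M x"] bexI[of _ y] imageI) simp_all
    qed
  qed
qed

end
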